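(* For any $l,k\in\mathbb{Z}_{\ge 0}\cup\{\infty\}$ with $k\ge l\ge 3$, there exists a hypergraph $\mathcal{C}$ with $\psi(\mathcal{C})=l$ and $\operatorname{conn}(\operatorname{Ind}(\mathcal{C}))=k-2$.
   Context: A hypergraph $\mathcal{C}$ on a finite vertex set $V$ is a family of pairwise incomparable subsets of $V$ (its edges), each of cardinality at least $2$; vertices lying in no edge are allowed. The independence complex $\operatorname{Ind}(\mathcal{C})$ is the simplicial complex on $V$ whose faces are the subsets of $V$ containing no edge of $\mathcal{C}$. For an edge $F$: $\mathcal{C}-F$ is the hypergraph on $V$ with edge set $\mathcal{C}\setminus\{F\}$; $N_{\mathcal{C}}(F)=\bigcup\{E\setminus F : E\in\mathcal{C},\ |E\setminus F|=1\}$; and $\mathcal{C}:F$ is the hypergraph on $V\setminus(F\cup N_{\mathcal{C}}(F))$ whose edges are the members of cardinality at least $2$ among the inclusion-minimal members of the family $\{E\setminus F : E\in \mathcal{C}-F\}$. The number $\psi(\mathcal{C})\in\mathbb{Z}_{\ge 0}\cup\{\infty\}$ is defined recursively: $\psi(\mathcal{C})=0$ if $V=\emptyset$; $\psi(\mathcal{C})=\infty$ if $V\neq\emptyset$ and $\mathcal{C}$ has no edges; otherwise $\psi(\mathcal{C})=\max_{F\in\mathcal{C}}\min\{\psi(\mathcal{C}-F),\ \psi(\mathcal{C}:F)+|F|-1\}$. The homotopical connectivity $\operatorname{conn}(\Delta)$ is the largest integer $k\ge -1$ such that $\Delta$ is nonempty and $\pi_i(\Delta)=0$ for all $0\le i\le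 k$; it is $\infty$ if all homotopy groups vanish (with $\infty-2=\infty$), and $\operatorname{conn}(\{\emptyset\})=-2$. *)

theory Defs
  imports "HOL-Analysis.Analysis" "HOL-Library.Extended_Real" "HOL-Library.Extended_Nat"
begin

definition hypergraph :: "'a set \<Rightarrow> 'a set set \<Rightarrow> bool" where
  "hypergraph V C \<longleftrightarrow> finite V \<and> (\<forall>E\<in>C. E \<subseteq> V \<and> 2 \<le> card E)
     \<and> (\<forall>E\<in>C. \<forall>E'\<in>C. E \<subseteq> E' \<longrightarrow> E = E')"

definition Ind :: "'a set \<Rightarrow> 'a set set \<Rightarrow> 'a set set" where
  "Ind V C = {S. S \<subseteq> V \<and> \<not> (\<exists>E\<in>C. E \<subseteq> S)}"

definition nbhd :: "'a set set \<Rightarrow> 'a set \<Rightarrow> 'a set" where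
  "nbhd C F = \<Union> {E - F | E. E \<in> C \<and> card (E - F) = 1}"

definition colon :: "'a set set \<Rightarrow> 'a set \<Rightarrow> 'a set set" where
  "colon C F = (let D = {E - F | E. E \<in> C - {F}} in
     {A. A \<in> D \<and> \<not> (\<exists>B\<in>D. B \<subset> A) \<and> 2 \<le> card A})"

declare image_cong [fundef_cong]

function psi :: "'a set \<Rightarrow> 'a set set \<Rightarrow> enat" where
  "psi V C =
    (if \<not> hypergraph V C then 0
     else if V = {} then 0
     else if C = {} then \<infinity>
     else Max ((\<lambda>F. min (psi V (C - {F}))
                       (psi (V - (F \<union> nbhd C F)) (colon C F) + enat (card F - 1))) ` C))"
  by pat_completeness auto
termination
proof (relation "inv_image (less_than <*lex*> less_than) (\<lambda>(V, C). (card V, card C))")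
  show "wf (inv_image (less_than <*lex*> less_than) (\<lambda>(V, C). (card V, card C)))" by auto
next
  fix V :: "'a set" and C F
  assume h: "\<not> \<not> hypergraph V C" "V \<noteq> {}" "C \<noteq> {}" "F \<in> C"
  then have fin: "finite V" and sub: "C \<subseteq> Pow V" by (auto simp: hypergraph_def)
  then have "finite C" by (meson finite_Pow_iff finite_subset)
  then have "card (C - {F}) < card C" using h(4) by (meson card_Diff1_less)
  then show "((V, C - {F}), V, C) \<in> inv_image (less_than <*lex*> less_than) (\<lambda>(V, C). (card V, card C))"
    by simp
next
  fix V :: "'a set" and C F
  assume h: "\<not> \<not> hypergraph V C" "V \<noteq> {}" "C \<noteq> {}" "F \<in> C"
  then have fin: "finite V" and FV: "F \<subseteq> V" and c2: "2 \<le> card F" by (auto simp: hypergraph_def)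
  then have "F \<noteq> {}" by auto
  then have "V - (F \<union> nbhd C F) \<subset> V" using FV by blast
  then have "card (V - (F \<union> nbhd C F)) < card V" using fin by (meson psubset_card_mono)
  then show "((V - (F \<union> nbhd C F), colon C F), V, C) \<in> inv_image (less_than <*lex*> less_than) (\<lambda>(V, C). (card V, card C))"
    by simp
qed

text \<open>Geometric realization of a simplicial complex Delta (a family of finite sets),
  as the set of functions v \<mapsto> barycentric coordinate, with product topology.\<close>
definition realization :: "'a set set \<Rightarrow> ('a \<Rightarrow> real) topology" where
  "realization \<Delta> = top_of_set {f. (\<forall>v. 0 \<le> f v) \<and> {v. f v \<noteq> 0} \<in> \<Delta> \<and> sum f {v. f v \<noteq> 0} = 1}"

definition sphere_base :: "nat \<Rightarrow> real" where
  "sphere_base = (\<lambda>j. if j = 0 then 1 else 0)"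

text \<open>pi_i(X, x) is trivial for every base point x: every based map S^i \<rightarrow> X is
  homotopic relative to the base point to the constant map.  (For i = 0 this says
  X is path connected.)\<close>
definition pi_trivial :: "'b topology \<Rightarrow> nat \<Rightarrow> bool" where
  "pi_trivial X i \<longleftrightarrow> (\<forall>x\<in>topspace X. \<forall>f. continuous_map (nsphere i) X f \<and> f sphere_base = x \<longrightarrow>
      homotopic_with (\<lambda>h. h sphere_base = x) (nsphere i) X f (\<lambda>_. x))"

definition conn :: "'b topology \<Rightarrow> ereal" where
  "conn X = (if topspace X = {} then -2
             else Sup {ereal (real_of_int k) | k. -1 \<le> k \<and> (\<forall>i::nat. int i \<le> k \<longrightarrow> pi_trivial X i)})"

end

theory Submission
  imports Defs "HOL-Homology.Brouwer_Degree"
begin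

text \<open>Passing from C to the deletion of F adds to the independence complex the star of F, whose link is
  the independence complex of the contraction. Hence psi at least 3 forces every covering of the
  independence complex to have a section, whereas psi at least 2 already follows from connectivity.
  Let A be an acyclic 2-complex with a five-sheeted covering without sections. The hypergraph of minimal
  nonfaces of a wedge of A with a sphere has psi equal to 2; each additional disjoint edge with two vertices
  suspends the complex and raises psi by one. After one suspension A becomes contractible, so that
  the homotopy type is that of the suspended sphere, while psi only counts the suspensions.

  The contraction of the suspension of A is an explicit sequence of elementary collapses and
  expansions. What remains is the boundary of a cross polytope: its homotopy groups
  below its dimension vanish because Lipschitz maps cannot raise dimension, and the one in its
  dimension does not since spheres are not contractible.\<close>

section \<open>The recursion for psi\<close>

text \<open>An acyclic complex has a perfect fundamental group, so the monodromy on the sheets of a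
  covering is perfect too. Permutation groups on at most four points are solvable; hence a covering
  without sections needs at least five sheets. The suspension of A is simply connected and acyclic,
  hence contractible by the theorems of Hurewicz and Whitehead. Explicit moves replace this
  argument; they must keep the path from 10 over 2 to 11, because the suspended sphere is glued
  along it. Before any suspension psi is exactly 2, and one suspension is needed to make A
  contractible: this is where l \<ge> 3 comes from. With l = n + 3 there are n + 1 suspensions, and
  a sphere of dimension j becomes one of dimension j + n + 1, whose connectivity is j + n. So j = k
  - l + 1, which is at least 1 because k \<ge> l. For k = \<infinity> and finite l the sphere is
  left out; for l = \<infinity> a single vertex without edges suffices.\<close>

declare psi.simps [simp del]

section \<open>Deletion, contraction and links\<close>

lemma hypergraphD:
  assumes "hypergraph V C"
  shows "finite V" "\<And>E. E \<in> C \<Longrightarrow> E \<subseteq> V" "\<And>E. E \<in> C \<Longrightarrow> 2 \<le> card E"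
    "\<And>E E'. E \<in> C \<Longrightarrow> E' \<in> C \<Longrightarrow> E \<subseteq> E' \<Longrightarrow> E = E'" "finite C"
proof -
  show "finite V" "\<And>E. E \<in> C \<Longrightarrow> E \<subseteq> V" "\<And>E. E \<in> C \<Longrightarrow> 2 \<le> card E"
    "\<And>E E'. E \<in> C \<Longrightarrow> E' \<in> C \<Longrightarrow> E \<subseteq> E' \<Longrightarrow> E = E'"
    using assms unfolding hypergraph_def by blast+
  then show "finite C"
    by (meson Pow_iff finite_Pow_iff finite_subset subsetI)
qed

lemma hypergraph_delete: "hypergraph V C \<Longrightarrow> hypergraph V (C - {F})"
  unfolding hypergraph_def by blast

lemma Diff_edge_nonempty:
  assumes "hypergraph V C" "E \<in> C" "F \<in> C" "E \<noteq> F"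
  shows "E - F \<noteq> {}"
  using hypergraphD(4)[OF assms(1)] assms by blast

lemma colon_iff: "A \<in> colon C F \<longleftrightarrow> (\<exists>E\<in>C. E \<noteq> F \<and> A = E - F) \<and> (\<forall>E\<in>C. E \<noteq> F \<longrightarrow> \<not> E - F \<subset> A) \<and> 2 \<le> card A"
proof -
  have D: "{E - F | E. E \<in> C - {F}} = (\<lambda>E. E - F) ` (C - {F})" by blast
  show ?thesis unfolding colon_def Let_def D by (simp only: mem_Collect_eq image_iff bex_simps Diff_iff) blast
qed

lemma hypergraph_colon:
  assumes h: "hypergraph V C"
  shows "hypergraph (V - (F \<union> nbhd C F)) (colon C F)"
  unfolding hypergraph_def
proof (intro conjI ballI impI)
  show "finite (V - (F \<union> nbhd C F))" using hypergraphD(1)[OF h] by simp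
next
  fix A assume "A \<in> colon C F"
  note * = this[unfolded colon_iff]
  from * obtain E where A: "A = E - F" "E \<in> C" by (elim conjE bexE)
  have "2 \<le> card A" and min: "\<And>E. E \<in> C \<Longrightarrow> E \<noteq> F \<Longrightarrow> \<not> E - F \<subset> A"
    using * by simp_all
  \<comment> \<open>A vertex x of \<open>nbhd C F\<close> gives the member {x} of the family, so by
    minimality a set A containing x would be {x}, too small for an edge.\<close>
  have "A \<inter> nbhd C F = {}"
  proof (rule ccontr)
    assume "A \<inter> nbhd C F \<noteq> {}"
    then obtain x E' where x: "x \<in> A" "E' \<in> C" "card (E' - F) = 1" "x \<in> E' - F"
      unfolding nbhd_def by blast
    then have eq: "E' - F = {x}" by (metis card_1_singletonE singletonD)
    have "E' \<noteq> F" using x by auto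
    then have "\<not> {x} \<subset> A" using min[OF x(2)] eq by simp
    then have "A = {x}" using x(1) by blast
    then show False using \<open>2 \<le> card A\<close> by simp
  qed
  then show "A \<subseteq> V - (F \<union> nbhd C F)" using A hypergraphD(2)[OF h] by blast
  show "2 \<le> card A" by fact
next
  fix E E' assume "E \<in> colon C F" "E' \<in> colon C F" "E \<subseteq> E'"
  then show "E = E'" unfolding colon_iff by (metis psubsetI)
qed

text \<open>The independence complex of the contraction is the link of F in the independence complex of
  the deletion.\<close>

lemma Ind_colon_iff:
  assumes h: "hypergraph V C" and F: "F \<in> C"
  shows "S \<in> Ind (V - (F \<union> nbhd C F)) (colon C F) \<longleftrightarrow> S \<inter> F = {} \<and> S \<union> F \<in> Ind V (C - {F})"
proof
  assume S: "S \<in> Ind (V - (F \<union> nbhd C F)) (colon C F)"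
  then have 1: "S \<inter> F = {}" "S \<subseteq> V" "S \<inter> nbhd C F = {}" by (auto simp: Ind_def)
  have "\<not> E \<subseteq> S \<union> F" if E: "E \<in> C" "E \<noteq> F" for E
  proof
    assume "E \<subseteq> S \<union> F"
    \<comment> \<open>A minimal member of D inside S gives the contradiction. If it has one element,
      it lies in \<open>nbhd C F\<close>, which S avoids; otherwise it is an edge of the
      contraction.\<close>
    let ?D = "{E - F | E. E \<in> C - {F}}"
    let ?M = "{A \<in> ?D. A \<subseteq> S}"
    have finM: "finite ?M"
      using hypergraphD(5)[OF h] by (auto simp: Setcompr_eq_image)
    have "E - F \<in> ?M" using E \<open>E \<subseteq> S \<union> F\<close> by blast
    then obtain A where A: "A \<in> ?M" "\<And>B. B \<in> ?M \<Longrightarrow> B \<le> A \<Longrightarrow> A = B"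
      using finite_has_minimal[OF finM] by (metis (no_types, lifting) empty_iff)
    then obtain E' where E': "A = E' - F" "E' \<in> C" "E' \<noteq> F" "A \<subseteq> S" by blast
    have minA: "\<not> (\<exists>B\<in>?D. B \<subset> A)"
    proof
      assume "\<exists>B\<in>?D. B \<subset> A"
      then obtain B where "B \<in> ?D" "B \<subset> A" by blast
      then have "B \<in> ?M" using \<open>A \<subseteq> S\<close> by blast
      then show False using A(2) \<open>B \<subset> A\<close> by blast
    qed
    have "A \<noteq> {}" using Diff_edge_nonempty[OF h E'(2) F E'(3)] E'(1) by simp
    moreover have "finite A"
      using E' hypergraphD(1,2)[OF h] by (meson Diff_subset finite_subset)
    ultimately have "1 \<le> card A" by (simp add: Suc_leI card_gt_0_iff)
    moreover have "card A \<noteq> 1"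
    proof
      assume "card A = 1"
      then have "A \<subseteq> nbhd C F" using E' by (auto simp: nbhd_def)
      then show False using E'(4) 1(3) \<open>A \<noteq> {}\<close> by blast
    qed
    ultimately have "2 \<le> card A" by linarith
    then have "A \<in> colon C F" using E' minA unfolding colon_iff by blast
    then show False using S E'(4) by (auto simp: Ind_def)
  qed
  moreover have "F \<subseteq> V" using hypergraphD(2)[OF h F] .
  ultimately show "S \<inter> F = {} \<and> S \<union> F \<in> Ind V (C - {F})" using 1 by (auto simp: Ind_def)
next
  assume S: "S \<inter> F = {} \<and> S \<union> F \<in> Ind V (C - {F})"
  then have no: "\<And>E. E \<in> C \<Longrightarrow> E \<noteq> F \<Longrightarrow> \<not> E - F \<subseteq> S" "S \<subseteq> V" by (auto simp: Ind_def)
  have "S \<inter> nbhd C F = {}"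
  proof (rule ccontr)
    assume "S \<inter> nbhd C F \<noteq> {}"
    then obtain x E where "x \<in> S" "E \<in> C" "card (E - F) = 1" "x \<in> E - F" by (auto simp: nbhd_def)
    then have "E - F = {x}" "E \<noteq> F" by (metis card_1_singletonE singletonD, auto)
    then have "E - F \<subseteq> S" "E \<noteq> F" using \<open>x \<in> S\<close> by auto
    then show False using no \<open>E \<in> C\<close> by blast
  qed
  moreover have "\<not> A \<subseteq> S" if "A \<in> colon C F" for A
    using that no(1) unfolding colon_iff by blast
  ultimately show "S \<in> Ind (V - (F \<union> nbhd C F)) (colon C F)" using S no(2) by (auto simp: Ind_def)
qed

section \<open>Threshold form and induction for psi\<close>

lemma psi_empty: "psi {} C = 0"
  by (subst psi.simps) simp

lemma psi_no_edges: "finite V \<Longrightarrow> V \<noteq> {} \<Longrightarrow> psi V {} = \<infinity>"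
  by (subst psi.simps) (simp add: hypergraph_def)

lemma psi_edges:
  assumes "hypergraph V C" "V \<noteq> {}" "C \<noteq> {}"
  shows "psi V C = Max ((\<lambda>F. min (psi V (C - {F}))
                       (psi (V - (F \<union> nbhd C F)) (colon C F) + enat (card F - 1))) ` C)"
  using assms by (subst psi.simps) simp

text \<open>This is psi as a game: one player offers an edge F, the other answers with deletion or
  contraction. A threshold turns the maximum into a choice of F and the minimum into a conjunction;
  the bounds by 1, 2, 3 and infinity below are all obtained in this form.\<close>

lemma psi_ge_iff:
  assumes h: "hypergraph V C" and n: "0 < n"
  shows "n \<le> psi V C \<longleftrightarrow> V \<noteq> {} \<and> (C = {} \<or> (\<exists>F\<in>C. n \<le> psi V (C - {F}) \<and>
           n \<le> psi (V - (F \<union> nbhd C F)) (colon C F) + enat (card F - 1)))"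
proof (cases "V = {} \<or> C = {}")
  case True
  then show ?thesis using n psi_empty[of C] psi_no_edges[OF hypergraphD(1)[OF h]]
    by (cases "V = {}") auto
next
  case False
  then show ?thesis using hypergraphD(5)[OF h]
    by (subst psi_edges[OF h]) (auto simp: Max_ge_iff)
qed

text \<open>An edge forces the vertex set to be nonempty, so the guards in \<open>psi.induct\<close>
  disappear and the hypergraph property is carried along.\<close>

lemma psi_induct [consumes 1, case_names step]:
  assumes "hypergraph V C"
    and "\<And>V C. hypergraph V C \<Longrightarrow>
      (\<And>F. F \<in> C \<Longrightarrow> P V (C - {F})) \<Longrightarrow>
      (\<And>F. F \<in> C \<Longrightarrow> P (V - (F \<union> nbhd C F)) (colon C F)) \<Longrightarrow> P V C"
  shows "P V C"
  using assms(1)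
proof (induction V C rule: psi.induct)
  case (1 V C)
  show ?case
  proof (rule assms(2)[OF 1(3)])
    fix F assume F: "F \<in> C"
    then have ne: "V \<noteq> {}" "C \<noteq> {}" using hypergraphD(2,3)[OF 1(3)] by force+
    show "P V (C - {F})" using 1(1)[OF _ ne F] 1(3) hypergraph_delete by blast
    show "P (V - (F \<union> nbhd C F)) (colon C F)" using 1(2)[OF _ ne F] 1(3) hypergraph_colon by blast
  qed
qed

text \<open>Neither deletion nor contraction removes a vertex outside all edges, so every branch of
  the recursion ends in a nonempty vertex set without edges.\<close>

lemma psi_isolated:
  assumes "hypergraph V C" "x \<in> V" "x \<notin> \<Union>C"
  shows "psi V C = \<infinity>"
  using assms
proof (induction V C rule: psi_induct)
  case (step V C)
  have "V \<noteq> {}" using step.prems by auto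
  show ?case
  proof (cases "C = {}")
    case True
    then show ?thesis using psi_no_edges[OF hypergraphD(1)[OF step.hyps(1)] \<open>V \<noteq> {}\<close>] by simp
  next
    case False
    then obtain F where F: "F \<in> C" by blast
    have 1: "psi V (C - {F}) = \<infinity>" using step.IH(1)[OF F] step.prems by blast
    have "x \<in> V - (F \<union> nbhd C F)" "x \<notin> \<Union>(colon C F)"
    proof -
      show "x \<in> V - (F \<union> nbhd C F)" using step.prems F unfolding nbhd_def by blast
      show "x \<notin> \<Union>(colon C F)"
      proof
        assume "x \<in> \<Union>(colon C F)"
        then obtain A where "x \<in> A" "A \<in> colon C F" by (elim UnionE)
        then show False using step.prems(2) unfolding colon_iff by auto
      qed
    qed
    then have 2: "psi (V - (F \<union> nbhd C F)) (colon C F) = \<infinity>" using step.IH(2)[OF F] by blast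
    have "\<infinity> \<le> psi V C"
      using psi_ge_iff[OF step.hyps(1), of \<infinity>] 1 2 F \<open>V \<noteq> {}\<close> by auto
    then show ?thesis by simp
  qed
qed

section \<open>A disjoint edge raises psi by one\<close>

lemma nbhd_insert_disjoint:
  assumes "2 \<le> card e" "e \<inter> F = {}"
  shows "nbhd (insert e C) F = nbhd C F"
proof -
  have "e - F = e" using assms by blast
  then have "card (e - F) \<noteq> 1" using assms(1) by simp
  then show ?thesis unfolding nbhd_def by blast
qed

lemma hypergraph_insert_disjoint:
  assumes "hypergraph V C" "e \<inter> V = {}" "card e = 2"
  shows "hypergraph (V \<union> e) (insert e C)"
proof -
  have "finite e" "e \<noteq> {}" using assms(3) by (auto intro: card_ge_0_finite)
  have ne: "E \<noteq> {}" "E \<subseteq> V" if "E \<in> C" for E using hypergraphD(2,3)[OF assms(1) that] by auto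
  show ?thesis unfolding hypergraph_def
  proof (intro conjI ballI impI)
    show "finite (V \<union> e)" using \<open>finite e\<close> hypergraphD(1)[OF assms(1)] by simp
    show "E \<subseteq> V \<union> e" "2 \<le> card E" if "E \<in> insert e C" for E
      using that ne hypergraphD(3)[OF assms(1)] assms(3) by auto
    show "E = E'" if "E \<in> insert e C" "E' \<in> insert e C" "E \<subseteq> E'" for E E'
    proof -
      have "\<not> e \<subseteq> G" "\<not> G \<subseteq> e" if "G \<in> C" for G
        using ne[OF that] \<open>e \<noteq> {}\<close> assms(2) by blast+
      then show ?thesis using that hypergraphD(4)[OF assms(1)] by blast
    qed
  qed
qed

lemma colon_insert_disjoint:
  assumes h: "hypergraph V C" and e: "e \<inter> V = {}" "card e = 2" and F: "F \<in> C"
  shows "colon (insert e C) F = insert e (colon C F)"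
proof -
  let ?D = "{E - F | E. E \<in> C - {F}}"
  have F': "F \<subseteq> V" "e \<noteq> {}" "e \<inter> F = {}" "e \<noteq> F"
  proof -
    show "F \<subseteq> V" by (rule hypergraphD(2)[OF h F])
    then show "e \<inter> F = {}" using e by blast
    show "e \<noteq> {}" using e by auto
    then show "e \<noteq> F" using \<open>e \<inter> F = {}\<close> by blast
  qed
  have D: "{E - F | E. E \<in> insert e C - {F}} = insert e ?D"
  proof -
    have "e - F = e" using F'(3) by blast
    moreover have "insert e C - {F} = insert e (C - {F})" using F'(4) by blast
    moreover have "{E - F | E. E \<in> X} = (\<lambda>E. E - F) ` X" for X by blast
    ultimately show ?thesis by (simp only: image_insert)
  qed
  have sub: "\<And>A. A \<in> ?D \<Longrightarrow> A \<noteq> {} \<and> A \<subseteq> V"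
    using Diff_edge_nonempty[OF h _ F] hypergraphD(2)[OF h] by blast
  have a: "\<not> A \<subset> e" "\<not> e \<subset> A" if "A \<in> ?D" for A
    using sub[OF that] e(1) F'(2) by blast+
  show ?thesis
  proof (rule Set.set_eqI)
    fix A show "A \<in> colon (insert e C) F \<longleftrightarrow> A \<in> insert e (colon C F)"
      unfolding colon_def Let_def D using a e(2) by (cases "A = e") auto
  qed
qed

lemma colon_insert_self:
  assumes h: "hypergraph V C" and e: "e \<inter> V = {}" "card e = 2"
  shows "colon (insert e C) e = C" "nbhd (insert e C) e = {}"
proof -
  have ne: "e \<noteq> {}" using e(2) by auto
  have E: "E - e = E" "E \<noteq> e" if "E \<in> C" for E
    using hypergraphD(2)[OF h that] e(1) ne by blast+
  have D: "{E - e | E. E \<in> insert e C - {e}} = C"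
  proof -
    have "insert e C - {e} = C" using E(2) by blast
    then show ?thesis using E(1) by (simp add: Setcompr_eq_image)
  qed
  show "colon (insert e C) e = C"
    unfolding colon_def Let_def D using hypergraphD(3,4)[OF h] by blast
  show "nbhd (insert e C) e = {}"
    unfolding nbhd_def using E hypergraphD(3)[OF h] by fastforce
qed

text \<open>Exact additivity is what keeps psi low while a suspension changes the connectivity by
  more than one. By induction every old edge contributes its old value plus one, and the value
  \<open>psi V C + 1\<close> of the new edge dominates these.\<close>

lemma psi_insert_disjoint_edge:
  assumes "hypergraph V C" "e \<inter> V = {}" "card e = 2"
  shows "psi (V \<union> e) (insert e C) = psi V C + 1"
  using assms
proof (induction V C rule: psi_induct)
  case (step V C)
  note h = step.hyps(1) and e = step.prems
  have h': "hypergraph (V \<union> e) (insert e C)" using hypergraph_insert_disjoint[OF h e] .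
  have ne: "e \<noteq> {}" using e by auto
  have eC: "e \<notin> C" using hypergraphD(2)[OF h] e(1) ne by blast
  have finC: "finite C" using hypergraphD(5)[OF h] .
  let ?m = "\<lambda>C' V' F. min (psi V' (C' - {F})) (psi (V' - (F \<union> nbhd C' F)) (colon C' F) + enat (card F - 1))"
  \<comment> \<open>Deleting e leaves its vertices isolated, which gives infinity; contracting e
    returns the original hypergraph with the summand |e| - 1 = 1.\<close>
  have m_e: "?m (insert e C) (V \<union> e) e = psi V C + 1"
  proof -
    obtain x where x: "x \<in> e" using ne by blast
    have "hypergraph (V \<union> e) C" using hypergraph_delete[OF h', of e] eC by simp
    then have "psi (V \<union> e) C = \<infinity>"
      by (rule psi_isolated[where x = x]) (use x e(1) hypergraphD(2)[OF h] in blast)+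
    moreover have "V \<union> e - e = V" using e by blast
    ultimately show ?thesis using colon_insert_self[OF h e] eC e(2) by (simp add: one_enat_def)
  qed
  have m_F: "?m (insert e C) (V \<union> e) F = ?m C V F + 1" if F: "F \<in> C" for F
  proof -
    have eF: "e \<inter> F = {}" "e \<noteq> F" using hypergraphD(2)[OF h F] e eC F by blast+
    have N: "nbhd C F \<subseteq> V" using hypergraphD(2)[OF h] by (auto simp: nbhd_def)
    have "V \<union> e - (F \<union> nbhd (insert e C) F) = (V - (F \<union> nbhd C F)) \<union> e"
      using nbhd_insert_disjoint[OF _ eF(1)] e eF N by auto
    moreover have "insert e C - {F} = insert e (C - {F})" using eF by blast
    moreover have "e \<inter> (V - (F \<union> nbhd C F)) = {}" using e by blast
    moreover have "psi (V \<union> e) (insert e (C - {F})) = psi V (C - {F}) + 1"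
      using step.IH(1)[OF F] e by blast
    moreover have "psi ((V - (F \<union> nbhd C F)) \<union> e) (insert e (colon C F)) = psi (V - (F \<union> nbhd C F)) (colon C F) + 1"
      using step.IH(2)[OF F] e by blast
    moreover have "min (a + 1) (b + 1 + c) = min a (b + c) + (1 :: enat)" for a b c
      by (cases a; cases b; cases c) (auto simp: one_enat_def min_def)
    ultimately show ?thesis
      by (simp only: colon_insert_disjoint[OF h e F])
  qed
  have psi: "psi (V \<union> e) (insert e C) = Max (insert (psi V C + 1) ((\<lambda>F. ?m C V F + 1) ` C))"
  proof -
    have "psi (V \<union> e) (insert e C) = Max (?m (insert e C) (V \<union> e) ` insert e C)"
      by (rule psi_edges[OF h']) (use ne in simp_all)
    also have "?m (insert e C) (V \<union> e) ` insert e C = insert (psi V C + 1) ((\<lambda>F. ?m C V F + 1) ` C)"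
      unfolding image_insert m_e by (rule arg_cong[where f = "insert _"], rule image_cong[OF refl], rule m_F)
    finally show ?thesis .
  qed
  show ?case
  proof (cases "C = {}")
    case True
    show ?thesis unfolding psi unfolding True by simp
  next
    case False
    then obtain F where "F \<in> C" by blast
    then have "F \<subseteq> V" "F \<noteq> {}" using hypergraphD(2,3)[OF h] by (blast, fastforce)
    then have "V \<noteq> {}" by blast
    have le: "?m C V F \<le> psi V C" if "F \<in> C" for F
      unfolding psi_edges[OF h \<open>V \<noteq> {}\<close> False] by (rule Max_ge) (use finC that in simp_all)
    have "Max ((\<lambda>F. ?m C V F + 1) ` C) \<le> psi V C + 1"
    proof (rule Max.boundedI)
      fix a assume "a \<in> (\<lambda>F. ?m C V F + 1) ` C"
      then show "a \<le> psi V C + 1" by (elim imageE) (simp only: add_right_mono le)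
    qed (use False finC in simp_all)
    moreover have "finite ((\<lambda>F. ?m C V F + 1) ` C)" "(\<lambda>F. ?m C V F + 1) ` C \<noteq> {}"
      using False finC by simp_all
    ultimately show ?thesis unfolding psi by (subst Max_insert) (assumption | rule max_absorb1)+
  qed
qed

section \<open>Connectedness and psi at least 2\<close>

lemma Ind_delete_iff:
  "S \<in> Ind V (C - {F}) \<longleftrightarrow> S \<in> Ind V C \<or> S \<in> Ind V (C - {F}) \<and> F \<subseteq> S"
  by (auto simp: Ind_def)

lemma Ind_mono: "S \<in> Ind V C \<Longrightarrow> S' \<subseteq> S \<Longrightarrow> S' \<in> Ind V C"
  unfolding Ind_def by blast

lemma psi_ge_1_nonempty: "1 \<le> psi V C \<Longrightarrow> V \<noteq> {}"
  by (auto simp: psi_empty)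

lemma link_vertex:
  assumes h: "hypergraph V C" and F: "F \<in> C" and ne: "V - (F \<union> nbhd C F) \<noteq> {}"
  obtains d where "d \<in> V - F" "insert d F \<in> Ind V (C - {F})"
proof -
  obtain d where d: "d \<in> V - (F \<union> nbhd C F)" using ne by blast
  have "\<not> E \<subseteq> {d}" if "E \<in> colon C F" for E
  proof
    assume "E \<subseteq> {d}"
    then have "card E \<le> 1" by (metis card.empty card.insert card_mono empty_iff finite.intros One_nat_def)
    then show False using that unfolding colon_iff by simp
  qed
  then have "{d} \<in> Ind (V - (F \<union> nbhd C F)) (colon C F)" using d by (simp add: Ind_def)
  then have "insert d F \<in> Ind V (C - {F})" using Ind_colon_iff[OF h F, of "{d}"] by simp
  then show thesis using that d by blast
qed

text \<open>Turns the contraction half of \<open>psi_ge_iff\<close> into a bound for the link: an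
  edge with c vertices lowers the requirement by c - 1.\<close>

lemma enat_le_add_diff_one:
  assumes "enat n \<le> x + enat (c - 1)" "c \<le> n" "2 \<le> c"
  shows "enat (n - c + 1) \<le> x"
  using assms by (cases x) auto

text \<open>Connectedness is phrased by functions constant along 1-simplices because it will be
  applied to a predicate on the vertices of a link. Deletion creates a new 1-simplex only if |F| =
  2, and then a vertex d of the link joins its ends by two old ones.\<close>

lemma psi_ge_2_connected:
  fixes f :: "'a \<Rightarrow> bool"
  assumes "hypergraph V C" "2 \<le> psi V C"
    and "\<And>u v. {u, v} \<in> Ind V C \<Longrightarrow> f u = f v" and "u \<in> V" "v \<in> V"
  shows "f u = f v"
  using assms
proof (induction V C rule: psi_induct)
  case (step V C)
  note h = step.hyps(1)
  from step.prems(1) consider "C = {}" | F where "F \<in> C" "2 \<le> psi V (C - {F})"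
    "2 \<le> psi (V - (F \<union> nbhd C F)) (colon C F) + enat (card F - 1)"
    using psi_ge_iff[OF h, of 2] by auto
  then show ?case
  proof cases
    case 1
    then have "{u, v} \<in> Ind V C" using step.prems(3,4) by (simp add: Ind_def)
    then show ?thesis by (rule step.prems(2))
  next
    case (2 F)
    show ?thesis
    proof (rule step.IH(1)[OF 2(1,2) _ step.prems(3,4)])
      fix u v assume uv: "{u, v} \<in> Ind V (C - {F})"
      show "f u = f v"
      proof (cases "F \<subseteq> {u, v}")
        case False
        then have "{u, v} \<in> Ind V C" using uv Ind_delete_iff by metis
        then show ?thesis by (rule step.prems(2))
      next
        case True
        have "2 \<le> card F" using hypergraphD(3)[OF h 2(1)] .
        moreover have "card F \<le> card {u, v}" using True by (simp add: card_mono)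
        ultimately have F: "card F = 2" "F = {u, v}" "u \<noteq> v"
          using True by (auto simp: card_insert_if card_subset_eq split: if_splits)
        have "1 \<le> psi (V - (F \<union> nbhd C F)) (colon C F)"
          using enat_le_add_diff_one[of 2 _ "card F"] 2(3) F(1) by (simp add: numeral_eq_enat one_enat_def)
        then have "V - (F \<union> nbhd C F) \<noteq> {}" by (rule psi_ge_1_nonempty)
        then obtain d where d: "d \<in> V - F" "insert d F \<in> Ind V (C - {F})"
          using link_vertex[OF h 2(1)] by blast
        have "{u, d} \<in> Ind V C" "{v, d} \<in> Ind V C"
          using d F(2,3) by (metis Ind_delete_iff Ind_mono insert_iff insert_subset subsetI DiffE empty_iff)+
        then have "f u = f d" "f v = f d" using step.prems(2) by blast+
        then show ?thesis by simp
      qed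
    qed
  qed
qed

lemma nonempty_psi_ge_1:
  assumes "hypergraph V C" "V \<noteq> {}"
  shows "1 \<le> psi V C"
  using assms
proof (induction V C rule: psi_induct)
  case (step V C)
  show ?case
  proof (cases "C = {}")
    case False
    then obtain F where F: "F \<in> C" by blast
    have "enat 1 \<le> enat (card F - 1)" using hypergraphD(3)[OF step.hyps(1) F] by simp
    then have "1 \<le> psi (V - (F \<union> nbhd C F)) (colon C F) + enat (card F - 1)"
      by (metis add_increasing one_enat_def zero_le)
    then show ?thesis
      using psi_ge_iff[OF step.hyps(1), of 1] step.IH(1)[OF F] step.prems F by auto
  qed (use psi_ge_iff[OF step.hyps(1), of 1] step.prems in auto)
qed

text \<open>An edge with at least three vertices can be offered at once, since its summand |F| - 1
  is at least 2. If all edges have two vertices, F needs a nonempty link: its two vertices must have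
  a common neighbour in the 1-skeleton of the independence complex.\<close>

lemma connected_psi_ge_2:
  assumes "hypergraph V C" "V \<noteq> {}"
    and "\<And>u v. u \<in> V \<Longrightarrow> v \<in> V \<Longrightarrow> (u, v) \<in> {(a, b). {a, b} \<in> Ind V C}\<^sup>*"
  shows "2 \<le> psi V C"
  using assms
proof (induction V C rule: psi_induct)
  case (step V C)
  note h = step.hyps(1)
  let ?R = "{(a, b). {a, b} \<in> Ind V C}"
  have IH: "2 \<le> psi V (C - {F})" if "F \<in> C" for F
  proof (rule step.IH(1)[OF that step.prems(1)])
    fix u v assume "u \<in> V" "v \<in> V"
    then have "(u, v) \<in> ?R\<^sup>*" by (rule step.prems(2))
    moreover have "?R \<subseteq> {(a, b). {a, b} \<in> Ind V (C - {F})}" by (auto simp: Ind_def)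
    ultimately show "(u, v) \<in> {(a, b). {a, b} \<in> Ind V (C - {F})}\<^sup>*" using rtrancl_mono by blast
  qed
  consider "C = {}" | F where "F \<in> C" "3 \<le> card F" | "C \<noteq> {}" "\<forall>F\<in>C. card F = 2"
    using hypergraphD(3)[OF h] by (metis One_nat_def Suc_1 le_antisym not_less_eq_eq numeral_3_eq_3)
  then show ?case
  proof cases
    case 1
    then show ?thesis using psi_ge_iff[OF h, of 2] step.prems(1) by auto
  next
    case (2 F)
    have "enat 2 \<le> enat (card F - 1)" using 2(2) by simp
    then have "2 \<le> psi (V - (F \<union> nbhd C F)) (colon C F) + enat (card F - 1)"
      by (metis add_increasing numeral_eq_enat zero_le)
    then show ?thesis using psi_ge_iff[OF h, of 2] IH[OF 2(1)] 2(1) step.prems(1) by auto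
  next
    case 3
    \<comment> \<open>In a connected graph with transitive adjacency distinct vertices are adjacent,
      but the two vertices of an edge of C are not. So some nonadjacent pair has a common
      neighbour.\<close>
    have "\<not> trans ?R"
    proof
      assume t: "trans ?R"
      obtain F where F: "F \<in> C" using 3 by blast
      then obtain a b where ab: "F = {a, b}" "a \<noteq> b" using 3 by (metis card_2_iff)
      then have "(a, b) \<in> ?R\<^sup>*" using step.prems(2) hypergraphD(2)[OF h F] by blast
      then have "(a, b) \<in> ?R" using ab(2) trancl_id[OF t] by (metis rtranclD)
      then show False using F ab(1) unfolding Ind_def by blast
    qed
    then obtain a b c where abc: "{a, c} \<in> Ind V C" "{c, b} \<in> Ind V C" "{a, b} \<notin> Ind V C"
      unfolding trans_def by blast
    then obtain F where F: "F \<in> C" "F \<subseteq> {a, b}" by (auto simp: Ind_def)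
    have "card F = 2" using 3 F(1) by blast
    moreover have "card {a, b} \<le> 2" by (simp add: card_insert_if)
    ultimately have eq: "F = {a, b}" using card_seteq[OF _ F(2)] by simp
    have ab: "a \<noteq> b" using \<open>card F = 2\<close> eq by auto
    have c: "c \<noteq> a" "c \<noteq> b" using abc by (auto simp: insert_commute)
    have "\<not> E \<subseteq> insert c F" if E: "E \<in> C" "E \<noteq> F" for E
    proof
      assume s: "E \<subseteq> insert c F"
      have "card E = 2" using 3 E(1) by blast
      then obtain x y where xy: "E = {x, y}" "x \<noteq> y" by (metis card_2_iff)
      then have "E = {a, c} \<or> E = {c, b} \<or> E = {a, b}" using s eq by auto
      then show False using abc E eq by (auto simp: Ind_def)
    qed
    moreover have "c \<in> V" "F \<subseteq> V" using abc(1) hypergraphD(2)[OF h F(1)] by (simp_all add: Ind_def)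
    ultimately have "{c} \<union> F \<in> Ind V (C - {F})" unfolding Ind_def by simp
    then have "{c} \<in> Ind (V - (F \<union> nbhd C F)) (colon C F)"
      using Ind_colon_iff[OF h F(1), of "{c}"] c eq by simp
    then have "V - (F \<union> nbhd C F) \<noteq> {}" by (auto simp: Ind_def)
    then have "1 \<le> psi (V - (F \<union> nbhd C F)) (colon C F)"
      by (rule nonempty_psi_ge_1[OF hypergraph_colon[OF h]])
    then have "1 + enat 1 \<le> psi (V - (F \<union> nbhd C F)) (colon C F) + enat (card F - 1)"
      using \<open>card F = 2\<close> by (intro add_mono) simp_all
    then have "2 \<le> psi (V - (F \<union> nbhd C F)) (colon C F) + enat (card F - 1)"
      by (simp only: one_add_one flip: one_enat_def)
    then show ?thesis using psi_ge_iff[OF h, of 2] IH[OF F(1)] F(1) step.prems(1) by auto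
  qed
qed

section \<open>Coverings\<close>

text \<open>A covering of the complex K with fibre Q, given by its transports along oriented edges.\<close>

definition cover_system :: "'a set set \<Rightarrow> 'q set \<Rightarrow> ('a \<Rightarrow> 'a \<Rightarrow> 'q \<Rightarrow> 'q) \<Rightarrow> bool" where
  "cover_system K Q g \<longleftrightarrow> (\<forall>u v w q. {u, v, w} \<in> K \<longrightarrow> q \<in> Q \<longrightarrow>
     g u v q \<in> Q \<and> g v w (g u v q) = g u w q \<and> g u u q = q)"

definition cover_section :: "'a set set \<Rightarrow> 'q set \<Rightarrow> ('a \<Rightarrow> 'a \<Rightarrow> 'q \<Rightarrow> 'q) \<Rightarrow> ('a \<Rightarrow> 'q) \<Rightarrow> bool" where
  "cover_section K Q g s \<longleftrightarrow> (\<forall>u v. {u, v} \<in> K \<longrightarrow> s u \<in> Q \<and> s v = g u v (s u))"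

text \<open>Degenerate triples carry information: the triple u, v, u makes the two transports along
  an edge inverse to each other.\<close>

lemma cover_systemD:
  assumes "cover_system K Q g" "{u, v, w} \<in> K" "q \<in> Q"
  shows "g u v q \<in> Q" "g v w (g u v q) = g u w q" "g u u q = q"
  using assms unfolding cover_system_def by blast+

text \<open>This replaces the statement that psi at least 3 implies simple connectivity.\<close>

lemma psi_ge_3_section:
  assumes "hypergraph V C" "3 \<le> psi V C" "cover_system (Ind V C) Q g" "Q \<noteq> {}"
  shows "\<exists>s. cover_section (Ind V C) Q g s"
  using assms
proof (induction V C arbitrary: g rule: psi_induct)
  case (step V C)
  note h = step.hyps(1)
  have Vne: "V \<noteq> {}" using step.prems(1) psi_empty[of C] by auto
  from step.prems(1) consider "C = {}" | F where "F \<in> C" "3 \<le> psi V (C - {F})"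
    "3 \<le> psi (V - (F \<union> nbhd C F)) (colon C F) + enat (card F - 1)"
    using psi_ge_iff[OF h, of 3] by auto
  then show ?case
  proof cases
    case 1
    \<comment> \<open>The complex is a full simplex, so transporting one point of the fibre from x
      to every vertex gives a section.\<close>
    then have face: "{u, v, w} \<in> Ind V C" if "u \<in> V" "v \<in> V" "w \<in> V" for u v w
      using that by (simp add: Ind_def)
    obtain x q where x: "x \<in> V" "q \<in> Q" using Vne step.prems(3) by blast
    have "cover_section (Ind V C) Q g (\<lambda>v. g x v q)"
      unfolding cover_section_def
    proof (intro allI impI)
      fix u v assume "{u, v} \<in> Ind V C"
      then have "u \<in> V" "v \<in> V" by (simp_all add: Ind_def)
      then have "{x, u, v} \<in> Ind V C" using face x by blast
      from cover_systemD(1,2)[OF step.prems(2) this x(2)]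
      show "g x u q \<in> Q \<and> g x v q = g u v (g x u q)" by simp
    qed
    then show ?thesis by blast
  next
    case (2 F)
    let ?L = "V - (F \<union> nbhd C F)"
    have F2: "2 \<le> card F" using hypergraphD(3)[OF h 2(1)] .
    have finF: "finite F" using F2 card_ge_0_finite by force
    have old: "S \<in> Ind V C" if "S \<in> Ind V (C - {F})" "\<not> F \<subseteq> S" for S
      using that Ind_delete_iff by metis
    note sys = cover_systemD[OF step.prems(2)]
    text \<open>Along a new face the transport can be read off by passing through a vertex d of
      the link of F.\<close>
    have via: "\<exists>g'. (\<forall>u v. \<not> F \<subseteq> {u, v} \<longrightarrow> g' u v = g u v) \<and>
      (\<forall>u v w. {u, v, w} \<in> Ind V (C - {F}) \<longrightarrow> F \<subseteq> {u, v, w} \<longrightarrow>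
         (\<exists>d. \<forall>a\<in>{u, v, w}. \<forall>b\<in>{u, v, w}. {a, d} \<in> Ind V C \<and> (\<forall>q\<in>Q. g' a b q = g d b (g a d q))))"
    proof -
      consider "card F = 2" | "card F = 3" | "4 \<le> card F" using F2 by linarith
      then show ?thesis
      proof cases
        \<comment> \<open>New faces have at least four vertices, so no triangle is new.\<close>
        case 3
        have "\<not> F \<subseteq> {u, v, w}" for u v w
        proof
          assume "F \<subseteq> {u, v, w}"
          then have "card F \<le> card {u, v, w}" by (simp add: card_mono)
          also have "\<dots> \<le> 3" by (simp add: card_insert_if)
          finally show False using 3 by simp
        qed
        then show ?thesis by blast
      next
        \<comment> \<open>Only the triangle F is new. For a link vertex d the triangles spanned by d
          and two vertices of F are old, and they make g consistent on F.\<close>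
        case c3: 2
        have "1 \<le> psi ?L (colon C F)"
          using enat_le_add_diff_one[of 3 _ "card F"] 2(3) c3 by (simp add: numeral_eq_enat one_enat_def)
        then have "?L \<noteq> {}" by (rule psi_ge_1_nonempty)
        then obtain d where d: "d \<in> V - F" "insert d F \<in> Ind V (C - {F})"
          using link_vertex[OF h 2(1)] by blast
        have face: "{a, b, d} \<in> Ind V C" if ab: "a \<in> F" "b \<in> F" for a b
        proof (rule old)
          show "{a, b, d} \<in> Ind V (C - {F})" by (rule Ind_mono[OF d(2)]) (use ab in auto)
          show "\<not> F \<subseteq> {a, b, d}"
          proof
            assume "F \<subseteq> {a, b, d}"
            then have "F \<subseteq> {a, b}" using d(1) by auto
            then have "card F \<le> card {a, b}" by (simp add: card_mono)
            then show False using c3 by (simp add: card_insert_if split: if_splits)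
          qed
        qed
        have "{u, v, w} = F" if "F \<subseteq> {u, v, w}" for u v w
        proof -
          have "card {u, v, w} \<le> card F" using c3 by (simp add: card_insert_if)
          then show ?thesis using card_seteq[OF _ that] by simp
        qed
        moreover have "{a, d} \<in> Ind V C" "\<forall>q\<in>Q. g a b q = g d b (g a d q)" if "a \<in> F" "b \<in> F" for a b
        proof -
          have f: "{a, d, b} \<in> Ind V C" using face[OF that] by (simp add: insert_commute)
          show "{a, d} \<in> Ind V C" by (rule Ind_mono[OF f]) auto
          show "\<forall>q\<in>Q. g a b q = g d b (g a d q)" using sys(2)[OF f] by simp
        qed
        ultimately show ?thesis by (intro exI[of _ g]) metis
      next
        \<comment> \<open>The 1-simplex {a, b} is new. Its transport is defined by a detour through
          a link vertex c; since the link is connected, every other link vertex gives the same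
          transport.\<close>
        case c2: 1
        then obtain a b where F: "F = {a, b}" "a \<noteq> b" by (auto simp: card_2_iff)
        have psiL: "2 \<le> psi ?L (colon C F)"
          using 2(3) c2 by (cases "psi ?L (colon C F)") (simp_all add: numeral_eq_enat)
        then have "1 \<le> psi ?L (colon C F)" by (metis one_le_numeral order_trans)
        then have "?L \<noteq> {}" by (rule psi_ge_1_nonempty)
        then obtain c where c: "c \<in> V - F" "insert c F \<in> Ind V (C - {F})"
          using link_vertex[OF h 2(1)] by blast
        have face: "{x, d, e} \<in> Ind V C"
          if "{d, e} \<in> Ind ?L (colon C F)" "x \<in> F" for x d e
        proof (rule old)
          have *: "{d, e} \<inter> F = {}" "{d, e} \<union> F \<in> Ind V (C - {F})"
            using that(1) unfolding Ind_colon_iff[OF h 2(1)] by (rule conjunct1, rule conjunct2)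
          show "{x, d, e} \<in> Ind V (C - {F})" by (rule Ind_mono[OF *(2)]) (use that(2) in auto)
          show "\<not> F \<subseteq> {x, d, e}" using *(1) F by auto
        qed
        have L: "{d} \<in> Ind ?L (colon C F)" "d \<in> ?L" if "insert d F \<in> Ind V (C - {F})" "d \<in> V - F" for d
        proof -
          show "{d} \<in> Ind ?L (colon C F)" using that Ind_colon_iff[OF h 2(1), of "{d}"] by simp
          then show "d \<in> ?L" by (auto simp: Ind_def)
        qed
        have indep: "g d y (g x d q) = g c y (g x c q)"
          if "insert d F \<in> Ind V (C - {F})" "d \<in> V - F" "x \<in> F" "y \<in> F" "q \<in> Q" for d x y q
        proof -
          \<comment> \<open>This predicate of e is constant along 1-simplices of the link: for
            adjacent u and v the triangles x, u, v and u, v, y are old, so the two detours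
            agree.\<close>
          let ?f = "\<lambda>e. g e y (g x e q) = g c y (g x c q)"
          have "?f d = ?f c"
          proof (rule psi_ge_2_connected[OF hypergraph_colon[OF h] psiL])
            show "d \<in> ?L" "c \<in> ?L" using L that c by blast+
            fix u v assume uv: "{u, v} \<in> Ind ?L (colon C F)"
            have f1: "{x, u, v} \<in> Ind V C" by (rule face[OF uv that(3)])
            have f2: "{u, v, y} \<in> Ind V C" using face[OF uv that(4)] by (simp add: insert_commute)
            have f3: "{x, u, u} \<in> Ind V C" by (rule Ind_mono[OF f1]) auto
            have q: "g x u q \<in> Q" by (rule sys(1)[OF f1 that(5)])
            have "g v y (g x v q) = g v y (g u v (g x u q))" using sys(2)[OF f1 that(5)] by simp
            also have "\<dots> = g u y (g x u q)" by (rule sys(2)[OF f2 q])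
            finally show "?f u = ?f v" by simp
          qed
          then show ?thesis by simp
        qed
        define g' where "g' = (\<lambda>u v. if F \<subseteq> {u, v} then \<lambda>q. g c v (g u c q) else g u v)"
        have viad: "{x, d} \<in> Ind V C \<and> (\<forall>q\<in>Q. g' x y q = g d y (g x d q))"
          if d: "insert d F \<in> Ind V (C - {F})" "d \<in> V - F" and xy: "x \<in> insert d F" "y \<in> insert d F" for d x y
        proof -
          have fd: "{z, d, d} \<in> Ind V C" if "z \<in> F" for z
            using face[of d d z] L(1)[OF d] that by simp
          have zd: "{z, d} \<in> Ind V C" if "z \<in> insert d F" for z
          proof (cases "z = d")
            case True
            have "{a, d, d} \<in> Ind V C" using fd F by blast
            then show ?thesis by (rule Ind_mono) (use True in auto)
          next
            case False
            then show ?thesis using fd[of z] that by simp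
          qed
          show ?thesis
          proof (intro conjI ballI zd xy(1))
            fix q assume q: "q \<in> Q"
            show "g' x y q = g d y (g x d q)"
            proof (cases "F \<subseteq> {x, y}")
              case True
              then have "x \<in> F" "y \<in> F" using xy F d(2) by auto
              then show ?thesis using indep[OF d _ _ q] True by (simp add: g'_def)
            next
              case False
              have "{x, d, y} \<in> Ind V C"
              proof (rule old)
                show "{x, d, y} \<in> Ind V (C - {F})" by (rule Ind_mono[OF d(1)]) (use xy in auto)
                show "\<not> F \<subseteq> {x, d, y}" using False d(2) by auto
              qed
              from sys(2)[OF this q] show ?thesis using False by (simp add: g'_def)
            qed
          qed
        qed
        have "\<exists>d. \<forall>x\<in>{u, v, w}. \<forall>y\<in>{u, v, w}. {x, d} \<in> Ind V C \<and> (\<forall>q\<in>Q. g' x y q = g d y (g x d q))"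
          if f: "{u, v, w} \<in> Ind V (C - {F})" "F \<subseteq> {u, v, w}" for u v w
        proof (cases "{u, v, w} = F")
          case True
          then show ?thesis using viad[OF c(2,1)] by (metis insertI2)
        next
          case False
          then obtain d where d: "d \<in> {u, v, w}" "d \<notin> F" using f(2) by blast
          have "{u, v, w} = insert d F"
          proof (rule sym, rule card_seteq)
            have "card (insert d F) = 3" using d(2) c2 finF by simp
            then show "card {u, v, w} \<le> card (insert d F)" by (simp add: card_insert_if)
          qed (use d f in auto)
          moreover have "d \<in> V - F" using d f(1) by (auto simp: Ind_def)
          ultimately show ?thesis using viad[of d] f(1) by metis
        qed
        moreover have "\<forall>u v. \<not> F \<subseteq> {u, v} \<longrightarrow> g' u v = g u v" by (simp add: g'_def)
        ultimately show ?thesis by blast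
      qed
    qed
    then obtain g' where *: "\<forall>u v. \<not> F \<subseteq> {u, v} \<longrightarrow> g' u v = g u v"
      "\<forall>u v w. {u, v, w} \<in> Ind V (C - {F}) \<longrightarrow> F \<subseteq> {u, v, w} \<longrightarrow>
         (\<exists>d. \<forall>a\<in>{u, v, w}. \<forall>b\<in>{u, v, w}. {a, d} \<in> Ind V C \<and> (\<forall>q\<in>Q. g' a b q = g d b (g a d q)))"
      by (elim exE conjE)
    note g' = *(1)[rule_format] *(2)[rule_format]
    have "cover_system (Ind V (C - {F})) Q g'"
      unfolding cover_system_def
    proof (intro allI impI)
      fix u v w q assume f: "{u, v, w} \<in> Ind V (C - {F})" and q: "q \<in> Q"
      show "g' u v q \<in> Q \<and> g' v w (g' u v q) = g' u w q \<and> g' u u q = q"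
      proof (cases "F \<subseteq> {u, v, w}")
        case False
        then have "{u, v, w} \<in> Ind V C" using old f by blast
        moreover have "\<not> F \<subseteq> {u, v}" "\<not> F \<subseteq> {v, w}" "\<not> F \<subseteq> {u, w}" "\<not> F \<subseteq> {u, u}" using False by auto
        ultimately show ?thesis using sys[OF _ q] g'(1) by metis
      next
        case True
        \<comment> \<open>On a face containing F every transport passes through d, so the
          composition rule follows by cancelling the passage from d to v and back.\<close>
        obtain d where d: "\<And>a b q. a \<in> {u, v, w} \<Longrightarrow> b \<in> {u, v, w} \<Longrightarrow> q \<in> Q \<Longrightarrow> g' a b q = g d b (g a d q)"
          "\<And>a. a \<in> {u, v, w} \<Longrightarrow> {a, d} \<in> Ind V C"
          using g'(2)[OF f True] by blast
        have to_d: "g a d p \<in> Q" "g d a (g a d p) = p" if "a \<in> {u, v, w}" "p \<in> Q" for a p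
        proof -
          have *: "{a, d, a} \<in> Ind V C" "{a, a, d} \<in> Ind V C" using d(2)[OF that(1)] by (simp_all add: insert_commute)
          show "g a d p \<in> Q" by (rule sys(1)[OF *(1) that(2)])
          show "g d a (g a d p) = p" using sys(2,3)[OF *(1) that(2)] by simp
        qed
        have from_d: "g d a p \<in> Q" "g a d (g d a p) = p" if "a \<in> {u, v, w}" "p \<in> Q" for a p
        proof -
          have *: "{d, a, d} \<in> Ind V C" using d(2)[OF that(1)] by (simp add: insert_commute)
          show "g d a p \<in> Q" by (rule sys(1)[OF * that(2)])
          show "g a d (g d a p) = p" using sys(2,3)[OF * that(2)] by simp
        qed
        have m: "u \<in> {u, v, w}" "v \<in> {u, v, w}" "w \<in> {u, v, w}" by auto
        have 1: "g' u v q = g d v (g u d q)" by (rule d(1)[OF m(1,2) q])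
        have 2: "g u d q \<in> Q" by (rule to_d(1)[OF m(1) q])
        have 3: "g' u v q \<in> Q" unfolding 1 by (rule from_d(1)[OF m(2) 2])
        have 4: "g' v w (g' u v q) = g d w (g v d (g d v (g u d q)))"
          using d(1)[OF m(2,3) 3] 1 by simp
        have 5: "\<dots> = g' u w q" using from_d(2)[OF m(2) 2] d(1)[OF m(1,3) q] by simp
        have 6: "g' u u q = q" using d(1)[OF m(1,1) q] to_d(2)[OF m(1) q] by simp
        show ?thesis using 3 4 5 6 by simp
      qed
    qed
    then obtain s where s: "cover_section (Ind V (C - {F})) Q g' s"
      using step.IH(1)[OF 2(1,2)] step.prems(3) by blast
    \<comment> \<open>No face of the smaller complex contains F, so \<open>g'\<close> agrees with g
      there and the section restricts.\<close>
    have "cover_section (Ind V C) Q g s"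
      unfolding cover_section_def
    proof (intro allI impI)
      fix u v assume uv: "{u, v} \<in> Ind V C"
      have "\<not> F \<subseteq> {u, v}" using uv 2(1) by (auto simp: Ind_def)
      moreover have "{u, v} \<in> Ind V (C - {F})" using uv by (auto simp: Ind_def)
      ultimately show "s u \<in> Q \<and> s v = g u v (s u)"
        using s g'(1) unfolding cover_section_def by metis
    qed
    then show ?thesis by blast
  qed
qed

section \<open>Homotopy groups and free null-homotopies\<close>

text \<open>Free homotopies replace the based ones of \<open>pi_trivial\<close>, since the two maps
  of a homotopy equivalence need not respect base points.\<close>

definition null_maps :: "'b topology \<Rightarrow> nat \<Rightarrow> bool" where
  "null_maps X i \<longleftrightarrow> (\<forall>f. continuous_map (nsphere i) X f \<longrightarrow>
     (\<exists>c. homotopic_with (\<lambda>_. True) (nsphere i) X f (\<lambda>_. c)))"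

definition nsph :: "nat \<Rightarrow> (nat \<Rightarrow> real) set" where
  "nsph n = {x. (\<Sum>i\<le>n. x i ^ 2) = 1 \<and> (\<forall>i>n. x i = 0)}"

text \<open>Indexed like its boundary \<open>nsph n\<close>: the dimension of this ball is n +
  1.\<close>

definition nball :: "nat \<Rightarrow> (nat \<Rightarrow> real) set" where
  "nball n = {x. (\<Sum>i\<le>n. x i ^ 2) \<le> 1 \<and> (\<forall>i>n. x i = 0)}"

lemma nsphere_eq: "nsphere n = top_of_set (nsph n)"
  unfolding nsphere nsph_def by (simp add: euclidean_product_topology)

lemma sphere_base_in: "sphere_base \<in> nsph n"
  by (simp add: sphere_base_def nsph_def power2_eq_square if_distrib [where f = "\<lambda>x. x * _"] cong: if_cong)

lemma nsph_subset_nball: "nsph n \<subseteq> nball n"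
  by (auto simp: nsph_def nball_def)

lemma nball_abs_le:
  assumes "x \<in> nball n" shows "\<bar>x i\<bar> \<le> 1"
proof (cases "i \<le> n")
  case True
  then have "x i ^ 2 \<le> (\<Sum>i\<le>n. x i ^ 2)" by (intro member_le_sum) auto
  then have "x i ^ 2 \<le> 1" using assms by (auto simp: nball_def)
  then show ?thesis by (simp add: abs_square_le_1)
qed (use assms in \<open>auto simp: nball_def\<close>)

lemma compact_nsph: "compact (nsph n)"
proof -
  have "compactin (product_topology (\<lambda>_. euclidean) UNIV) (PiE UNIV (\<lambda>_. {-1..1::real}))"
    by (subst compactin_PiE) auto
  then have c: "compact (PiE (UNIV :: nat set) (\<lambda>_. {-1..1::real}))"
    by (simp add: euclidean_product_topology)
  have "closed ({x. (\<Sum>i\<le>n. x i ^ 2) = 1} \<inter> (\<Inter>i\<in>{n<..}. {x :: nat \<Rightarrow> real. x i = 0}))"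
    by (intro closed_Int closed_INT ballI closed_Collect_eq continuous_intros continuous_on_product_coordinates)
  moreover have "nsph n = {x. (\<Sum>i\<le>n. x i ^ 2) = 1} \<inter> (\<Inter>i\<in>{n<..}. {x :: nat \<Rightarrow> real. x i = 0})"
    by (auto simp: nsph_def)
  ultimately have "closed (nsph n)" by simp
  moreover have "nsph n \<subseteq> PiE UNIV (\<lambda>_. {-1..1})"
    using nball_abs_le nsph_subset_nball by (force simp: abs_le_iff)
  ultimately show ?thesis using c by (metis compact_Int_closed inf.absorb_iff2)
qed

lemma homotopic_with_setI:
  fixes h :: "real \<times> 'a::topological_space \<Rightarrow> 'b::topological_space"
  assumes "continuous_on ({0..1} \<times> S) h" "\<And>t x. t \<in> {0..1} \<Longrightarrow> x \<in> S \<Longrightarrow> h (t, x) \<in> T"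
    and "\<And>x. x \<in> S \<Longrightarrow> h (0, x) = f x" "\<And>x. x \<in> S \<Longrightarrow> h (1, x) = g x"
  shows "homotopic_with (\<lambda>_. True) (top_of_set S) (top_of_set T) f g"
  using assms by (subst homotopic_with) (auto intro!: exI[of _ h])

lemma continuous_on_snd_coordinate:
  fixes S :: "('c::topological_space \<times> ('a \<Rightarrow> real)) set"
  shows "continuous_on S (\<lambda>p. snd p j)"
  by (rule continuous_on_product_then_coordinatewise) (intro continuous_intros)

text \<open>A free null-homotopy is constant on the top of the cylinder and so extends f over the
  ball. The straight-line contraction of the ball to \<open>sphere_base\<close> fixes that point,
  and composing with it gives a based homotopy.\<close>

lemma pi_trivial_iff_null:
  fixes X :: "'b topology"
  shows "pi_trivial X i \<longleftrightarrow> null_maps X i"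
proof
  assume p: "pi_trivial X i"
  show "null_maps X i" unfolding null_maps_def
  proof (intro allI impI)
    fix f assume f: "continuous_map (nsphere i) X f"
    then have "f sphere_base \<in> topspace X"
      using continuous_map_image_subset_topspace[OF f] sphere_base_in[of i] by (auto simp: nsphere_eq)
    then have "homotopic_with (\<lambda>h. h sphere_base = f sphere_base) (nsphere i) X f (\<lambda>_. f sphere_base)"
      using p f unfolding pi_trivial_def by blast
    then show "\<exists>c. homotopic_with (\<lambda>_. True) (nsphere i) X f (\<lambda>_. c)"
      by (blast intro: homotopic_with_mono)
  qed
next
  assume n: "null_maps X i"
  show "pi_trivial X i" unfolding pi_trivial_def
  proof (intro ballI allI impI)
    fix x f assume x: "x \<in> topspace X" and f: "continuous_map (nsphere i) X f \<and> f sphere_base = x"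
    then obtain c where "homotopic_with (\<lambda>_. True) (nsphere i) X f (\<lambda>_. c)"
      using n unfolding null_maps_def by blast
    then obtain H :: "real \<times> (nat \<Rightarrow> real) \<Rightarrow> 'b" where H: "continuous_map (prod_topology (top_of_set {0..1}) (nsphere i)) X H"
      "\<forall>x. H (0, x) = f x" "\<forall>x. H (1, x) = c"
      unfolding homotopic_with_def by (elim exE conjE)
    let ?P = "{0..1::real} \<times> nsph i"
    define \<phi> where "\<phi> = (\<lambda>(t :: real, x :: nat \<Rightarrow> real). \<lambda>j. (1 - t) * x j)"
    have c\<phi>: "continuous_on ?P \<phi>"
      unfolding \<phi>_def case_prod_unfold
      by (intro continuous_on_coordinatewise_then_product continuous_intros
           continuous_on_snd_coordinate)
    have norm_\<phi>: "(\<Sum>j\<le>i. \<phi> (t, x) j ^ 2) = (1 - t)\<^sup>2" if "x \<in> nsph i" for t x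
      using that by (simp add: \<phi>_def power_mult_distrib nsph_def flip: sum_distrib_left)
    have im: "\<phi> ` ?P = nball i"
    proof
      show "\<phi> ` ?P \<subseteq> nball i"
      proof
        fix v assume "v \<in> \<phi> ` ?P"
        then obtain t x where tx: "v = \<phi> (t, x)" "t \<in> {0..1}" "x \<in> nsph i" by blast
        have "(1 - t)\<^sup>2 \<le> 1" using tx(2) by (auto intro: power_le_one)
        moreover have "\<forall>j>i. v j = 0" using tx by (auto simp: \<phi>_def nsph_def)
        ultimately show "v \<in> nball i" using norm_\<phi>[OF tx(3), of t] tx(1) by (simp add: nball_def)
      qed
      show "nball i \<subseteq> \<phi> ` ?P"
      proof
        fix v assume v: "v \<in> nball i"
        define r where "r = sqrt (\<Sum>j\<le>i. v j ^ 2)"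
        have s0: "0 \<le> (\<Sum>j\<le>i. v j ^ 2)" by (simp add: sum_nonneg)
        then have r: "0 \<le> r" "r \<le> 1" "r\<^sup>2 = (\<Sum>j\<le>i. v j ^ 2)"
          using v by (auto simp: r_def nball_def)
        show "v \<in> \<phi> ` ?P"
        proof (cases "r = 0")
          case True
          then have "(\<Sum>j\<le>i. v j ^ 2) = 0" using r(3) by simp
          then have "\<forall>j\<le>i. v j = 0" by (simp add: sum_nonneg_eq_0_iff)
          then have "v j = 0" for j using v by (cases "j \<le> i") (auto simp: nball_def)
          then have "v = (\<lambda>_. 0)" by blast
          then have "v = \<phi> (1, sphere_base)" by (simp add: \<phi>_def)
          then show ?thesis using sphere_base_in[of i] by (intro image_eqI[of _ _ "(1, sphere_base)"]) auto
        next
          case False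
          have "(\<Sum>j\<le>i. (v j / r)\<^sup>2) = (\<Sum>j\<le>i. v j ^ 2) / r\<^sup>2"
            by (simp add: power_divide sum_divide_distrib)
          also have "\<dots> = 1" unfolding r(3)[symmetric] using False by simp
          finally have "(\<lambda>j. v j / r) \<in> nsph i" using v by (auto simp: nsph_def nball_def)
          moreover have "v = \<phi> (1 - r, \<lambda>j. v j / r)" using False by (simp add: \<phi>_def)
          ultimately show ?thesis using r by (intro image_eqI[of _ _ "(1 - r, \<lambda>j. v j / r)"]) auto
        qed
      qed
    qed
    have comp: "compact ?P" by (intro compact_Times compact_nsph compact_Icc)
    \<comment> \<open>X is an arbitrary space, so the extension to the ball comes from the quotient
      property of the continuous surjection from the compact cylinder.\<close>
    have "quotient_map (top_of_set ?P) (top_of_set (nball i)) \<phi>"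
      unfolding quotient_map_def
      using Abstract_Topology_2.continuous_imp_quotient_map[OF c\<phi> im comp] im
      by (auto simp: vimage_def Int_def)
    moreover have "continuous_map (top_of_set ?P) X H" using H(1) by (simp add: nsphere_eq)
    moreover have "H p = H q" if pq: "p \<in> topspace (top_of_set ?P)" "q \<in> topspace (top_of_set ?P)" "\<phi> p = \<phi> q" for p q
    proof -
      obtain t x s y where p: "p = (t, x)" "q = (s, y)" by (metis surj_pair)
      have *: "t \<in> {0..1}" "s \<in> {0..1}" "x \<in> nsph i" "y \<in> nsph i" using pq p by auto
      have "(1 - t)\<^sup>2 = (1 - s)\<^sup>2" using norm_\<phi>[OF *(3), of t] norm_\<phi>[OF *(4), of s] pq(3) p by simp
      then have "t = s" using * by (auto simp: power2_eq_iff)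
      show ?thesis
      proof (cases "t = 1")
        case True
        then show ?thesis using H(3) p \<open>t = s\<close> by simp
      next
        case False
        then have "x = y" using pq(3) p \<open>t = s\<close> by (auto simp: \<phi>_def fun_eq_iff)
        then show ?thesis using p \<open>t = s\<close> by simp
      qed
    qed
    ultimately obtain G where G: "continuous_map (top_of_set (nball i)) X G"
      "\<And>p. p \<in> ?P \<Longrightarrow> G (\<phi> p) = H p"
      by (rule quotient_map_lift_exists) (use that in auto)
    have Gf: "G y = f y" if "y \<in> nsph i" for y
      using G(2)[of "(0, y)"] that H(2) by (simp add: \<phi>_def)
    define k where "k = (\<lambda>(s :: real, y :: nat \<Rightarrow> real). \<lambda>j. (1 - s) * y j + s * sphere_base j)"
    have ck: "continuous_on ?P k"
      unfolding k_def case_prod_unfold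
      by (intro continuous_on_coordinatewise_then_product continuous_intros
           continuous_on_snd_coordinate)
    have kB: "k p \<in> nball i" if pP: "p \<in> ?P" for p
    proof -
      obtain s y where p: "p = (s, y)" "s \<in> {0..1}" "y \<in> nsph i" using pP by (elim SigmaE)
      \<comment> \<open>Convexity of the square, summed over the coordinates, keeps the segment
        inside the ball.\<close>
      have conv: "((1 - s) * a + s * b)\<^sup>2 \<le> (1 - s) * a\<^sup>2 + s * b\<^sup>2" for a b :: real
      proof -
        have "(1 - s) * a\<^sup>2 + s * b\<^sup>2 - ((1 - s) * a + s * b)\<^sup>2 = s * (1 - s) * (a - b)\<^sup>2"
          by (simp add: power2_eq_square algebra_simps)
        moreover have "0 \<le> s * (1 - s) * (a - b)\<^sup>2" using p(2) by simp
        ultimately show ?thesis by linarith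
      qed
      have "(\<Sum>j\<le>i. (k p j)\<^sup>2) \<le> (\<Sum>j\<le>i. (1 - s) * (y j)\<^sup>2 + s * (sphere_base j)\<^sup>2)"
        unfolding k_def p(1) prod.case by (intro sum_mono conv)
      also have "\<dots> = (1 - s) * (\<Sum>j\<le>i. (y j)\<^sup>2) + s * (\<Sum>j\<le>i. (sphere_base j)\<^sup>2)"
        by (simp add: sum.distrib sum_distrib_left)
      also have "\<dots> = 1" using p(3) sphere_base_in[of i] by (simp add: nsph_def)
      finally show ?thesis using p(3) sphere_base_in[of i] by (auto simp: nball_def nsph_def k_def p(1))
    qed
    have "continuous_map (top_of_set ?P) (top_of_set (nball i)) k"
      unfolding continuous_map_subtopology_eu using ck kB by (intro conjI Pi_I)
    then have cont: "continuous_map (prod_topology (top_of_set {0..1}) (nsphere i)) X (G \<circ> k)"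
      unfolding nsphere_eq prod_topology_subtopology_eu using G(1) by (rule continuous_map_compose)
    have base: "G sphere_base = x" using Gf[OF sphere_base_in] conjunct2[OF f] by (rule trans)
    have kb: "k (s, sphere_base) = sphere_base" for s by (auto simp: k_def algebra_simps)
    have k0: "k (0, y) = y" and k1: "k (1, y) = sphere_base" for y by (auto simp: k_def)
    show "homotopic_with (\<lambda>h. h sphere_base = x) (nsphere i) X f (\<lambda>_. x)"
    proof (subst homotopic_with)
      show "(h sphere_base = x) = (k sphere_base = x)" if "\<And>x. x \<in> topspace (nsphere i) \<Longrightarrow> h x = k x" for h k
      proof -
        have "h sphere_base = k sphere_base" by (rule that) (simp add: nsphere_eq sphere_base_in)
        then show ?thesis by simp
      qed
      show "\<exists>h. continuous_map (prod_topology (top_of_set {0..1::real}) (nsphere i)) X h \<and>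
            (\<forall>x\<in>topspace (nsphere i). h (0, x) = f x) \<and>
            (\<forall>xa\<in>topspace (nsphere i). h (1, xa) = x) \<and> (\<forall>t\<in>{0..1}. h (t, sphere_base) = x)"
        by (rule exI[of _ "G \<circ> k"], intro conjI ballI cont) (simp_all add: nsphere_eq kb k0 k1 Gf base)
    qed
  qed
qed

text \<open>A map f into X is homotopic to s \<circ> r \<circ> f, which factors through Y. The
  one-sided form is what the cross polytope inside a punctured space requires.\<close>

lemma null_maps_retract:
  assumes "null_maps Y i" "continuous_map X Y r" "continuous_map Y X s"
    and "homotopic_with (\<lambda>_. True) X X (s \<circ> r) id"
  shows "null_maps X i"
  unfolding null_maps_def
proof (intro allI impI)
  fix f assume f: "continuous_map (nsphere i) X f"
  then have "continuous_map (nsphere i) Y (r \<circ> f)" using assms(2) continuous_map_compose by blast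
  then obtain c where "homotopic_with (\<lambda>_. True) (nsphere i) Y (r \<circ> f) (\<lambda>_. c)"
    using assms(1) unfolding null_maps_def by blast
  then have "homotopic_with (\<lambda>_. True) (nsphere i) X (s \<circ> (r \<circ> f)) (s \<circ> (\<lambda>_. c))"
    by (rule homotopic_with_compose_continuous_map_left[OF _ assms(3)]) simp
  moreover have "homotopic_with (\<lambda>_. True) (nsphere i) X ((s \<circ> r) \<circ> f) (id \<circ> f)"
    by (rule homotopic_with_compose_continuous_map_right[OF assms(4) f]) simp
  ultimately have "homotopic_with (\<lambda>_. True) (nsphere i) X f (s \<circ> (\<lambda>_. c))"
    unfolding comp_assoc id_comp by (metis homotopic_with_symD homotopic_with_trans)
  then show "\<exists>c. homotopic_with (\<lambda>_. True) (nsphere i) X f (\<lambda>_. c)" by (auto simp: comp_def)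
qed

lemma null_maps_homotopy_equivalent:
  assumes "X homotopy_equivalent_space Y"
  shows "null_maps X i \<longleftrightarrow> null_maps Y i"
proof -
  obtain f g where *: "continuous_map X Y f" "continuous_map Y X g"
    "homotopic_with (\<lambda>_. True) X X (g \<circ> f) id" "homotopic_with (\<lambda>_. True) Y Y (f \<circ> g) id"
    using assms unfolding homotopy_equivalent_space_def by blast
  show ?thesis using null_maps_retract[OF _ *(1,2,3)] null_maps_retract[OF _ *(2,1,4)] by blast
qed

lemma conn_homotopy_equivalent:
  fixes X :: "'b topology" and Y :: "'c topology"
  assumes "X homotopy_equivalent_space Y"
  shows "conn X = conn Y"
proof -
  have "topspace X = {} \<longleftrightarrow> topspace Y = {}"
  proof -
    obtain f g where c: "continuous_map X Y f" "continuous_map Y X g"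
      using assms unfolding homotopy_equivalent_space_def by blast
    show ?thesis
      using continuous_map_image_subset_topspace[OF c(1)] continuous_map_image_subset_topspace[OF c(2)] by auto
  qed
  moreover have "pi_trivial X i = pi_trivial Y i" for i
    by (simp only: pi_trivial_iff_null null_maps_homotopy_equivalent[OF assms])
  ultimately show ?thesis unfolding conn_def by simp
qed

text \<open>Here n is the first degree with an essential map, so the supremum runs over -1, ..., n -
  1; for n = 0 only -1 is left.\<close>

lemma conn_eqI:
  assumes "topspace X \<noteq> {}" "\<And>i. i < n \<Longrightarrow> null_maps X i" "\<not> null_maps X n"
  shows "conn X = ereal (real n - 1)"
proof -
  have "(\<forall>i::nat. int i \<le> k \<longrightarrow> pi_trivial X i) \<longleftrightarrow> k \<le> int n - 1" for k
  proof
    assume "\<forall>i::nat. int i \<le> k \<longrightarrow> pi_trivial X i"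
    then have "\<not> int n \<le> k" using assms(3) unfolding pi_trivial_iff_null by blast
    then show "k \<le> int n - 1" by simp
  next
    assume "k \<le> int n - 1"
    then have "i < n" if "int i \<le> k" for i using that by simp
    then show "\<forall>i::nat. int i \<le> k \<longrightarrow> pi_trivial X i" using assms(2) by (simp add: pi_trivial_iff_null)
  qed
  then have "{ereal (real_of_int k) | k. -1 \<le> k \<and> (\<forall>i::nat. int i \<le> k \<longrightarrow> pi_trivial X i)}
      = (\<lambda>k. ereal (real_of_int k)) ` {-1..int n - 1}" by auto
  moreover have "Sup \<dots> = ereal (real n - 1)"
  proof (rule Sup_eqI)
    fix y assume y: "\<And>z. z \<in> (\<lambda>k. ereal (real_of_int k)) ` {-1..int n - 1} \<Longrightarrow> z \<le> y"
    have "ereal (real_of_int (int n - 1)) \<le> y" by (intro y imageI) simp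
    then show "ereal (real n - 1) \<le> y" by simp
  qed auto
  ultimately show ?thesis using assms(1) by (simp add: conn_def)
qed

lemma conn_contractible:
  assumes "contractible_space X" "topspace X \<noteq> {}"
  shows "conn X = \<infinity>"
proof -
  have "null_maps X i" for i
    unfolding null_maps_def
  proof (intro allI impI)
    fix f assume "continuous_map (nsphere i) X f"
    then obtain c where "homotopic_with (\<lambda>h. True) (nsphere i) X f (\<lambda>x. c)"
      by (rule nullhomotopic_into_contractible_space[OF _ assms(1)])
    then show "\<exists>c. homotopic_with (\<lambda>h. True) (nsphere i) X f (\<lambda>x. c)" by blast
  qed
  then have "{ereal (real_of_int k) | k. -1 \<le> k \<and> (\<forall>i::nat. int i \<le> k \<longrightarrow> pi_trivial X i)}
      = {ereal (real_of_int k) | k. -1 \<le> k}" by (simp add: pi_trivial_iff_null)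
  moreover have "Sup {ereal (real_of_int k) | k. -1 \<le> k} = \<infinity>"
  proof (rule Sup_eqI)
    fix y assume y: "\<And>z. z \<in> {ereal (real_of_int k) | k. -1 \<le> k} \<Longrightarrow> z \<le> y"
    have le: "ereal (real n) \<le> y" for n :: nat
    proof (rule y)
      have "ereal (real n) = ereal (real_of_int (int n)) \<and> - 1 \<le> int n" by simp
      then show "ereal (real n) \<in> {ereal (real_of_int k) | k. -1 \<le> k}" by blast
    qed
    show "\<infinity> \<le> y"
    proof (cases y)
      case (real r)
      obtain n where "r < real n" using reals_Archimedean2 by blast
      then show ?thesis using le[of n] real by simp
    qed (use le[of 0] in simp_all)
  qed simp
  ultimately show ?thesis using assms(2) by (simp add: conn_def)
qed

section \<open>Collapses\<close>

text \<open>Summing over a fixed finite U instead of the varying support lets sums be computed term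
  by term along a homotopy.\<close>

definition points :: "'a set \<Rightarrow> 'a set set \<Rightarrow> ('a \<Rightarrow> real) set" where
  "points U K = {f. (\<forall>v. 0 \<le> f v) \<and> {v. f v \<noteq> 0} \<in> K \<and> sum f U = 1}"

lemma realization_eq:
  assumes "finite U" "\<Union>K \<subseteq> U"
  shows "realization K = top_of_set (points U K)"
proof -
  have "sum f {v. f v \<noteq> 0} = sum f U" if "{v. f v \<noteq> 0} \<in> K" for f :: "'a \<Rightarrow> real"
    by (rule sum.mono_neutral_left) (use assms that in auto)
  then have "{f. (\<forall>v. 0 \<le> f v) \<and> {v. f v \<noteq> 0} \<in> K \<and> sum f {v. f v \<noteq> 0} = 1} = points U K"
    unfolding points_def by auto
  then show ?thesis by (simp add: realization_def)
qed

lemma continuous_on_Min_coordinates: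
  fixes s :: "'a set"
  assumes "finite s" "s \<noteq> {}"
  shows "continuous_on UNIV (\<lambda>f :: 'a \<Rightarrow> real. Min (f ` s))"
  using assms
proof (induction s rule: finite_ne_induct)
  case (insert x F)
  have "Min (f ` insert x F) = min (f x) (Min (f ` F))" for f :: "'a \<Rightarrow> real"
    using insert.hyps by simp
  then show ?case using insert.IH by (simp add: continuous_on_min)
qed simp

text \<open>The flow moves the least barycentric coordinate on s to the apex w.\<close>

lemma collapse_homotopy_equivalent:
  fixes K :: "'a set set"
  assumes finK: "finite (\<Union>K)" and down: "\<And>S T. S \<in> K \<Longrightarrow> T \<subseteq> S \<Longrightarrow> T \<in> K"
    and s: "finite s" "s \<noteq> {}" "w \<notin> s" and star: "\<And>S. S \<in> K \<Longrightarrow> s \<subseteq> S \<Longrightarrow> insert w S \<in> K"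
  shows "realization K homotopy_equivalent_space realization {S \<in> K. \<not> s \<subseteq> S}"
proof -
  let ?L = "{S \<in> K. \<not> s \<subseteq> S}"
  define U where "U = \<Union>K \<union> s \<union> {w}"
  have U: "finite U" "\<Union>K \<subseteq> U" "s \<subseteq> U" "w \<in> U" "\<Union>?L \<subseteq> U" using finK s by (auto simp: U_def)
  define m where "m = (\<lambda>f :: 'a \<Rightarrow> real. Min (f ` s))"
  \<comment> \<open>Each vertex of s gives up t * m f and w receives \<open>card s\<close> times
    this amount, so the coordinates still sum to 1.\<close>
  define h where "h = (\<lambda>(t :: real, f). \<lambda>v. f v - t * m f * (if v \<in> s then 1 else 0)
                        + (if v = w then real (card s) * (t * m f) else 0))"
  have m_le: "m f \<le> f v" if "v \<in> s" for f v using s that by (simp add: m_def)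
  have m_att: "\<exists>v\<in>s. f v = m f" for f
  proof -
    have "m f \<in> f ` s" unfolding m_def using s by (intro Min_in) auto
    then show ?thesis by (metis imageE)
  qed
  have cm: "continuous_on UNIV m" unfolding m_def by (rule continuous_on_Min_coordinates[OF s(1,2)])
  have cm2: "continuous_on A (\<lambda>p. m (snd p))" for A :: "(real \<times> ('a \<Rightarrow> real)) set"
    by (rule continuous_on_compose2[OF cm continuous_on_snd[OF continuous_on_id]]) simp
  have ch: "continuous_on A h" for A
    unfolding h_def case_prod_unfold
  proof (rule continuous_on_coordinatewise_then_product)
    fix v
    show "continuous_on A (\<lambda>p. snd p v - fst p * m (snd p) * (if v \<in> s then 1 else 0)
                        + (if v = w then real (card s) * (fst p * m (snd p)) else 0))"
      by (cases "v = w"; cases "v \<in> s")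
         (simp; intro continuous_on_add continuous_on_diff continuous_on_mult continuous_on_const
            continuous_on_fst continuous_on_id continuous_on_snd_coordinate cm2)+
  qed
  have m0: "0 \<le> m f" if "f \<in> points U K" for f
  proof -
    obtain v where "f v = m f" using m_att by blast
    moreover have "0 \<le> f v" using that by (simp add: points_def)
    ultimately show ?thesis by simp
  qed
  have hK: "h (t, f) \<in> points U K" if t: "t \<in> {0..1}" and f: "f \<in> points U K" for t f
  proof -
    have f0: "0 \<le> f v" for v using f by (simp add: points_def)
    have tm: "0 \<le> t * m f" "t * m f \<le> m f"
      using t m0[OF f] by (auto simp: mult_left_le_one_le)
    have pos: "0 \<le> h (t, f) v" for v
    proof (cases "v \<in> s")
      case True
      then have "v \<noteq> w" using s by auto
      then show ?thesis using m_le[OF True, of f] tm True by (simp add: h_def)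
    next
      case False
      then show ?thesis using tm f0[of v] by (simp add: h_def)
    qed
    have "sum (h (t, f)) U = sum f U - t * m f * (\<Sum>v\<in>U. if v \<in> s then 1 else 0)
            + (\<Sum>v\<in>U. if v = w then real (card s) * (t * m f) else 0)"
      by (simp add: h_def sum.distrib sum_subtractf sum_distrib_left)
    also have "(\<Sum>v\<in>U. if v \<in> s then 1 else 0) = real (card s)"
      using U by (simp add: sum.If_cases Int_absorb1)
    also have "(\<Sum>v\<in>U. if v = w then real (card s) * (t * m f) else 0) = real (card s) * (t * m f)"
      using U by simp
    finally have sum: "sum (h (t, f)) U = 1" using f by (simp add: points_def)
    \<comment> \<open>If anything moves, all coordinates on s are positive; then the support
      contains s and may be enlarged by w.\<close>
    have supp: "{v. h (t, f) v \<noteq> 0} \<in> K"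
    proof (cases "t * m f = 0")
      case True
      then have "h (t, f) = f" by (auto simp: h_def fun_eq_iff)
      then show ?thesis using f by (simp add: points_def)
    next
      case False
      then have "0 < m f" using tm by linarith
      then have "f v \<noteq> 0" if "v \<in> s" for v using m_le[OF that, of f] by linarith
      then have "s \<subseteq> {v. f v \<noteq> 0}" by blast
      then have "insert w {v. f v \<noteq> 0} \<in> K" using star f by (simp add: points_def)
      moreover have "{v. h (t, f) v \<noteq> 0} \<subseteq> insert w {v. f v \<noteq> 0}"
        using \<open>s \<subseteq> {v. f v \<noteq> 0}\<close> by (auto simp: h_def split: if_splits)
      ultimately show ?thesis by (rule down)
    qed
    show ?thesis using pos sum supp by (simp add: points_def)
  qed
  \<comment> \<open>At t = 1 the least coordinate on s has dropped to zero, so s is no longer in the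
    support.\<close>
  have h1: "h (1, f) \<in> points U ?L" if f: "f \<in> points U K" for f
  proof -
    obtain v where "v \<in> s" "f v = m f" using m_att by blast
    then have "h (1, f) v = 0" using s by (auto simp: h_def)
    then have "\<not> s \<subseteq> {v. h (1, f) v \<noteq> 0}" using \<open>v \<in> s\<close> by auto
    then show ?thesis using hK[of 1 f] f by (simp add: points_def)
  qed
  have hL: "h (t, f) = f" if f: "f \<in> points U ?L" for t f
  proof -
    have fK: "f \<in> points U K" using f by (simp add: points_def)
    obtain v where "v \<in> s" "f v = 0" using f by (auto simp: points_def)
    then have "m f = 0" using m_le[of v f] m0[OF fK] by simp
    then show ?thesis by (auto simp: h_def fun_eq_iff)
  qed
  have h0: "h (0, f) = f" for f by (auto simp: h_def fun_eq_iff)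
  have "homotopic_with (\<lambda>_. True) (top_of_set (points U K)) (top_of_set (points U K)) id (\<lambda>f. h (1, f))"
    by (rule homotopic_with_setI[OF ch]) (use hK h0 in simp_all)
  then have hom: "homotopic_with (\<lambda>_. True) (top_of_set (points U K)) (top_of_set (points U K)) (\<lambda>f. h (1, f)) id"
    by (rule homotopic_with_symD)
  have "continuous_on (points U K) (\<lambda>f. h (1, f))"
    by (rule continuous_on_compose2[OF ch[of UNIV]]) (intro continuous_on_Pair continuous_on_const continuous_on_id, simp)
  then have "retraction_maps (top_of_set (points U K)) (top_of_set (points U ?L)) (\<lambda>f. h (1, f)) id"
    unfolding retraction_maps_def continuous_map_subtopology_eu
    using h1 hL by (auto simp: points_def)
  from deformation_retract_imp_homotopy_equivalent_space[OF hom this]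
  show ?thesis unfolding realization_eq[OF U(1,2)] realization_eq[OF U(1,5)] .
qed

lemma cone_contractible:
  fixes K :: "'a set set"
  assumes finK: "finite (\<Union>K)" and down: "\<And>S T. S \<in> K \<Longrightarrow> T \<subseteq> S \<Longrightarrow> T \<in> K"
    and star: "\<And>S. S \<in> K \<Longrightarrow> insert w S \<in> K"
  shows "contractible_space (realization K)"
proof -
  define U where "U = insert w (\<Union>K)"
  have U: "finite U" "\<Union>K \<subseteq> U" "w \<in> U" using finK by (auto simp: U_def)
  define e :: "'a \<Rightarrow> real" where "e = (\<lambda>v. if v = w then 1 else 0)"
  define h where "h = (\<lambda>(t :: real, f). \<lambda>v. (1 - t) * f v + t * e v)"
  have ch: "continuous_on A h" for A
    unfolding h_def case_prod_unfold
    by (intro continuous_on_coordinatewise_then_product continuous_on_add continuous_on_diff continuous_on_mult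
          continuous_on_const continuous_on_fst continuous_on_id continuous_on_snd_coordinate)
  have hK: "h (t, f) \<in> points U K" if t: "t \<in> {0..1}" and f: "f \<in> points U K" for t f
  proof -
    have "sum (h (t, f)) U = (1 - t) * sum f U + t * sum e U"
      by (simp add: h_def sum.distrib sum_distrib_left)
    also have "sum e U = 1" using U by (simp add: e_def)
    finally have "sum (h (t, f)) U = 1" using f by (simp add: points_def)
    moreover have "insert w {v. f v \<noteq> 0} \<in> K" using f by (intro star) (simp add: points_def)
    then have "{v. h (t, f) v \<noteq> 0} \<in> K"
      by (rule down) (auto simp: h_def e_def split: if_splits)
    moreover have "0 \<le> h (t, f) v" for v using t f by (auto simp: h_def e_def points_def)
    ultimately show ?thesis by (simp add: points_def)
  qed
  have "homotopic_with (\<lambda>_. True) (top_of_set (points U K)) (top_of_set (points U K)) id (\<lambda>_. e)"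
    by (rule homotopic_with_setI[OF ch]) (use hK in \<open>simp_all add: h_def\<close>)
  then show ?thesis unfolding contractible_space_def realization_eq[OF U(1,2)] by blast
qed

section \<open>Cross polytopes\<close>

definition cube :: "(nat \<Rightarrow> real) set" where
  "cube = {x. \<forall>j. \<bar>x j\<bar> \<le> 1}"

lemma continuous_on_coordinate: "continuous_on A (\<lambda>f :: 'a \<Rightarrow> real. f j)"
  by (rule continuous_on_subset[OF continuous_on_product_coordinates]) simp

text \<open>Counting: a Lipschitz image of an m-dimensional cube is covered by too few small balls to
  contain a fine grid in a dimension above m.\<close>

lemma Lipschitz_misses_small_point:
  fixes F :: "(nat \<Rightarrow> real) \<Rightarrow> nat \<Rightarrow> real"
  assumes lip: "\<And>x y j. x \<in> cube \<Longrightarrow> y \<in> cube \<Longrightarrow> j < k \<Longrightarrow> \<bar>F x j - F y j\<bar> \<le> L * (\<Sum>a<m. \<bar>x a - y a\<bar>)"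
    and L: "0 \<le> L" and mk: "m < k" and e: "0 < e"
  shows "\<exists>p. (\<forall>j. \<bar>p j\<bar> \<le> e) \<and> (\<forall>x\<in>cube. \<exists>j<k. F x j \<noteq> p j)"
proof (rule ccontr)
  assume neg: "\<not> ?thesis"
  obtain K where K: "2 * L * real m / e < real K" using reals_Archimedean2 by blast
  have "0 \<le> 2 * L * real m / e" using L e by simp
  then have K0: "0 < K" using K by (metis of_nat_0 of_nat_0_less_iff order.strict_trans1)
  \<comment> \<open>Points of the cube in a common cell of the M-grid differ by at most 2 / M in
    each of m coordinates. Their images then differ by at most 2 L m / (K N) < e / N, the spacing of
    the grid of the points p b. So the (N + 1)^k grid points would need distinct cells, but there
    are at most (M + 1)^m \<le> N (N + 1)^m < (N + 1)^k of them.\<close>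
  define N where "N = K ^ m"
  define M where "M = K * N"
  have N0: "0 < N" using K0 by (simp add: N_def)
  have M0: "0 < M" using K0 N0 by (simp add: M_def)
  define B where "B = PiE {..<k} (\<lambda>_. {..N})"
  define p where "p = (\<lambda>b j. if j < k then e * real (b j) / real N else 0)"
  have "\<exists>x\<in>cube. \<forall>j<k. F x j = p b j" if b: "b \<in> B" for b
  proof -
    have "\<bar>p b j\<bar> \<le> e" for j
    proof (cases "j < k")
      case True
      then have "b j \<le> N" using b by (auto simp: B_def PiE_def Pi_def)
      then have "e * real (b j) \<le> e * real N" using e by simp
      then show ?thesis using True e N0 by (simp add: p_def divide_le_eq abs_mult)
    qed (use e in \<open>simp add: p_def\<close>)
    then show ?thesis using neg by blast
  qed
  then obtain X where X: "\<And>b. b \<in> B \<Longrightarrow> X b \<in> cube" "\<And>b j. b \<in> B \<Longrightarrow> j < k \<Longrightarrow> F (X b) j = p b j"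
    by metis
  define g where "g = (\<lambda>b. \<lambda>a\<in>{..<m}. nat \<lfloor>(X b a + 1) / 2 * real M\<rfloor>)"
  have range: "0 \<le> (X b a + 1) / 2 * real M \<and> (X b a + 1) / 2 * real M \<le> real M" if "b \<in> B" for b a
  proof -
    have "\<bar>X b a\<bar> \<le> 1" using X(1)[OF that] by (simp add: cube_def)
    then have *: "0 \<le> (X b a + 1) / 2" "(X b a + 1) / 2 \<le> 1" by auto
    have "0 \<le> (X b a + 1) / 2 * real M" by (intro mult_nonneg_nonneg *) simp
    moreover have "(X b a + 1) / 2 * real M \<le> 1 * real M" by (intro mult_right_mono *) simp
    ultimately show ?thesis by simp
  qed
  have "g \<in> B \<rightarrow> PiE {..<m} (\<lambda>_. {..M})"
  proof
    fix b assume b: "b \<in> B"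
    have "nat \<lfloor>(X b a + 1) / 2 * real M\<rfloor> \<le> M" for a
    proof -
      have "\<lfloor>(X b a + 1) / 2 * real M\<rfloor> \<le> int M" using range[OF b, of a] by (simp add: floor_le_iff)
      then show ?thesis by simp
    qed
    then show "g b \<in> PiE {..<m} (\<lambda>_. {..M})" by (simp add: g_def)
  qed
  moreover have "inj_on g B"
  proof (rule inj_onI)
    fix b b' assume b: "b \<in> B" "b' \<in> B" and eq: "g b = g b'"
    have close: "\<bar>X b a - X b' a\<bar> \<le> 2 / real M" if "a < m" for a
    proof -
      have "nat \<lfloor>(X b a + 1) / 2 * real M\<rfloor> = nat \<lfloor>(X b' a + 1) / 2 * real M\<rfloor>"
        using fun_cong[OF eq, of a] that by (simp add: g_def)
      moreover have "0 \<le> \<lfloor>(X b a + 1) / 2 * real M\<rfloor>" "0 \<le> \<lfloor>(X b' a + 1) / 2 * real M\<rfloor>"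
        using range[OF b(1)] range[OF b(2)] by simp_all
      ultimately have "\<lfloor>(X b a + 1) / 2 * real M\<rfloor> = \<lfloor>(X b' a + 1) / 2 * real M\<rfloor>" by linarith
      then have "\<bar>(X b a + 1) / 2 * real M - (X b' a + 1) / 2 * real M\<bar> < 1" by linarith
      moreover have "(X b a + 1) / 2 * real M - (X b' a + 1) / 2 * real M = (X b a - X b' a) * (real M / 2)"
        by (simp add: field_simps)
      ultimately have "\<bar>X b a - X b' a\<bar> * (real M / 2) < 1" by (simp add: abs_mult)
      then show ?thesis using M0 by (simp add: field_simps)
    qed
    have "b j = b' j" if j: "j < k" for j
    proof -
      have "\<bar>p b j - p b' j\<bar> \<le> L * (\<Sum>a<m. \<bar>X b a - X b' a\<bar>)"
        using lip[OF X(1)[OF b(1)] X(1)[OF b(2)] j] X(2)[OF b(1) j] X(2)[OF b(2) j] by simp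
      also have "\<dots> \<le> L * (\<Sum>a<m. 2 / real M)" using L close by (intro mult_left_mono sum_mono) auto
      also have "\<dots> = (2 * L * real m) / (real K * real N)" by (simp add: M_def)
      also have "\<dots> < e / real N"
      proof -
        have "2 * L * real m < real K * e" using K e by (simp add: field_simps)
        then show ?thesis using K0 N0 by (simp add: field_simps)
      qed
      finally have "\<bar>e / real N * (real (b j) - real (b' j))\<bar> < e / real N"
        using j by (simp add: p_def algebra_simps diff_divide_distrib)
      moreover have pos: "0 < e / real N" using e N0 by simp
      ultimately have "e / real N * \<bar>real (b j) - real (b' j)\<bar> < e / real N * 1"
        by (simp only: abs_mult abs_of_pos mult_1_right)
      then have "\<bar>real (b j) - real (b' j)\<bar> < 1" using pos by (simp only: mult_less_cancel_left_pos)
      then show ?thesis by linarith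
    qed
    then show "b = b'" using b by (intro PiE_ext[of b "{..<k}" _ b']) (auto simp: B_def)
  qed
  moreover have "finite (PiE {..<m} (\<lambda>_. {..M}))" by (simp add: finite_PiE)
  ultimately have "card B \<le> card (PiE {..<m} (\<lambda>_. {..M}))" by (intro card_inj_on_le) auto
  then have "Suc N ^ k \<le> Suc M ^ m" by (simp add: B_def card_PiE)
  also have "\<dots> \<le> (K * Suc N) ^ m" using K0 by (intro power_mono) (auto simp: M_def)
  also have "\<dots> = N * Suc N ^ m" by (simp only: power_mult_distrib N_def)
  also have "\<dots> < Suc N ^ Suc m" by simp
  also have "\<dots> \<le> Suc N ^ k" using mk by (intro power_increasing) auto
  finally show False by simp
qed

text \<open>The bound sees the first m coordinates only, so on the cube g is a function of m
  variables. A cube instead of the sphere is used because the final homotopy runs through the ball;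
  its boundedness makes the class closed under products, as Stone-Weierstrass requires.\<close>

definition Lipschitz_on_cube :: "nat \<Rightarrow> ((nat \<Rightarrow> real) \<Rightarrow> real) \<Rightarrow> bool" where
  "Lipschitz_on_cube m g \<longleftrightarrow> continuous_on UNIV g \<and>
     (\<exists>L\<ge>0. \<forall>x\<in>cube. \<forall>y\<in>cube. \<bar>g x - g y\<bar> \<le> L * (\<Sum>a<m. \<bar>x a - y a\<bar>))"

lemma Lipschitz_on_cube_add:
  assumes "Lipschitz_on_cube m f" "Lipschitz_on_cube m g"
  shows "Lipschitz_on_cube m (\<lambda>x. f x + g x)"
proof -
  obtain L where L: "0 \<le> L" "\<And>x y. x \<in> cube \<Longrightarrow> y \<in> cube \<Longrightarrow> \<bar>f x - f y\<bar> \<le> L * (\<Sum>a<m. \<bar>x a - y a\<bar>)"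
    using assms(1) unfolding Lipschitz_on_cube_def by blast
  obtain M where M: "0 \<le> M" "\<And>x y. x \<in> cube \<Longrightarrow> y \<in> cube \<Longrightarrow> \<bar>g x - g y\<bar> \<le> M * (\<Sum>a<m. \<bar>x a - y a\<bar>)"
    using assms(2) unfolding Lipschitz_on_cube_def by blast
  have "\<bar>(f x + g x) - (f y + g y)\<bar> \<le> (L + M) * (\<Sum>a<m. \<bar>x a - y a\<bar>)" if "x \<in> cube" "y \<in> cube" for x y
    using L(2)[OF that] M(2)[OF that] unfolding distrib_right by linarith
  moreover have "0 \<le> L + M" using L M by simp
  moreover have "continuous_on UNIV (\<lambda>x. f x + g x)"
    using assms by (intro continuous_on_add) (simp_all add: Lipschitz_on_cube_def)
  ultimately show ?thesis
    unfolding Lipschitz_on_cube_def by (intro conjI exI[of _ "L + M"] ballI) simp_all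
qed

lemma Lipschitz_on_cube_mult:
  assumes "Lipschitz_on_cube m f" "Lipschitz_on_cube m g"
  shows "Lipschitz_on_cube m (\<lambda>x. f x * g x)"
proof -
  obtain L where L: "0 \<le> L" "\<And>x y. x \<in> cube \<Longrightarrow> y \<in> cube \<Longrightarrow> \<bar>f x - f y\<bar> \<le> L * (\<Sum>a<m. \<bar>x a - y a\<bar>)"
    using assms(1) unfolding Lipschitz_on_cube_def by blast
  obtain M where M: "0 \<le> M" "\<And>x y. x \<in> cube \<Longrightarrow> y \<in> cube \<Longrightarrow> \<bar>g x - g y\<bar> \<le> M * (\<Sum>a<m. \<bar>x a - y a\<bar>)"
    using assms(2) unfolding Lipschitz_on_cube_def by blast
  have zero: "(\<lambda>_. 0) \<in> cube" by (simp add: cube_def)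
  have S: "(\<Sum>a<m. \<bar>x a - 0\<bar>) \<le> real m" if "x \<in> cube" for x
    using sum_bounded_above[of "{..<m}" "\<lambda>a. \<bar>x a - 0\<bar>" 1] that by (simp add: cube_def)
  define A where "A = \<bar>f (\<lambda>_. 0)\<bar> + L * real m"
  define B where "B = \<bar>g (\<lambda>_. 0)\<bar> + M * real m"
  have bf: "\<bar>f x\<bar> \<le> A" if "x \<in> cube" for x
    using L(2)[OF that zero] mult_left_mono[OF S[OF that] L(1)] unfolding A_def by linarith
  have bg: "\<bar>g x\<bar> \<le> B" if "x \<in> cube" for x
    using M(2)[OF that zero] mult_left_mono[OF S[OF that] M(1)] unfolding B_def by linarith
  have AB: "0 \<le> A" "0 \<le> B" using L(1) M(1) by (simp_all add: A_def B_def)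
  have "\<bar>f x * g x - f y * g y\<bar> \<le> (A * M + B * L) * (\<Sum>a<m. \<bar>x a - y a\<bar>)" if "x \<in> cube" "y \<in> cube" for x y
  proof -
    let ?d = "\<Sum>a<m. \<bar>x a - y a\<bar>"
    have "f x * g x - f y * g y = f x * (g x - g y) + g y * (f x - f y)" by (simp add: algebra_simps)
    then have "\<bar>f x * g x - f y * g y\<bar> \<le> \<bar>f x\<bar> * \<bar>g x - g y\<bar> + \<bar>g y\<bar> * \<bar>f x - f y\<bar>"
      by (metis abs_mult abs_triangle_ineq)
    also have "\<dots> \<le> A * (M * ?d) + B * (L * ?d)"
      by (intro add_mono mult_mono bf bg L(2) M(2) that AB) auto
    finally show ?thesis by (simp add: algebra_simps)
  qed
  moreover have "0 \<le> A * M + B * L" using AB L(1) M(1) by simp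
  moreover have "continuous_on UNIV (\<lambda>x. f x * g x)"
    using assms by (intro continuous_on_mult) (simp_all add: Lipschitz_on_cube_def)
  ultimately show ?thesis
    unfolding Lipschitz_on_cube_def by (intro conjI exI[of _ "A * M + B * L"] ballI) simp_all
qed

lemma Lipschitz_on_cube_coordinate:
  assumes "j < m" shows "Lipschitz_on_cube m (\<lambda>x. x j)"
  unfolding Lipschitz_on_cube_def
proof (intro conjI exI[of _ 1] ballI continuous_on_coordinate)
  fix x y :: "nat \<Rightarrow> real"
  show "\<bar>x j - y j\<bar> \<le> 1 * (\<Sum>a<m. \<bar>x a - y a\<bar>)"
    using member_le_sum[of j "{..<m}" "\<lambda>a. \<bar>x a - y a\<bar>"] assms by simp
qed simp

lemma Lipschitz_approximation:
  assumes "continuous_on (nsph i) f" "0 < e"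
  shows "\<exists>g. Lipschitz_on_cube (Suc i) g \<and> (\<forall>x\<in>nsph i. \<bar>f x - g x\<bar> < e)"
proof (rule Stone_Weierstrass_HOL[OF compact_nsph])
  fix c :: real
  have "\<forall>x\<in>cube. \<forall>y\<in>cube. \<bar>c - c\<bar> \<le> 0 * (\<Sum>a<Suc i. \<bar>x a - y a\<bar>)" by simp
  then show "Lipschitz_on_cube (Suc i) (\<lambda>_. c)"
    unfolding Lipschitz_on_cube_def using continuous_on_const by blast
next
  fix g :: "(nat \<Rightarrow> real) \<Rightarrow> real" assume "Lipschitz_on_cube (Suc i) g"
  then show "continuous_on (nsph i) g"
    unfolding Lipschitz_on_cube_def using continuous_on_subset by blast
next
  fix g h :: "(nat \<Rightarrow> real) \<Rightarrow> real" assume "Lipschitz_on_cube (Suc i) g \<and> Lipschitz_on_cube (Suc i) h"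
  then show "Lipschitz_on_cube (Suc i) (\<lambda>x. g x + h x)" "Lipschitz_on_cube (Suc i) (\<lambda>x. g x * h x)"
    using Lipschitz_on_cube_add Lipschitz_on_cube_mult by simp_all
next
  fix x y assume xy: "x \<in> nsph i \<and> y \<in> nsph i \<and> x \<noteq> y"
  then obtain j where "x j \<noteq> y j" by blast
  moreover have "j < Suc i"
  proof (rule ccontr)
    assume "\<not> j < Suc i"
    then have "x j = 0" "y j = 0" using xy by (auto simp: nsph_def)
    then show False using \<open>x j \<noteq> y j\<close> by simp
  qed
  ultimately show "\<exists>f. Lipschitz_on_cube (Suc i) f \<and> f x \<noteq> f y"
    using Lipschitz_on_cube_coordinate by blast
qed (use assms in simp_all)

text \<open>The k-dimensional space without the origin; the coordinates from k on are left free,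
  which does not change the homotopy type.\<close>

definition punctured :: "nat \<Rightarrow> (nat \<Rightarrow> real) set" where
  "punctured k = {v. \<exists>j<k. v j \<noteq> 0}"

text \<open>Approximate f by a Lipschitz map g on the whole cube. The ball bounded by
  \<open>nsph i\<close> has dimension i + 1 < k, so g misses a small p on the cube. Then g - p is
  homotopic to f in the punctured space and contracts through the ball.\<close>

lemma null_maps_punctured:
  assumes ik: "Suc i < k"
  shows "null_maps (top_of_set (punctured k)) i"
  unfolding null_maps_def
proof (intro allI impI)
  fix f assume "continuous_map (nsphere i) (top_of_set (punctured k)) f"
  then have cf: "continuous_on (nsph i) f" and fp: "\<And>x. x \<in> nsph i \<Longrightarrow> f x \<in> punctured k"
    unfolding nsphere_eq continuous_map_subtopology_eu by auto
  have cfj: "continuous_on (nsph i) (\<lambda>x. f x j)" for j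
    by (rule continuous_on_product_then_coordinatewise[OF cf])
  have "continuous_on (nsph i) (\<lambda>x. \<Sum>j<k. \<bar>f x j\<bar>)"
    by (intro continuous_on_sum continuous_on_rabs cfj)
  moreover have "nsph i \<noteq> {}" using sphere_base_in by blast
  ultimately obtain x0 where x0: "x0 \<in> nsph i" "\<forall>x\<in>nsph i. (\<Sum>j<k. \<bar>f x0 j\<bar>) \<le> (\<Sum>j<k. \<bar>f x j\<bar>)"
    using continuous_attains_inf[OF compact_nsph] by blast
  define \<mu> where "\<mu> = (\<Sum>j<k. \<bar>f x0 j\<bar>)"
  have "0 < \<mu>"
  proof -
    obtain j where "j < k" "f x0 j \<noteq> 0" using fp[OF x0(1)] by (auto simp: punctured_def)
    then show ?thesis unfolding \<mu>_def by (intro sum_pos2[of _ j]) auto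
  qed
  \<comment> \<open>Approximation error and shift p cost at most 2 * e in each coordinate, together
    2 * e * k = \<mu> / 2 in the sum norm. This is less than \<mu>, so the segment from f to g - p
    misses the origin.\<close>
  define e where "e = \<mu> / (4 * real k)"
  have e: "0 < e" "2 * e * real k < \<mu>" using \<open>0 < \<mu>\<close> ik by (auto simp: e_def)
  have "\<forall>j. \<exists>g. Lipschitz_on_cube (Suc i) g \<and> (\<forall>x\<in>nsph i. \<bar>f x j - g x\<bar> < e)"
    using Lipschitz_approximation[OF cfj e(1)] by blast
  then obtain g where g: "\<And>j. Lipschitz_on_cube (Suc i) (g j)" "\<And>j x. x \<in> nsph i \<Longrightarrow> \<bar>f x j - g j x\<bar> < e"
    by metis
  have cg: "continuous_on UNIV (g j)" for j using g(1)[of j] by (simp add: Lipschitz_on_cube_def)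
  have "\<forall>j. \<exists>L\<ge>0. \<forall>x\<in>cube. \<forall>y\<in>cube. \<bar>g j x - g j y\<bar> \<le> L * (\<Sum>a<Suc i. \<bar>x a - y a\<bar>)"
    using g(1) unfolding Lipschitz_on_cube_def by blast
  then obtain L where L: "\<And>j. 0 \<le> L j"
    "\<And>j x y. x \<in> cube \<Longrightarrow> y \<in> cube \<Longrightarrow> \<bar>g j x - g j y\<bar> \<le> L j * (\<Sum>a<Suc i. \<bar>x a - y a\<bar>)"
    by metis
  have "\<exists>p. (\<forall>j. \<bar>p j\<bar> \<le> e) \<and> (\<forall>x\<in>cube. \<exists>j<k. g j x \<noteq> p j)"
  proof (rule Lipschitz_misses_small_point[where F = "\<lambda>x j. g j x", OF _ _ ik e(1)])
    fix x y j assume *: "x \<in> cube" "y \<in> cube" "j < k"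
    have "L j \<le> (\<Sum>j<k. L j)" using L(1) *(3) by (intro member_le_sum) auto
    then have "L j * (\<Sum>a<Suc i. \<bar>x a - y a\<bar>) \<le> (\<Sum>j<k. L j) * (\<Sum>a<Suc i. \<bar>x a - y a\<bar>)"
      by (intro mult_right_mono sum_nonneg) auto
    then show "\<bar>g j x - g j y\<bar> \<le> (\<Sum>j<k. L j) * (\<Sum>a<Suc i. \<bar>x a - y a\<bar>)"
      using L(2)[OF *(1,2), of j] by linarith
  qed (use L(1) in \<open>simp add: sum_nonneg\<close>)
  then obtain p where p: "\<And>j. \<bar>p j\<bar> \<le> e" "\<And>x. x \<in> cube \<Longrightarrow> \<exists>j<k. g j x \<noteq> p j" by blast
  define h1 where "h1 = (\<lambda>(t :: real, x). \<lambda>j. f x j + t * (g j x - p j - f x j))"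
  define h2 where "h2 = (\<lambda>(t :: real, x :: nat \<Rightarrow> real). \<lambda>j. g j (\<lambda>a. (1 - t) * x a) - p j)"
  let ?P = "{0..1::real} \<times> nsph i"
  have csnd: "continuous_on ?P (\<lambda>q. u (snd q))" if "continuous_on (nsph i) u" for u :: "_ \<Rightarrow> real"
    by (rule continuous_on_compose2[OF that continuous_on_snd[OF continuous_on_id]]) auto
  have "homotopic_with (\<lambda>_. True) (nsphere i) (top_of_set (punctured k)) f (\<lambda>x j. g j x - p j)"
    unfolding nsphere_eq
  proof (rule homotopic_with_setI[of _ h1])
    show "continuous_on ?P h1"
      unfolding h1_def case_prod_unfold
      by (intro continuous_on_coordinatewise_then_product continuous_on_add continuous_on_mult continuous_on_diff
            continuous_on_const continuous_on_fst continuous_on_id csnd cfj continuous_on_subset[OF cg]) simp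
    fix t :: real and x assume t: "t \<in> {0..1}" and x: "x \<in> nsph i"
    show "h1 (t, x) \<in> punctured k"
    proof (rule ccontr)
      assume "h1 (t, x) \<notin> punctured k"
      then have z: "h1 (t, x) j = 0" if "j < k" for j using that by (auto simp: punctured_def)
      have "\<bar>f x j\<bar> \<le> 2 * e" if j: "j < k" for j
      proof -
        have 1: "\<bar>f x j\<bar> = \<bar>t\<bar> * \<bar>g j x - p j - f x j\<bar>" using z[OF j] by (simp add: h1_def flip: abs_mult)
        have 2: "\<bar>g j x - p j - f x j\<bar> \<le> 2 * e" using g(2)[OF x, of j] p(1)[of j] by linarith
        have "\<bar>t\<bar> * \<bar>g j x - p j - f x j\<bar> \<le> 1 * (2 * e)" using t 2 by (intro mult_mono) auto
        then show ?thesis using 1 by simp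
      qed
      then have "(\<Sum>j<k. \<bar>f x j\<bar>) \<le> (\<Sum>j<k. 2 * e)" by (intro sum_mono) auto
      then have "(\<Sum>j<k. \<bar>f x j\<bar>) \<le> 2 * e * real k" by (simp add: mult.commute)
      then show False using bspec[OF x0(2) x] e(2) unfolding \<mu>_def by linarith
    qed
  qed (auto simp: h1_def)
  moreover have "homotopic_with (\<lambda>_. True) (nsphere i) (top_of_set (punctured k)) (\<lambda>x j. g j x - p j)
      (\<lambda>_ j. g j (\<lambda>_. 0) - p j)"
    unfolding nsphere_eq
  proof (rule homotopic_with_setI[of _ h2])
    have "continuous_on ?P (\<lambda>q. \<lambda>a. (1 - fst q) * snd q a)"
      by (intro continuous_on_coordinatewise_then_product continuous_on_mult continuous_on_diff continuous_on_const
            continuous_on_fst continuous_on_id continuous_on_snd_coordinate)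
    then have "continuous_on ?P (\<lambda>q. g j (\<lambda>a. (1 - fst q) * snd q a))" for j
      by (rule continuous_on_compose2[OF cg]) simp
    then show "continuous_on ?P h2"
      unfolding h2_def case_prod_unfold
      by (intro continuous_on_coordinatewise_then_product continuous_on_diff continuous_on_const)
    fix t :: real and x assume t: "t \<in> {0..1}" and x: "x \<in> nsph i"
    have "\<bar>(1 - t) * x a\<bar> \<le> 1" for a
    proof -
      have "\<bar>x a\<bar> \<le> 1" using x nsph_subset_nball nball_abs_le by blast
      then have "\<bar>1 - t\<bar> * \<bar>x a\<bar> \<le> 1 * 1" using t by (intro mult_mono) auto
      then show ?thesis by (simp add: abs_mult)
    qed
    then have "(\<lambda>a. (1 - t) * x a) \<in> cube" by (simp add: cube_def)
    then show "h2 (t, x) \<in> punctured k" using p(2) by (force simp: punctured_def h2_def)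
  qed (auto simp: h2_def)
  ultimately show "\<exists>c. homotopic_with (\<lambda>_. True) (nsphere i) (top_of_set (punctured k)) f (\<lambda>_. c)"
    using homotopic_with_trans by blast
qed

text \<open>The boundary complex of the k-dimensional cross polytope, a sphere of dimension k - 1; a
  j and b j are antipodal.\<close>

definition cross :: "(nat \<Rightarrow> 'a) \<Rightarrow> (nat \<Rightarrow> 'a) \<Rightarrow> nat \<Rightarrow> 'a set set" where
  "cross a b k = {S. S \<subseteq> a ` {..<k} \<union> b ` {..<k} \<and> (\<forall>j<k. \<not> (a j \<in> S \<and> b j \<in> S))}"

text \<open>The realization is a retract of the punctured space, so its homotopy groups below degree
  k - 1 vanish. In degree k - 1 a null-homotopy of d on the unit sphere would contract that
  sphere.\<close>

lemma conn_cross: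
  fixes a b :: "nat \<Rightarrow> 'a"
  assumes inj: "inj_on a {..<k}" "inj_on b {..<k}"
    and disj: "\<And>i j. i < k \<Longrightarrow> j < k \<Longrightarrow> a i \<noteq> b j" and k: "1 \<le> k"
  shows "conn (realization (cross a b k)) = ereal (real k - 2)"
proof -
  define U where "U = a ` {..<k} \<union> b ` {..<k}"
  let ?X = "points U (cross a b k)"
  have finU: "finite U" by (simp add: U_def)
  have "\<Union>(cross a b k) \<subseteq> U" unfolding cross_def U_def by blast
  note real = realization_eq[OF finU this]
  have aU: "a j \<in> U" "b j \<in> U" if "j < k" for j using that by (auto simp: U_def)
  have dab: "a ` {..<k} \<inter> b ` {..<k} = {}" using disj by auto
  have sumU: "sum f U = (\<Sum>j<k. f (a j) + f (b j))" for f :: "'a \<Rightarrow> real"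
  proof -
    have "sum f U = sum f (a ` {..<k}) + sum f (b ` {..<k})"
      unfolding U_def by (rule sum.union_disjoint) (use dab in auto)
    then show ?thesis by (simp add: sum.reindex[OF inj(1)] sum.reindex[OF inj(2)] sum.distrib)
  qed
  define n where "n = (\<lambda>v :: nat \<Rightarrow> real. \<Sum>j<k. \<bar>v j\<bar>)"
  \<comment> \<open>c places a j at the j-th unit vector and b j at its negative. d scales to sum
    norm 1 and separates positive and negative parts, so d \<circ> c is the identity.\<close>
  define c where "c = (\<lambda>f :: 'a \<Rightarrow> real. \<lambda>j. if j < k then f (a j) - f (b j) else 0)"
  define d where "d = (\<lambda>v :: nat \<Rightarrow> real. \<lambda>x. (\<Sum>j<k. of_bool (x = a j) * max (v j) 0 + of_bool (x = b j) * max (- v j) 0) / n v)"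
  have n_pos: "0 < n v" if v: "v \<in> punctured k" for v
  proof -
    obtain j where "j < k" "v j \<noteq> 0" using v by (auto simp: punctured_def)
    then show ?thesis unfolding n_def by (intro sum_pos2[of _ j]) auto
  qed
  have da: "d v (a i) = max (v i) 0 / n v" and db: "d v (b i) = max (- v i) 0 / n v" if "i < k" for v i
  proof -
    have "(\<Sum>j<k. of_bool (a i = a j) * max (v j) 0 + of_bool (a i = b j) * max (- v j) 0)
        = (\<Sum>j<k. if j = i then max (v j) 0 else 0)"
      using that disj inj(1) by (intro sum.cong) (auto simp: inj_on_def)
    then show "d v (a i) = max (v i) 0 / n v" using that by (simp add: d_def)
    have "(\<Sum>j<k. of_bool (b i = a j) * max (v j) 0 + of_bool (b i = b j) * max (- v j) 0)
        = (\<Sum>j<k. if j = i then max (- v j) 0 else 0)"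
      using that disj inj(2) by (intro sum.cong) (auto simp: inj_on_def dest: sym)
    then show "d v (b i) = max (- v i) 0 / n v" using that by (simp add: d_def)
  qed
  have d0: "d v x = 0" if "x \<notin> U" for v x
  proof -
    have "x \<noteq> a j" "x \<noteq> b j" if "j < k" for j using \<open>x \<notin> U\<close> aU that by auto
    then show ?thesis by (simp add: d_def)
  qed
  have cd: "continuous_on (punctured k) d"
  proof (rule continuous_on_coordinatewise_then_product)
    fix x
    have cn: "continuous_on (punctured k) n"
      unfolding n_def by (intro continuous_on_sum continuous_on_rabs continuous_on_coordinate)
    show "continuous_on (punctured k) (\<lambda>v. d v x)"
      unfolding d_def
      by (intro continuous_on_divide continuous_on_sum continuous_on_add continuous_on_mult continuous_on_const
            continuous_on_max continuous_on_minus continuous_on_coordinate cn)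
         (use n_pos in force)
  qed
  have dX: "d v \<in> ?X" if v: "v \<in> punctured k" for v
  proof -
    note np = n_pos[OF v]
    have pos: "0 \<le> d v x" for x
      unfolding d_def using np by (intro divide_nonneg_pos sum_nonneg add_nonneg_nonneg mult_nonneg_nonneg) auto
    have "sum (d v) U = (\<Sum>j<k. max (v j) 0 / n v + max (- v j) 0 / n v)"
      unfolding sumU by (intro sum.cong) (simp_all add: da db)
    also have "\<dots> = (\<Sum>j<k. \<bar>v j\<bar> / n v)"
      by (intro sum.cong refl) (simp add: max_def flip: add_divide_distrib)
    also have "\<dots> = n v / n v" by (simp only: n_def sum_divide_distrib)
    also have "\<dots> = 1" using np by simp
    finally have sum: "sum (d v) U = 1" .
    have "{x. d v x \<noteq> 0} \<subseteq> U" using d0 by blast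
    moreover have "\<forall>j<k. \<not> (a j \<in> {x. d v x \<noteq> 0} \<and> b j \<in> {x. d v x \<noteq> 0})"
      by (auto simp: da db max_def)
    ultimately have "{x. d v x \<noteq> 0} \<in> cross a b k" unfolding cross_def U_def by (intro CollectI conjI)
    then show ?thesis using pos sum by (simp add: points_def)
  qed
  have cc: "continuous_on A c" for A
    unfolding c_def
  proof (rule continuous_on_coordinatewise_then_product)
    show "continuous_on A (\<lambda>f. if j < k then f (a j) - f (b j) else 0)" for j
      by (cases "j < k") (simp_all add: continuous_on_diff continuous_on_coordinate)
  qed
  have one0: "f (a j) = 0 \<or> f (b j) = 0" "0 \<le> f (a j)" "0 \<le> f (b j)" if "f \<in> ?X" "j < k" for f j
    using that by (auto simp: points_def cross_def)
  have cX: "c f \<in> punctured k" if f: "f \<in> ?X" for f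
  proof (rule ccontr)
    assume "c f \<notin> punctured k"
    then have "f (a j) = f (b j)" if "j < k" for j using that by (auto simp: punctured_def c_def)
    then have "f (a j) + f (b j) = 0" if "j < k" for j using that one0[OF f that] by auto
    then have "sum f U = 0" unfolding sumU by simp
    then show False using f by (simp add: points_def)
  qed
  have dc: "d (c f) = f" if f: "f \<in> ?X" for f
  proof
    have "n (c f) = (\<Sum>j<k. f (a j) + f (b j))"
      unfolding n_def using one0[OF f] by (intro sum.cong refl) (force simp: c_def)
    also have "\<dots> = 1" using f unfolding sumU[symmetric] by (simp add: points_def)
    finally have n1: "n (c f) = 1" .
    have cj: "c f j = f (a j) - f (b j)" if "j < k" for j using that by (simp add: c_def)
    fix x
    show "d (c f) x = f x"
    proof (cases "x \<in> U")
      case True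
      then consider j where "j < k" "x = a j" | j where "j < k" "x = b j" by (auto simp: U_def)
      then show ?thesis
      proof cases
        case 1
        then show ?thesis using one0[OF f 1(1)] by (auto simp: da n1 cj)
      next
        case 2
        then show ?thesis using one0[OF f 2(1)] by (auto simp: db n1 cj)
      qed
    next
      case False
      then have "f x = 0" using f by (auto simp: points_def cross_def U_def)
      then show ?thesis using d0[OF False] by simp
    qed
  qed
  have mc: "continuous_map (top_of_set ?X) (top_of_set (punctured k)) c"
    unfolding continuous_map_subtopology_eu using cc cX by (intro conjI Pi_I)
  have md: "continuous_map (top_of_set (punctured k)) (top_of_set ?X) d"
    unfolding continuous_map_subtopology_eu using cd dX by (intro conjI Pi_I)
  have hom: "homotopic_with (\<lambda>_. True) (top_of_set ?X) (top_of_set ?X) (d \<circ> c) id"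
    by (rule homotopic_with_equal) (use dc continuous_map_compose[OF mc md] in auto)
  obtain r where kr: "k = Suc r" using k by (cases k) auto
  have "\<not> null_maps (top_of_set ?X) r"
  proof
    assume null: "null_maps (top_of_set ?X) r"
    have sub: "x \<in> punctured k" if "x \<in> nsph r" for x
    proof (rule ccontr)
      assume "x \<notin> punctured k"
      then have "\<forall>j\<le>r. x j = 0" using kr by (auto simp: punctured_def)
      then show False using that by (simp add: nsph_def)
    qed
    have "continuous_map (nsphere r) (top_of_set ?X) d"
      unfolding nsphere_eq continuous_map_subtopology_eu
      using continuous_on_subset[OF cd] sub dX by (intro conjI Pi_I) blast+
    then obtain q where "homotopic_with (\<lambda>_. True) (nsphere r) (top_of_set ?X) d (\<lambda>_. q)"
      using null unfolding null_maps_def by blast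
    \<comment> \<open>Radial projection to the unit sphere. As c \<circ> d only rescales a vector of
      the sphere, \<rho> \<circ> c \<circ> d is the identity there.\<close>
    moreover define \<rho> where "\<rho> = (\<lambda>v :: nat \<Rightarrow> real. \<lambda>j. of_bool (j \<le> r) * v j / sqrt (\<Sum>j\<le>r. (v j)\<^sup>2))"
    have sq: "0 < (\<Sum>j\<le>r. (v j)\<^sup>2)" if v: "v \<in> punctured k" for v
    proof -
      obtain j where "j < k" "v j \<noteq> 0" using v by (auto simp: punctured_def)
      then show ?thesis using kr by (intro sum_pos2[of _ j]) auto
    qed
    have "continuous_map (top_of_set (punctured k)) (nsphere r) \<rho>"
      unfolding nsphere_eq continuous_map_subtopology_eu
    proof (intro conjI Pi_I)
      show "continuous_on (punctured k) \<rho>"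
        unfolding \<rho>_def
        by (intro continuous_on_coordinatewise_then_product continuous_on_divide continuous_on_mult continuous_on_const
              continuous_on_coordinate continuous_on_real_sqrt continuous_on_sum continuous_on_power)
           (use sq in force)
      fix v assume v: "v \<in> punctured k"
      have "(\<Sum>j\<le>r. (\<rho> v j)\<^sup>2) = (\<Sum>j\<le>r. (v j)\<^sup>2 / (\<Sum>j\<le>r. (v j)\<^sup>2))"
        using sq[OF v] by (intro sum.cong refl) (simp add: \<rho>_def power_divide)
      also have "\<dots> = (\<Sum>j\<le>r. (v j)\<^sup>2) / (\<Sum>j\<le>r. (v j)\<^sup>2)" by (simp only: sum_divide_distrib)
      also have "\<dots> = 1" using sq[OF v] by simp
      finally show "\<rho> v \<in> nsph r" by (simp add: nsph_def \<rho>_def)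
    qed
    then have "continuous_map (top_of_set ?X) (nsphere r) (\<rho> \<circ> c)"
      using mc continuous_map_compose by blast
    ultimately have h: "homotopic_with (\<lambda>_. True) (nsphere r) (nsphere r) ((\<rho> \<circ> c) \<circ> d) ((\<rho> \<circ> c) \<circ> (\<lambda>_. q))"
      by (intro homotopic_with_compose_continuous_map_left) simp_all
    have "\<rho> (c (d x)) = x" if x: "x \<in> nsph r" for x
    proof
      fix j
      note np = n_pos[OF sub[OF x]]
      have cdx: "c (d x) i = x i / n x" if "i \<le> r" for i
        using that kr by (simp add: c_def da db max_def flip: diff_divide_distrib)
      have "(\<Sum>i\<le>r. (c (d x) i)\<^sup>2) = (\<Sum>i\<le>r. (x i)\<^sup>2 / (n x)\<^sup>2)"
        by (intro sum.cong refl) (simp add: cdx power_divide)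
      also have "\<dots> = (\<Sum>i\<le>r. (x i)\<^sup>2) / (n x)\<^sup>2" by (simp only: sum_divide_distrib)
      also have "\<dots> = (1 / n x)\<^sup>2" using x by (simp add: nsph_def power_divide)
      finally have "sqrt (\<Sum>i\<le>r. (c (d x) i)\<^sup>2) = 1 / n x" using np by (simp add: real_sqrt_abs)
      then have "\<rho> (c (d x)) j = of_bool (j \<le> r) * c (d x) j * n x" by (simp add: \<rho>_def)
      then show "\<rho> (c (d x)) j = x j" using np x cdx[of j] by (cases "j \<le> r") (auto simp: nsph_def)
    qed
    then have "homotopic_with (\<lambda>_. True) (nsphere r) (nsphere r) id ((\<rho> \<circ> c) \<circ> (\<lambda>_. q))"
      by (intro homotopic_with_eq[OF h]) (auto simp: nsphere_eq)
    then have "contractible_space (nsphere r)" unfolding contractible_space_def by (auto simp: comp_def)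
    then show False using non_contractible_space_nsphere by blast
  qed
  moreover have "null_maps (top_of_set ?X) i" if "i < r" for i
    using null_maps_retract[OF null_maps_punctured mc md hom] that kr by simp
  moreover have "topspace (top_of_set ?X) \<noteq> {}"
  proof -
    have "(\<lambda>_. 1) \<in> punctured k" using k by (auto simp: punctured_def intro!: exI[of _ 0])
    then show ?thesis using dX by auto
  qed
  ultimately have "conn (top_of_set ?X) = ereal (real r - 1)" by (intro conn_eqI)
  then show ?thesis using kr unfolding real by simp
qed

section \<open>Checking collapses by computation\<close>

definition gen :: "nat list list \<Rightarrow> nat set set" where
  "gen L = {S. \<exists>G\<in>set L. S \<subseteq> set G}"

text \<open>In the checker a vertex set is its characteristic list.\<close>

fun fs :: "nat \<Rightarrow> bool list \<Rightarrow> nat set" where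
  "fs n [] = {}"
| "fs n (True # bs) = insert n (fs (Suc n) bs)"
| "fs n (False # bs) = fs (Suc n) bs"

fun subl :: "bool list \<Rightarrow> bool list \<Rightarrow> bool" where
  "subl [] ys = True"
| "subl (True # xs) [] = False"
| "subl (False # xs) [] = subl xs []"
| "subl (True # xs) (False # ys) = False"
| "subl (True # xs) (True # ys) = subl xs ys"
| "subl (False # xs) (y # ys) = subl xs ys"

fun has :: "bool list \<Rightarrow> nat \<Rightarrow> bool" where
  "has [] n = False"
| "has (b # bs) 0 = b"
| "has (b # bs) (Suc n) = has bs n"

text \<open>For s inside G these are the sets G minus one element of s, the maximal subsets of G
  that do not contain s.\<close>

fun dels :: "bool list \<Rightarrow> bool list \<Rightarrow> bool list list" where
  "dels (True # s) (g # G) = (False # G) # map (Cons g) (dels s G)"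
| "dels (False # s) (g # G) = map (Cons g) (dels s G)"
| "dels s G = []"

lemma fs_ge: "x \<in> fs n xs \<Longrightarrow> n \<le> x"
proof (induction n xs rule: fs.induct)
  case (2 n bs)
  then show ?case by (metis Suc_leD fs.simps(2) insert_iff order_refl)
next
  case (3 n bs)
  then show ?case by (metis Suc_leD fs.simps(3))
qed simp

lemma notin_fs_Suc: "n \<notin> fs (Suc n) xs"
  using fs_ge[of n "Suc n" xs] by auto

lemma subl_iff: "subl xs ys \<longleftrightarrow> fs n xs \<subseteq> fs n ys"
proof (induction xs ys arbitrary: n rule: subl.induct)
  case (5 xs ys)
  have "insert n A \<subseteq> insert n B \<longleftrightarrow> A \<subseteq> B" if "n \<notin> A" for A B :: "nat set" using that by auto
  then show ?case using 5 notin_fs_Suc by simp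
next
  case (6 xs y ys)
  have "A \<subseteq> insert n B \<longleftrightarrow> A \<subseteq> B" if "n \<notin> A" for A B :: "nat set" using that by auto
  then show ?case using 6 notin_fs_Suc by (cases y) simp_all
qed (use notin_fs_Suc in auto)

lemma has_iff: "has xs i \<longleftrightarrow> n + i \<in> fs n xs"
proof (induction xs i arbitrary: n rule: has.induct)
  case (2 b bs)
  then show ?case using notin_fs_Suc by (cases b) simp_all
next
  case (3 b bs i)
  then show ?case using 3[of "Suc n"] by (cases b) simp_all
qed simp

lemma dels_iff:
  "fs n s \<subseteq> fs n G \<Longrightarrow> (\<exists>H\<in>set (dels s G). S \<subseteq> fs n H) \<longleftrightarrow> S \<subseteq> fs n G \<and> \<not> fs n s \<subseteq> S"
proof (induction s G arbitrary: n S rule: dels.induct)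
  case (1 s g G)
  have g: "g" using 1(2) notin_fs_Suc by (cases g) auto
  have sub: "fs (Suc n) s \<subseteq> fs (Suc n) G" using 1(2) g notin_fs_Suc by auto
  have ih: "(\<exists>H\<in>set (dels s G). S - {n} \<subseteq> fs (Suc n) H) \<longleftrightarrow> S - {n} \<subseteq> fs (Suc n) G \<and> \<not> fs (Suc n) s \<subseteq> S - {n}"
    by (rule 1(1)[OF sub])
  have "(\<exists>H\<in>set (dels (True # s) (g # G)). S \<subseteq> fs n H) \<longleftrightarrow>
      S \<subseteq> fs (Suc n) G \<or> (\<exists>H\<in>set (dels s G). S \<subseteq> insert n (fs (Suc n) H))"
    using g by simp
  also have "\<dots> \<longleftrightarrow> S \<subseteq> fs (Suc n) G \<or> (\<exists>H\<in>set (dels s G). S - {n} \<subseteq> fs (Suc n) H)"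
    by (simp add: subset_insert_iff Diff_insert0 cong: bex_cong) (metis Diff_empty Diff_insert0 Diff_subset subset_trans)
  also have "\<dots> \<longleftrightarrow> S \<subseteq> insert n (fs (Suc n) G) \<and> \<not> insert n (fs (Suc n) s) \<subseteq> S"
    unfolding ih using notin_fs_Suc[of n s] notin_fs_Suc[of n G] by auto
  finally show ?case using g by simp
next
  case (2 s g G)
  have sub: "fs (Suc n) s \<subseteq> fs (Suc n) G" using 2(2) notin_fs_Suc[of n s] by (cases g) auto
  show ?case
  proof (cases g)
    case True
    have ih: "(\<exists>H\<in>set (dels s G). S - {n} \<subseteq> fs (Suc n) H) \<longleftrightarrow> S - {n} \<subseteq> fs (Suc n) G \<and> \<not> fs (Suc n) s \<subseteq> S - {n}"
      by (rule 2(1)[OF sub])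
    have "S \<subseteq> insert n A \<longleftrightarrow> S - {n} \<subseteq> A" for A by auto
    then show ?thesis using True ih notin_fs_Suc[of n s] by auto
  next
    case False
    then show ?thesis using 2(1)[OF sub] by simp
  qed
qed simp_all

definition bits :: "nat list \<Rightarrow> bool list" where
  "bits xs = map (\<lambda>i. list_ex ((=) i) xs) [0, 1, 2, 3, 4, 5, 6, 7, 8, 9, 10, 11, 12]"

lemma fs_bits: "fs 0 (bits xs) = set xs \<inter> {..12}"
proof -
  have "x \<in> fs 0 (bits xs) \<longleftrightarrow> x \<in> set xs \<and> x \<le> 12" for x
  proof -
    have "x \<in> fs 0 (bits xs) \<longleftrightarrow> has (bits xs) x" using has_iff[of _ x 0] by simp
    also have "\<dots> \<longleftrightarrow> x \<in> set xs \<and> x \<le> 12"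
    proof (cases "x \<le> 12")
      case True
      then have "x \<in> {0, 1, 2, 3, 4, 5, 6, 7, 8, 9, 10, 11, 12}" by (simp, arith)
      then show ?thesis using True by (auto simp: bits_def list_ex_iff numeral_eq_Suc)
    next
      case False
      then obtain y where "x = Suc (Suc (Suc (Suc (Suc (Suc (Suc (Suc (Suc (Suc (Suc (Suc (Suc y))))))))))))"
        using le_Suc_ex[of 13 x] by (auto simp: numeral_eq_Suc)
      then show ?thesis using False by (simp add: bits_def)
    qed
    finally show ?thesis .
  qed
  then show ?thesis by auto
qed

datatype move = Collapse "nat list" nat | Expand "nat list" "nat list"

definition genb :: "bool list list \<Rightarrow> nat set set" where
  "genb L = {S. \<exists>G\<in>set L. S \<subseteq> fs 0 G}"

lemma genb_mono: "S \<in> genb L \<Longrightarrow> T \<subseteq> S \<Longrightarrow> T \<in> genb L"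
  unfolding genb_def by blast

lemma genb_bits: "(\<And>G. G \<in> set L \<Longrightarrow> set G \<subseteq> {..12}) \<Longrightarrow> genb (map bits L) = gen L"
  unfolding genb_def gen_def by (auto simp: fs_bits)

definition covered :: "bool list list \<Rightarrow> bool list \<Rightarrow> bool" where
  "covered L H \<longleftrightarrow> list_ex (subl H) L"

lemma covered_iff: "covered L H \<longleftrightarrow> fs 0 H \<in> genb L"
  by (simp add: covered_def list_ex_iff genb_def subl_iff[of _ _ 0])

text \<open>A is meant for the facets containing s and B for the others. The test on A says that w
  can be added to every face containing s.\<close>

definition collapse_in :: "bool list \<Rightarrow> nat \<Rightarrow> bool list list \<Rightarrow> bool list list \<Rightarrow> bool list list option" where
  "collapse_in s w A B = (if list_all (\<lambda>G. has G w) A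
     then Some (filter (\<lambda>H. \<not> covered B H) (concat (map (dels s) A)) @ B) else None)"

text \<open>The simplices of a fixed subcomplex P must survive.\<close>

fun step :: "bool list list \<Rightarrow> move \<Rightarrow> bool list list \<Rightarrow> bool list list option" where
  "step P (Collapse s w) L = (if w \<le> 12 \<and> \<not> has (bits s) w \<and> \<not> covered P (bits s)
     then collapse_in (bits s) w (filter (subl (bits s)) L) (filter (\<lambda>G. \<not> subl (bits s) G) L) else None)"
| "step P (Expand s g) L = (if subl (bits s) (bits g) \<and> \<not> subl (bits g) (bits s) \<and> \<not> covered P (bits s)
       \<and> \<not> covered L (bits s) \<and> list_all (covered L) (dels (bits s) (bits g))
     then Some (bits g # filter (\<lambda>G. \<not> subl G (bits g)) L) else None)"

fun run :: "bool list list \<Rightarrow> move list \<Rightarrow> bool list list \<Rightarrow> bool list list option" where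
  "run P [] L = Some L"
| "run P (m # ms) L = (case step P m L of None \<Rightarrow> None | Some L' \<Rightarrow> run P ms L')"

text \<open>Generator lists may differ in order and redundancy, so equality of the complexes is
  tested by covering in both directions.\<close>

definition run_to :: "bool list list \<Rightarrow> move list \<Rightarrow> bool list list \<Rightarrow> bool list list \<Rightarrow> bool" where
  "run_to P ms L M = (case run P ms L of None \<Rightarrow> False
     | Some L' \<Rightarrow> list_all (covered M) L' \<and> list_all (covered L') M)"

text \<open>The removed simplices form the open star of s, which is closed under adding w. For P
  closed under subsets, s outside P protects all of P.\<close>

definition collapses :: "nat set set \<Rightarrow> nat set set \<Rightarrow> nat set set \<Rightarrow> bool" where
  "collapses P K K' \<longleftrightarrow> (\<exists>s w. s \<subseteq> {..12} \<and> w \<in> {..12} - s \<and> s \<notin> P \<and>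
     (\<forall>S\<in>K. s \<subseteq> S \<longrightarrow> insert w S \<in> K) \<and> K' = {S \<in> K. \<not> s \<subseteq> S})"

text \<open>An expansion is a collapse read backwards: s is new and the faces of g not containing s
  are present, so removing the star of s restores the old complex. Any vertex of g outside s serves
  as apex.\<close>

lemma step_sound:
  assumes "step (P :: bool list list) m L = Some L'"
  shows "collapses (genb P) (genb L) (genb L') \<or> collapses (genb P) (genb L') (genb L)"
proof (cases m)
  case (Collapse s w)
  let ?s = "fs 0 (bits s)"
  define A where "A = filter (subl (bits s)) L"
  define B where "B = filter (\<lambda>G. \<not> subl (bits s) G) L"
  have c: "w \<le> 12" "\<not> has (bits s) w" "\<not> covered P (bits s)" "collapse_in (bits s) w A B = Some L'"
    using assms unfolding Collapse step.simps A_def B_def by (auto split: if_splits)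
  then have w: "\<And>G. G \<in> set A \<Longrightarrow> has G w"
    and L': "L' = filter (\<lambda>H. \<not> covered B H) (concat (map (dels (bits s)) A)) @ B"
    unfolding collapse_in_def by (auto simp: list_all_iff split: if_splits)
  have mA: "G \<in> set A \<longleftrightarrow> G \<in> set L \<and> ?s \<subseteq> fs 0 G" for G by (auto simp: A_def subl_iff[of _ _ 0])
  have mB: "G \<in> set B \<longleftrightarrow> G \<in> set L \<and> \<not> ?s \<subseteq> fs 0 G" for G by (auto simp: B_def subl_iff[of _ _ 0])
  have AB: "S \<in> genb L \<longleftrightarrow> (\<exists>G\<in>set A. S \<subseteq> fs 0 G) \<or> S \<in> genb B" for S
    unfolding genb_def using mA mB by blast
  have "S \<in> genb L' \<longleftrightarrow> (\<exists>G\<in>set A. \<exists>H\<in>set (dels (bits s) G). S \<subseteq> fs 0 H) \<or> S \<in> genb B" for S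
  proof -
    have cov: "S \<in> genb B" if "covered B H" "S \<subseteq> fs 0 H" for H
      using that unfolding covered_iff genb_def by blast
    have mL: "H \<in> set L' \<longleftrightarrow> \<not> covered B H \<and> (\<exists>G\<in>set A. H \<in> set (dels (bits s) G)) \<or> H \<in> set B" for H
      unfolding L' by auto
    have "S \<in> genb L' \<longleftrightarrow> (\<exists>H. H \<in> set L' \<and> S \<subseteq> fs 0 H)" "S \<in> genb B \<longleftrightarrow> (\<exists>H\<in>set B. S \<subseteq> fs 0 H)"
      unfolding genb_def by blast+
    then show ?thesis unfolding mL using cov by blast
  qed
  also have "\<dots> S \<longleftrightarrow> (\<exists>G\<in>set A. S \<subseteq> fs 0 G \<and> \<not> ?s \<subseteq> S) \<or> S \<in> genb B" for S
  proof -
    have "(\<exists>G\<in>set A. \<exists>H\<in>set (dels (bits s) G). S \<subseteq> fs 0 H) \<longleftrightarrow> (\<exists>G\<in>set A. S \<subseteq> fs 0 G \<and> \<not> ?s \<subseteq> S)"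
      by (rule bex_cong[OF refl], rule dels_iff) (simp add: mA)
    then show ?thesis by simp
  qed
  also have "\<dots> S \<longleftrightarrow> S \<in> genb L \<and> \<not> ?s \<subseteq> S" for S
  proof -
    have "\<not> ?s \<subseteq> S" if "S \<in> genb B" using that mB unfolding genb_def by blast
    then show ?thesis using AB by blast
  qed
  finally have eq: "genb L' = {S \<in> genb L. \<not> ?s \<subseteq> S}" by blast
  have star: "insert w S \<in> genb L" if S: "S \<in> genb L" "?s \<subseteq> S" for S
  proof -
    obtain G where G: "G \<in> set L" "S \<subseteq> fs 0 G" using S(1) unfolding genb_def by blast
    then have "G \<in> set A" using mA S(2) by blast
    then have "w \<in> fs 0 G" using w has_iff[of G w 0] by simp
    then show ?thesis using G unfolding genb_def by blast
  qed
  have adm: "?s \<subseteq> {..12}" "w \<in> {..12} - ?s" "?s \<notin> genb P"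
    using c has_iff[of "bits s" w 0] by (auto simp: fs_bits covered_iff)
  show ?thesis unfolding collapses_def
    by (intro disjI1 exI[of _ ?s] exI[of _ w] conjI ballI impI adm eq star)
next
  case (Expand s g)
  let ?s = "fs 0 (bits s)" and ?g = "fs 0 (bits g)"
  have c: "?s \<subseteq> ?g" "\<not> ?g \<subseteq> ?s" "?s \<notin> genb P" "?s \<notin> genb L"
    "\<And>H. H \<in> set (dels (bits s) (bits g)) \<Longrightarrow> fs 0 H \<in> genb L"
    "L' = bits g # filter (\<lambda>G. \<not> subl G (bits g)) L"
    using assms unfolding Expand by (auto simp: covered_iff list_all_iff subl_iff[of _ _ 0] split: if_splits)
  note down = genb_mono
  have L': "S \<in> genb L' \<longleftrightarrow> S \<subseteq> ?g \<or> S \<in> genb L" for S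
    unfolding c(6) genb_def by (auto simp: subl_iff[of _ _ 0])
  have s: "S \<in> genb L \<Longrightarrow> \<not> ?s \<subseteq> S" for S using down c(4) by blast
  have inn: "S \<in> genb L" if S: "S \<subseteq> ?g" "\<not> ?s \<subseteq> S" for S
  proof -
    have "\<exists>H\<in>set (dels (bits s) (bits g)). S \<subseteq> fs 0 H" using dels_iff[OF c(1), of S] S by simp
    then obtain H where H: "H \<in> set (dels (bits s) (bits g))" "S \<subseteq> fs 0 H" by blast
    show ?thesis by (rule down[OF c(5)[OF H(1)] H(2)])
  qed
  have eq: "genb L = {S \<in> genb L'. \<not> ?s \<subseteq> S}"
  proof (rule Set.set_eqI)
    fix S show "S \<in> genb L \<longleftrightarrow> S \<in> {S \<in> genb L'. \<not> ?s \<subseteq> S}"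
      unfolding mem_Collect_eq L' using s[of S] inn[of S] by blast
  qed
  obtain w where w: "w \<in> ?g" "w \<notin> ?s" using c(2) by blast
  have star: "insert w S \<in> genb L'" if "S \<in> genb L'" "?s \<subseteq> S" for S
  proof -
    have "S \<subseteq> ?g" using that(1) s[of S] that(2) unfolding L' by blast
    then show ?thesis unfolding L' using w(1) by blast
  qed
  have adm: "?s \<subseteq> {..12}" "w \<in> {..12} - ?s" using w by (auto simp: fs_bits)
  show ?thesis unfolding collapses_def
    by (intro disjI2 exI[of _ ?s] exI[of _ w] conjI ballI impI adm c(3) eq star)
qed

lemma run_invariant:
  assumes "run P ms L = Some L'"
    and step: "\<And>L L'. collapses (genb P) (genb L) (genb L') \<Longrightarrow> Q (genb L) \<longleftrightarrow> Q (genb L')"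
  shows "Q (genb L) \<longleftrightarrow> Q (genb L')"
  using assms(1)
proof (induction ms arbitrary: L)
  case (Cons m ms)
  then obtain L1 where "step P m L = Some L1" "run P ms L1 = Some L'" by (auto split: option.splits)
  then show ?case using step_sound step Cons.IH by blast
qed simp

lemma run_to_invariant:
  assumes r: "run_to P ms L M"
    and step: "\<And>L L'. collapses (genb P) (genb L) (genb L') \<Longrightarrow> Q (genb L) \<longleftrightarrow> Q (genb L')"
  shows "Q (genb L) \<longleftrightarrow> Q (genb M)"
proof -
  obtain L' where L': "run P ms L = Some L'" "list_all (covered M) L'" "list_all (covered L') M"
    using r unfolding run_to_def by (auto split: option.splits)
  have "genb M = genb L'"
  proof (rule Set.set_eqI)
    fix S
    have 1: "\<forall>H\<in>set L'. fs 0 H \<in> genb M" "\<forall>H\<in>set M. fs 0 H \<in> genb L'"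
      using L'(2,3) by (simp_all add: list_all_iff covered_iff)
    show "S \<in> genb M \<longleftrightarrow> S \<in> genb L'"
    proof
      assume "S \<in> genb M"
      then obtain H where "H \<in> set M" "S \<subseteq> fs 0 H" unfolding genb_def by blast
      then show "S \<in> genb L'" using genb_mono bspec[OF 1(2)] by blast
    next
      assume "S \<in> genb L'"
      then obtain H where "H \<in> set L'" "S \<subseteq> fs 0 H" unfolding genb_def by blast
      then show "S \<in> genb M" using genb_mono bspec[OF 1(1)] by blast
    qed
  qed
  then show ?thesis using run_invariant[of P ms L L' Q, OF L'(1) step] by simp
qed

section \<open>The suspension of an acyclic complex\<close>

text \<open>The triangles of an acyclic complex with nontrivial fundamental group: the seven-vertex
  torus without the triangle 0, 1, 3, together with three discs, which are cones with apex 7, 8, 9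
  over the path 2, 1, 0, 3, 6 and the closed walks 2, 3, 1, 0, 6, 7 and 2, 4, 0, 3, 1, 6, 7.\<close>

definition acyclic_facets :: "nat list list" where
  "acyclic_facets = [
    [1,2,4], [2,3,5], [3,4,6], [0,4,5], [1,5,6], [0,2,6], [0,2,3], [1,3,4], [2,4,5], [3,5,6],
    [0,4,6], [0,1,5], [1,2,6], [1,2,7], [0,1,7], [0,3,7], [3,6,7], [2,3,8], [1,3,8], [0,1,8],
    [0,6,8], [6,7,8], [2,7,8], [2,4,9], [0,4,9], [0,3,9], [1,3,9], [1,6,9], [6,7,9], [2,7,9]]"

definition suspension_facets :: "nat list list" where
  "suspension_facets = map (Cons 10) acyclic_facets @ map (Cons 11) acyclic_facets"

text \<open>A complex that collapses to the suspension of the acyclic complex: each of the suspension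
  points 10 and 11 is also joined with one of two solid tori bounded by the seven-vertex torus, and
  a further vertex 12 with both.\<close>

definition thick_facets :: "nat list list" where
  "thick_facets = [
    [1,2,7,10], [1,2,7,11], [0,1,7,10], [0,1,7,11], [0,3,7,10], [0,3,7,11], [3,6,7,10], [3,6,7,11],
    [2,3,8,10], [2,3,8,11], [1,3,8,10], [1,3,8,11], [0,1,8,10], [0,1,8,11], [0,6,8,10], [0,6,8,11],
    [6,7,8,10], [6,7,8,11], [2,7,8,10], [2,7,8,11], [2,4,9,10], [2,4,9,11], [0,4,9,10], [0,4,9,11],
    [0,3,9,10], [0,3,9,11], [1,3,9,10], [1,3,9,11], [1,6,9,10], [1,6,9,11], [6,7,9,10], [6,7,9,11],
    [2,7,9,10], [2,7,9,11], [0,1,2,3,10], [1,2,3,4,10], [2,3,4,5,10], [3,4,5,6,10], [0,4,5,6,10],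
    [0,1,5,6,10], [0,1,2,6,10], [0,1,3,4,11], [1,2,4,5,11], [2,3,5,6,11], [0,3,4,6,11],
    [0,1,4,5,11], [1,2,5,6,11], [0,2,3,6,11], [0,1,2,3,12], [1,2,3,4,12], [2,3,4,5,12],
    [3,4,5,6,12], [0,4,5,6,12], [0,1,5,6,12], [0,1,2,6,12], [0,1,3,4,12], [1,2,4,5,12],
    [2,3,5,6,12], [0,3,4,6,12], [0,1,4,5,12], [1,2,5,6,12], [0,2,3,6,12]]"

text \<open>The suspension of the wedge point 2. It serves both as the protected subcomplex and,
  being contractible, as the target of the moves.\<close>

definition path_facets :: "nat list list" where
  "path_facets = [[2, 10], [2, 11]]"

text \<open>Only collapses occur: they remove the solid tori and the vertex 12 again.\<close>

definition moves_to_suspension :: "move list" where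
  "moves_to_suspension = [
    Collapse [0,1,3,11] 4, Collapse [0,1,3,4] 12, Collapse [0,3,4] 6, Collapse [0,1,3] 2,
    Collapse [4,6,12] 5, Collapse [3,12] 2, Collapse [12] 1, Collapse [4,5,6] 10,
    Collapse [2,3,4] 10, Collapse [0,1,6] 10, Collapse [2,3,6] 11, Collapse [1,4,5] 11,
    Collapse [2,5,6] 1, Collapse [0,1,4] 11, Collapse [0,1,2] 10, Collapse [0,3,6] 11,
    Collapse [3,4,5] 10, Collapse [0,5,6] 10, Collapse [1,2,3] 10, Collapse [1,2,5] 11]"

text \<open>An expansion by a simplex followed by a collapse at another of its faces pushes part of
  the complex across that simplex. Such exchanges alternate with collapses;
  \<open>[0,1,3,7,10]\<close> alone is expanded five times.\<close>

definition moves_to_path :: "move list" where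
  "moves_to_path = [
    Collapse [3,5,10] 4, Collapse [3,4,5] 12, Collapse [3,5] 2, Collapse [5,11] 1,
    Collapse [5,6,10] 0, Collapse [5,6] 12, Collapse [6,12] 0, Collapse [12] 1,
    Collapse [0,1,2] 10, Collapse [0,3,4] 11, Collapse [2,5] 4, Collapse [5] 0,
    Collapse [1,4,10] 2, Collapse [2,3,6] 0, Collapse [0,1,4] 11, Collapse [0,1,6] 10,
    Collapse [0,3,6] 11, Expand [1,4,10] [1,2,3,4,10], Collapse [2,3,4] 1, Collapse [1,2,3] 10,
    Expand [1,3,7] [0,1,3,7,11], Collapse [0,1,3,11] 7, Expand [0,1,3,11] [0,1,3,7,11],
    Collapse [1,3,7] 0, Expand [1,3,7] [0,1,3,7,10], Collapse [0,1,3,10] 7,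
    Expand [0,3,8] [0,1,3,8,11], Collapse [1,8,11] 0, Expand [0,1,9] [0,1,3,9,11],
    Collapse [3,9,11] 0, Expand [0,1,3,10] [0,1,3,7,10], Collapse [0,7,10] 1,
    Expand [0,1,9,10] [0,1,3,9,10], Collapse [3,9] 0, Expand [0,7,10] [0,1,3,7,10],
    Collapse [0,1,3,10] 7, Expand [0,1,3,10] [0,1,3,7,10], Collapse [1,3,7] 0,
    Expand [0,3,8,10] [0,1,3,8,10], Collapse [1,8] 0, Expand [1,3,7] [0,1,3,7,11],
    Collapse [0,7,11] 1, Expand [0,2,8] [0,2,3,8,10], Collapse [2,3,10] 0, Collapse [3,8,10] 0,
    Expand [3,9] [0,1,3,9,11], Collapse [0,1,11] 3, Expand [1,3,7,10] [0,1,3,7,10],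
    Collapse [0,7] 1, Collapse [0,3,10] 1, Collapse [0,1] 9, Collapse [3,9] 11, Collapse [0,9] 4,
    Collapse [4,9] 2, Collapse [2,9] 7, Collapse [9] 6, Collapse [0,4] 6, Collapse [1,6] 2,
    Collapse [2,6] 0, Collapse [4,6] 3, Collapse [4] 1, Collapse [1] 7, Collapse [2,7] 8,
    Collapse [7] 6, Collapse [0,6] 8, Collapse [0,11] 3, Collapse [0] 2, Collapse [3,8] 2,
    Collapse [2,3] 11, Collapse [3] 6, Collapse [6] 8, Collapse [8] 2]"

lemma run_to_suspension:
  "run_to (map bits path_facets) moves_to_suspension (map bits thick_facets) (map bits suspension_facets)"
  by code_simp

lemma run_to_path:
  "run_to (map bits path_facets) moves_to_path (map bits thick_facets) (map bits path_facets)"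
  by code_simp

text \<open>Both runs start at the thick complex, which links their ends. Q is left general because
  it will speak about a larger complex in which K is only a part.\<close>

lemma suspension_iff_path:
  assumes "\<And>K K'. (\<And>S T. S \<in> K \<Longrightarrow> T \<subseteq> S \<Longrightarrow> T \<in> K) \<Longrightarrow> collapses (gen path_facets) K K' \<Longrightarrow> Q K \<longleftrightarrow> Q K'"
  shows "Q (gen suspension_facets) \<longleftrightarrow> Q (gen path_facets)"
proof -
  have P: "genb (map bits path_facets) = gen path_facets"
    by (rule genb_bits) (auto simp: path_facets_def)
  have S: "genb (map bits suspension_facets) = gen suspension_facets"
    by (rule genb_bits) (auto simp: suspension_facets_def acyclic_facets_def)
  have "Q (genb L) \<longleftrightarrow> Q (genb L')" if "collapses (genb (map bits path_facets)) (genb L) (genb L')" for L L'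
  proof (rule assms)
    show "T \<in> genb L" if "S \<in> genb L" "T \<subseteq> S" for S T using that by (rule genb_mono)
    show "collapses (gen path_facets) (genb L) (genb L')" using that P by simp
  qed
  then have "Q (genb (map bits thick_facets)) = Q (genb (map bits suspension_facets))"
    "Q (genb (map bits thick_facets)) = Q (genb (map bits path_facets))"
    using run_to_invariant[of _ _ _ _ Q, OF run_to_suspension] run_to_invariant[of _ _ _ _ Q, OF run_to_path]
    by blast+
  then show ?thesis unfolding P S by blast
qed

section \<open>A covering of the acyclic complex\<close>

text \<open>The identity and twelve 5-cycles, in six inverse pairs; a permutation is the list of its
  values.\<close>

definition perms :: "nat list list" where
  "perms = [
    [0,1,2,3,4], [1,2,3,4,0], [1,3,0,4,2], [1,4,3,0,2], [2,0,4,1,3], [2,4,1,0,3], [2,4,3,1,0],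
    [3,0,4,2,1], [3,2,0,4,1], [3,2,4,1,0], [4,0,1,2,3], [4,3,0,2,1], [4,3,1,0,2]]"

text \<open>Entry v of row u is the position in the list of permutations of the transport from u to v.\<close>

definition transport_table :: "nat list list" where
  "transport_table = [
    [0,0,0,0,0,0,0,0,0,0], [0,0,1,4,12,0,1,0,0,4], [0,10,0,0,6,6,0,10,2,6], [0,2,0,0,7,6,7,0,2,0],
    [0,9,11,3,0,0,0,0,0,0], [0,0,11,11,0,0,1,0,0,0], [0,10,0,3,0,10,0,3,0,8],
    [0,0,1,0,0,0,7,0,7,12], [0,0,4,4,0,0,0,3,0,0], [0,2,11,0,0,0,5,9,0,0]]"

text \<open>The vertex 0 is joined to all others with identity transports, so the transport along an
  edge from u to v is the monodromy of the walk 0, u, v, 0. Pairs that are not edges have the filler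
  entry 0.\<close>

definition transport :: "nat \<Rightarrow> nat \<Rightarrow> nat list" where
  "transport u v = perms ! (transport_table ! u ! v)"

text \<open>The identity outside A makes the covering trivial over the sphere.\<close>

definition acyclic_transport :: "nat \<Rightarrow> nat \<Rightarrow> nat \<Rightarrow> nat" where
  "acyclic_transport u v q = (if u \<le> 9 \<and> v \<le> 9 then transport u v ! q else q)"

text \<open>Mapping \<open>nth p\<close> over a list composes it with p, so this is the composition
  rule on every facet, repeated vertices included.\<close>

lemma transport_check:
  "list_all (\<lambda>G. list_all (\<lambda>u. list_all (\<lambda>v. list_all (\<lambda>w.
     map (nth (transport v w)) (transport u v) = transport u w) G) G \<and> transport u u = [0, 1, 2, 3, 4]) G)
     acyclic_facets"
  by code_simp

lemma perms_check: "list_all (\<lambda>p. length p = 5 \<and> list_all (\<lambda>x. x < 5) p) perms"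
  by code_simp

lemma table_check: "length transport_table = 10 \<and>
    list_all (\<lambda>r. length r = 10 \<and> list_all (\<lambda>x. x < length perms) r) transport_table"
  by code_simp

section \<open>The hypergraphs\<close>

lemma hypergraph_add_disjoint_edges:
  fixes e :: "nat \<Rightarrow> 'a set"
  assumes "hypergraph V C" "\<And>i. i < n \<Longrightarrow> card (e i) = 2" "\<And>i. i < n \<Longrightarrow> e i \<inter> V = {}"
    and "\<And>i j. i < j \<Longrightarrow> j < n \<Longrightarrow> e i \<inter> e j = {}"
  shows "hypergraph (V \<union> (\<Union>i<n. e i)) (C \<union> e ` {..<n}) \<and>
    psi (V \<union> (\<Union>i<n. e i)) (C \<union> e ` {..<n}) = psi V C + enat n"
  using assms(2-4)
proof (induction n)
  case 0
  then show ?case using assms(1) by (simp add: zero_enat_def[symmetric])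
next
  case (Suc n)
  let ?V = "V \<union> (\<Union>i<n. e i)" and ?C = "C \<union> e ` {..<n}"
  have ih: "hypergraph ?V ?C" "psi ?V ?C = psi V C + enat n"
    using Suc.IH Suc.prems by simp_all
  have "e n \<inter> e i = {}" if "i < n" for i using Suc.prems(3)[of i n] that by auto
  then have d: "e n \<inter> ?V = {}" "card (e n) = 2" using Suc.prems(1,2)[of n] by auto
  have eq: "V \<union> (\<Union>i<Suc n. e i) = ?V \<union> e n" "C \<union> e ` {..<Suc n} = insert (e n) ?C"
    by (auto simp: lessThan_Suc)
  have "psi V C + enat n + 1 = psi V C + enat (Suc n)"
    by (simp add: one_enat_def add.assoc)
  then show ?case
    unfolding eq using hypergraph_insert_disjoint[OF ih(1) d] psi_insert_disjoint_edge[OF ih(1) d] ih(2) by simp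
qed

lemma Ind_add_disjoint_edges:
  assumes "hypergraph V C" "\<And>i. i < n \<Longrightarrow> e i \<inter> V = {}"
  shows "S \<in> Ind (V \<union> (\<Union>i<n. e i)) (C \<union> e ` {..<n}) \<longleftrightarrow>
    S \<subseteq> V \<union> (\<Union>i<n. e i) \<and> S \<inter> V \<in> Ind V C \<and> (\<forall>i<n. \<not> e i \<subseteq> S)"
proof -
  have "E \<subseteq> S \<longleftrightarrow> E \<subseteq> S \<inter> V" if "E \<in> C" for E using hypergraphD(2)[OF assms(1) that] by blast
  then have "(\<exists>E\<in>C. E \<subseteq> S) \<longleftrightarrow> (\<exists>E\<in>C. E \<subseteq> S \<inter> V)" by (intro bex_cong) simp_all
  then show ?thesis unfolding Ind_def by auto
qed

definition nonfaces :: "'a set \<Rightarrow> 'a set set \<Rightarrow> 'a set set" where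
  "nonfaces V K = {E. E \<subseteq> V \<and> E \<notin> K \<and> (\<forall>S. S \<subset> E \<longrightarrow> S \<in> K)}"

lemma hypergraph_nonfaces:
  assumes "finite V" "{} \<in> K" "\<And>v. v \<in> V \<Longrightarrow> {v} \<in> K"
  shows "hypergraph V (nonfaces V K)"
  unfolding hypergraph_def
proof (intro conjI ballI impI assms(1))
  fix E assume E: "E \<in> nonfaces V K"
  then show "E \<subseteq> V" by (simp add: nonfaces_def)
  then have fin: "finite E" using assms(1) finite_subset by blast
  have EK: "E \<notin> K" using E by (simp add: nonfaces_def)
  have "card E \<noteq> 0" using EK assms(2) fin by auto
  moreover have "card E \<noteq> 1"
  proof
    assume "card E = 1"
    then obtain v where "E = {v}" by (rule card_1_singletonE)
    then show False using EK assms(3) \<open>E \<subseteq> V\<close> by simp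
  qed
  ultimately show "2 \<le> card E" by linarith
next
  fix E E' assume "E \<in> nonfaces V K" "E' \<in> nonfaces V K" "E \<subseteq> E'"
  then show "E = E'" unfolding nonfaces_def by (metis (no_types, lifting) mem_Collect_eq psubsetI)
qed

text \<open>By finiteness every nonface contains a minimal one. So any finite complex with all its
  vertices can be realized by a hypergraph.\<close>

lemma Ind_nonfaces:
  assumes "finite V" "\<And>S. S \<in> K \<Longrightarrow> S \<subseteq> V" "\<And>S T. S \<in> K \<Longrightarrow> T \<subseteq> S \<Longrightarrow> T \<in> K"
  shows "Ind V (nonfaces V K) = K"
proof (rule Set.set_eqI)
  fix S
  show "S \<in> Ind V (nonfaces V K) \<longleftrightarrow> S \<in> K"
  proof
    assume S: "S \<in> K"
    have "\<not> E \<subseteq> S" if "E \<in> nonfaces V K" for E using that assms(3)[OF S, of E] by (auto simp: nonfaces_def)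
    then show "S \<in> Ind V (nonfaces V K)" using assms(2)[OF S] by (simp add: Ind_def)
  next
    assume S: "S \<in> Ind V (nonfaces V K)"
    show "S \<in> K"
    proof (rule ccontr)
      assume "S \<notin> K"
      have "S \<subseteq> V" using S by (simp add: Ind_def)
      have fin: "finite {T. T \<subseteq> S \<and> T \<notin> K}"
        using finite_subset[OF \<open>S \<subseteq> V\<close> assms(1)] by simp
      obtain E where E: "E \<subseteq> S" "E \<notin> K" "\<And>T. T \<subseteq> S \<Longrightarrow> T \<notin> K \<Longrightarrow> T \<subseteq> E \<Longrightarrow> E = T"
        using finite_has_minimal2[OF fin, of S] \<open>S \<notin> K\<close> by auto
      have "T \<in> K" if "T \<subset> E" for T
      proof (rule ccontr)
        assume "T \<notin> K"
        then have "E = T" using E(1) that by (intro E(3)) auto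
        then show False using that by simp
      qed
      then have "E \<in> nonfaces V K" using E(1,2) \<open>S \<subseteq> V\<close> by (simp add: nonfaces_def)
      then show False using S E(1) by (auto simp: Ind_def)
    qed
  qed
qed

text \<open>The vertices from 13 on: 13 is antipodal to the base vertex 2, and each 14 + 2 * i to its successor.\<close>

definition pairfree :: "nat set \<Rightarrow> bool" where
  "pairfree S \<longleftrightarrow> (\<forall>i. \<not> (14 + 2 * i \<in> S \<and> 15 + 2 * i \<in> S))"

text \<open>The wedge, at the vertex 2, of the acyclic complex and the cross polytope with vertex set
  T and 2.\<close>

definition wedge :: "nat set \<Rightarrow> nat set set" where
  "wedge T = {S. S \<inter> {..9} \<in> gen acyclic_facets \<and> S - {..9} \<subseteq> T \<and> (S \<inter> T \<noteq> {} \<longrightarrow> S \<inter> {..9} \<subseteq> {2})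
     \<and> \<not> {2, 13} \<subseteq> S \<and> pairfree S}"

lemma gen_mono: "S \<in> gen L \<Longrightarrow> T \<subseteq> S \<Longrightarrow> T \<in> gen L"
  unfolding gen_def by blast

lemma wedge_mono:
  assumes "S \<in> wedge T" "R \<subseteq> S" shows "R \<in> wedge T"
proof -
  have "R \<inter> {..9} \<in> gen acyclic_facets"
    by (rule gen_mono[of "S \<inter> {..9}"]) (use assms in \<open>auto simp: wedge_def\<close>)
  moreover have "pairfree R" using assms unfolding wedge_def pairfree_def by blast
  ultimately show ?thesis using assms unfolding wedge_def by blast
qed

lemma star_check: "list_all (\<lambda>u. list_ex (\<lambda>G. list_ex ((=) 2) G \<and> list_ex ((=) u) G) acyclic_facets)
    [0, 1, 2, 3, 4, 5, 6, 7, 8, 9]"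
  by code_simp

lemma star_gen: "u \<le> 9 \<Longrightarrow> {u, 2} \<in> gen acyclic_facets"
proof -
  assume "u \<le> 9"
  then have "u \<in> set [0, 1, 2, 3, 4, 5, 6, 7, 8, 9]" by (simp, arith)
  then have "list_ex (\<lambda>G. list_ex ((=) 2) G \<and> list_ex ((=) u) G) acyclic_facets"
    using star_check unfolding list_all_iff by blast
  then show ?thesis unfolding gen_def list_ex_iff by auto
qed

lemma gen_acyclic_subset: "S \<in> gen acyclic_facets \<Longrightarrow> S \<subseteq> {..9}"
proof -
  have "list_all (\<lambda>G. list_all (\<lambda>x. x \<le> 9) G) acyclic_facets" by (simp add: acyclic_facets_def)
  then show "S \<in> gen acyclic_facets \<Longrightarrow> S \<subseteq> {..9}" unfolding gen_def list_all_iff by auto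
qed

lemma empty_gen: "{} \<in> gen acyclic_facets"
  by (rule gen_mono[OF star_gen[of 0]]) auto

lemma transport_in_perms:
  assumes "u \<le> 9" "v \<le> 9" shows "transport u v \<in> set perms"
proof -
  have "transport_table ! u \<in> set transport_table" using assms table_check by simp
  then have r: "length (transport_table ! u) = 10" "\<forall>x\<in>set (transport_table ! u). x < length perms"
    using table_check unfolding list_all_iff by blast+
  then have "transport_table ! u ! v < length perms" using assms by simp
  then show ?thesis unfolding transport_def by (rule nth_mem)
qed

lemma transport_length: "u \<le> 9 \<Longrightarrow> v \<le> 9 \<Longrightarrow> length (transport u v) = 5"
  using transport_in_perms perms_check unfolding list_all_iff by blast

lemma acyclic_transport_lt:
  assumes "q < 5" shows "acyclic_transport u v q < 5"
proof (cases "u \<le> 9 \<and> v \<le> 9")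
  case True
  then have "transport u v \<in> set perms" using transport_in_perms by blast
  then have "length (transport u v) = 5" "\<forall>x\<in>set (transport u v). x < 5"
    using perms_check unfolding list_all_iff by blast+
  then show ?thesis using True assms by (simp add: acyclic_transport_def)
next
  case False
  then show ?thesis unfolding acyclic_transport_def using assms by presburger
qed

lemma id_list_nth: "q < 5 \<Longrightarrow> [0, 1, 2, 3, 4 :: nat] ! q = q"
  by (auto simp: less_Suc_eq numeral_eq_Suc)

text \<open>A simplex without vertices in T lies in a facet of A, where the table was checked. A
  simplex that meets T has at most the vertex 2 in A, so its transports are identities.\<close>

lemma cover_system_wedge:
  assumes T: "T \<subseteq> {13..}"
  shows "cover_system (wedge T) {..<5} acyclic_transport"
  unfolding cover_system_def
proof (intro allI impI)
  fix u v w q assume f: "{u, v, w} \<in> wedge T" and q: "q \<in> {..<5 :: nat}"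
  have lt: "acyclic_transport u v q \<in> {..<5}" using acyclic_transport_lt q by simp
  show "acyclic_transport u v q \<in> {..<5} \<and>
    acyclic_transport v w (acyclic_transport u v q) = acyclic_transport u w q \<and> acyclic_transport u u q = q"
  proof (cases "{u, v, w} \<inter> T = {}")
    case True
    then have s: "{u, v, w} \<subseteq> {..9}" using f unfolding wedge_def by blast
    then have eq: "{u, v, w} \<inter> {..9} = {u, v, w}" by (rule Int_absorb2)
    have "{u, v, w} \<inter> {..9} \<in> gen acyclic_facets" using f unfolding wedge_def mem_Collect_eq by (rule conjunct1)
    then obtain G where G0: "G \<in> set acyclic_facets" "{u, v, w} \<subseteq> set G"
      unfolding eq gen_def mem_Collect_eq by (rule bexE)
    then have G: "G \<in> set acyclic_facets" "u \<in> set G" "v \<in> set G" "w \<in> set G" by simp_all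
    have *: "map (nth (transport v w)) (transport u v) = transport u w" "transport u u = [0, 1, 2, 3, 4]"
      using bspec[OF bspec[OF transport_check[unfolded list_all_iff] G(1)] G(2)] G(3,4) by simp_all
    have le: "u \<le> 9" "v \<le> 9" "w \<le> 9" using s by auto
    have "transport v w ! (transport u v ! q) = transport u w ! q"
      using arg_cong[OF *(1), of "\<lambda>xs. xs ! q"] transport_length[OF le(1,2)] q by simp
    moreover have "transport u u ! q = q" unfolding *(2) by (rule id_list_nth) (use q in simp)
    ultimately show ?thesis using lt le by (simp add: acyclic_transport_def)
  next
    case False
    then have s: "{u, v, w} \<inter> {..9} \<subseteq> {2}" using f by (simp add: wedge_def)
    have t2: "transport 2 2 = [0, 1, 2, 3, 4]" by code_simp
    have id2: "transport 2 2 ! q = q" unfolding t2 by (rule id_list_nth) (use q in simp)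
    have "acyclic_transport x y q = q" if "x \<in> {u, v, w}" "y \<in> {u, v, w}" for x y
    proof (cases "x \<le> 9 \<and> y \<le> 9")
      case True
      then have "x = 2" "y = 2" using that s by auto
      then show ?thesis using id2 by (simp add: acyclic_transport_def)
    next
      case False
      then show ?thesis unfolding acyclic_transport_def by presburger
    qed
    then show ?thesis using lt by simp
  qed
qed

text \<open>The closed walk 0, 1, 2, 0, which bounds no triangle of A, has a 5-cycle as monodromy
  and thus fixes no sheet.\<close>

lemma no_section_wedge:
  assumes T: "T \<subseteq> {13..}"
  shows "\<not> cover_section (wedge T) {..<5} acyclic_transport s"
proof
  assume s: "cover_section (wedge T) {..<5} acyclic_transport s"
  have "list_all (\<lambda>F. list_ex (\<lambda>G. list_all (\<lambda>x. list_ex ((=) x) G) F) acyclic_facets) [[0, 1], [0, 2], [1, 2]]"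
    by code_simp
  then have g: "{0, 1} \<in> gen acyclic_facets" "{0, 2} \<in> gen acyclic_facets" "{1, 2} \<in> gen acyclic_facets"
    by (auto simp: gen_def list_ex_iff)
  have e: "{x, y} \<in> wedge T" if "{x, y} \<in> gen acyclic_facets" for x y
  proof -
    have "{x, y} \<subseteq> {..9}" by (rule gen_acyclic_subset[OF that])
    moreover from this have "{x, y} \<inter> {..9} = {x, y}" by blast
    ultimately show ?thesis using that T by (auto simp: wedge_def pairfree_def)
  qed
  have sec: "s y = acyclic_transport x y (s x)" "s x < 5" if "{x, y} \<in> gen acyclic_facets" for x y
    using s e[OF that] unfolding cover_section_def by auto
  have t: "transport 0 1 = [0, 1, 2, 3, 4]" "transport 0 2 = [0, 1, 2, 3, 4]" "transport 1 2 = [1, 2, 3, 4, 0]"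
    by code_simp+
  have "s 1 = s 0" "s 2 = s 0"
    using sec[OF g(1)] sec[OF g(2)] by (simp_all add: acyclic_transport_def t id_list_nth del: One_nat_def)
  moreover have "s 2 = [1, 2, 3, 4, 0] ! s 1" using sec(1)[OF g(3)] by (simp add: acyclic_transport_def t(3) del: One_nat_def)
  ultimately have "[1, 2, 3, 4, 0] ! s 0 = s 0" by simp
  moreover have "s 0 < 5" using sec(2)[OF g(1)] .
  ultimately show False by (auto simp: less_Suc_eq numeral_eq_Suc)
qed

text \<open>For j > 0 these vertices and 2 span a sphere of dimension j. The value j = 0 means no
  sphere at all, not the 0-sphere, which would disconnect the wedge.\<close>

definition sphere_vertices :: "nat \<Rightarrow> nat set" where
  "sphere_vertices j = (if j = 0 then {} else insert 13 {14..<14 + 2 * j})"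

lemma sphere_vertices_ge: "sphere_vertices j \<subseteq> {13..}"
  by (auto simp: sphere_vertices_def)

lemma wedge_hypergraph:
  fixes j :: nat
  defines "T \<equiv> sphere_vertices j"
  defines "V \<equiv> {..9} \<union> T"
  shows "hypergraph V (nonfaces V (wedge T))" "Ind V (nonfaces V (wedge T)) = wedge T"
    "psi V (nonfaces V (wedge T)) = 2"
proof -
  have T: "T \<subseteq> {13..}" "finite T" unfolding T_def by (rule sphere_vertices_ge) (simp add: sphere_vertices_def)
  have V: "finite V" using T by (simp add: V_def)
  have sub: "S \<subseteq> V" if "S \<in> wedge T" for S using that by (auto simp: wedge_def V_def)
  have "{v} \<in> wedge T" if "v \<in> V" for v
  proof (cases "v \<le> 9")
    case True
    then have "{v} \<inter> {..9} \<in> gen acyclic_facets" by (intro gen_mono[OF star_gen[OF True]]) auto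
    then show ?thesis using True T(1) by (auto simp: wedge_def pairfree_def)
  next
    case False
    then have "{v} \<inter> {..9} = {}" "v \<in> T" using that by (auto simp: V_def)
    then show ?thesis using False empty_gen by (auto simp: wedge_def pairfree_def)
  qed
  moreover have "{} \<in> wedge T" using empty_gen by (simp add: wedge_def pairfree_def)
  ultimately show h: "hypergraph V (nonfaces V (wedge T))" by (intro hypergraph_nonfaces V)
  show I: "Ind V (nonfaces V (wedge T)) = wedge T" by (rule Ind_nonfaces[OF V sub wedge_mono])
  let ?R = "{(a, b). {a, b} \<in> wedge T}"
  have r2: "(u, 2) \<in> ?R" if "u \<in> V" "u \<noteq> 13" for u
  proof (cases "u \<le> 9")
    case True
    then have "{u, 2} \<inter> {..9} = {u, 2}" by auto
    then show ?thesis using True star_gen[OF True] T(1) by (auto simp: wedge_def pairfree_def)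
  next
    case False
    then have "u \<in> T" "{u, 2} \<inter> {..9} = {2}" using that by (auto simp: V_def)
    moreover have "{2} \<in> gen acyclic_facets" using star_gen[of 2] by simp
    ultimately show ?thesis using that(2) by (auto simp: wedge_def pairfree_def)
  qed
  have to2: "(u, 2) \<in> ?R\<^sup>*" if u: "u \<in> V" for u
  proof (cases "u = 13")
    case True
    \<comment> \<open>13 is antipodal to 2 and not adjacent to it; a sphere of dimension at least 1
      also has the vertex 14, which is adjacent to both.\<close>
    then have "j \<noteq> 0" using u by (auto simp: V_def T_def sphere_vertices_def split: if_splits)
    then have m: "13 \<in> T" "14 \<in> T" by (auto simp: T_def sphere_vertices_def)
    have "{13, 14} \<inter> {..9 :: nat} = {}" by auto
    then have "(13, 14) \<in> ?R" using m empty_gen by (auto simp: wedge_def pairfree_def)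
    moreover have "(14, 2) \<in> ?R" using m by (intro r2) (auto simp: V_def)
    ultimately show ?thesis using True by (meson converse_rtrancl_into_rtrancl r_into_rtrancl)
  qed (use r2 u in blast)
  have "sym ?R" by (auto simp: sym_def insert_commute)
  then have "sym (?R\<^sup>*)" by (rule sym_rtrancl)
  then have "(u, v) \<in> ?R\<^sup>*" if "u \<in> V" "v \<in> V" for u v
    using to2[OF that(1)] to2[OF that(2)] by (meson symD rtrancl_trans)
  moreover have "V \<noteq> {}" by (auto simp: V_def)
  ultimately have "2 \<le> psi V (nonfaces V (wedge T))"
    by (intro connected_psi_ge_2 h) (simp_all add: I)
  moreover have "\<not> 3 \<le> psi V (nonfaces V (wedge T))"
  proof
    assume "3 \<le> psi V (nonfaces V (wedge T))"
    moreover have "0 \<in> {..<5 :: nat}" by simp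
    then have "{..<5 :: nat} \<noteq> {}" by blast
    ultimately show False
      using psi_ge_3_section[OF h, of "{..<5}" acyclic_transport] cover_system_wedge[OF T(1)] no_section_wedge[OF T(1)]
      unfolding I by blast
  qed
  ultimately show "psi V (nonfaces V (wedge T)) = 2"
    by (cases "psi V (nonfaces V (wedge T))") (auto simp: numeral_eq_enat)
qed

section \<open>The homotopy type\<close>

text \<open>With K the suspension of the acyclic complex, this is the iterated suspension of the wedge. The complex K
  varies inside it, and the rest of the complex meets it in the path from 10 over 2 to 11.\<close>

definition fill :: "nat set \<Rightarrow> nat set \<Rightarrow> nat set set \<Rightarrow> nat set set" where
  "fill T U K = {S. S \<inter> {..12} \<in> K \<and> S - {..12} \<subseteq> U \<and> (S \<inter> T \<noteq> {} \<longrightarrow> S \<inter> {..12} \<in> gen path_facets)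
     \<and> \<not> {2, 13} \<subseteq> S \<and> pairfree S}"

lemma fill_mono:
  assumes "\<And>S T. S \<in> K \<Longrightarrow> T \<subseteq> S \<Longrightarrow> T \<in> K" "S \<in> fill T U K" "R \<subseteq> S"
  shows "R \<in> fill T U K"
proof -
  have "R \<inter> {..12} \<in> K"
    by (rule assms(1)[of "S \<inter> {..12}"]) (use assms(2,3) in \<open>auto simp: fill_def\<close>)
  moreover have "R \<inter> {..12} \<in> gen path_facets" if "R \<inter> T \<noteq> {}"
  proof (rule gen_mono[of "S \<inter> {..12}"])
    have "S \<inter> T \<noteq> {}" using that assms(3) by blast
    then show "S \<inter> {..12} \<in> gen path_facets" using assms(2) by (simp add: fill_def)
  qed (use assms(3) in auto)
  moreover have "pairfree R" using assms(2,3) unfolding fill_def pairfree_def by blast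
  moreover have "\<not> {2, 13} \<subseteq> R" "R - {..12} \<subseteq> U" using assms(2,3) unfolding fill_def by blast+
  ultimately show ?thesis unfolding fill_def by simp
qed

lemma finite_fill:
  assumes "finite U" shows "finite (\<Union>(fill T U K))"
proof (rule finite_subset)
  show "\<Union>(fill T U K) \<subseteq> {..12} \<union> U" unfolding fill_def by blast
qed (use assms in simp)

text \<open>A simplex over s leaves the path, so it has no vertex in T. The conditions that glue the
  sphere therefore do not obstruct adding w, and a collapse of K stays a collapse of the whole
  complex.\<close>

lemma conn_fill_collapses:
  assumes U: "finite U" "T \<subseteq> U" "U \<subseteq> {13..}" "13 \<in> U \<Longrightarrow> 13 \<in> T"
    and down: "\<And>S T. S \<in> K \<Longrightarrow> T \<subseteq> S \<Longrightarrow> T \<in> K"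
    and c: "collapses (gen path_facets) K K'"
  shows "conn (realization (fill T U K)) = conn (realization (fill T U K'))"
proof -
  obtain s w where s: "s \<subseteq> {..12}" "w \<in> {..12} - s" "s \<notin> gen path_facets"
    "\<And>S. S \<in> K \<Longrightarrow> s \<subseteq> S \<Longrightarrow> insert w S \<in> K" "K' = {S \<in> K. \<not> s \<subseteq> S}"
    using c unfolding collapses_def by blast
  have eq: "s \<subseteq> S \<longleftrightarrow> s \<subseteq> S \<inter> {..12}" for S using s(1) by blast
  have star: "insert w S \<in> fill T U K" if S: "S \<in> fill T U K" "s \<subseteq> S" for S
  proof -
    have sS: "s \<subseteq> S \<inter> {..12}" using S(2) eq by blast
    then have "S \<inter> {..12} \<notin> gen path_facets" using s(3) gen_mono by blast
    then have ST: "S \<inter> T = {}" using S(1) by (auto simp: fill_def)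
    have w: "w \<le> 12" using s(2) by simp
    then have "w \<notin> T" using U by auto
    have "S - {..12} \<subseteq> U" using S(1) by (simp add: fill_def)
    \<comment> \<open>For w = 2 this keeps the antipodal pair 2, 13 out of the enlarged
      simplex.\<close>
    have "13 \<notin> S"
    proof
      assume "13 \<in> S"
      then have "13 \<in> S - {..12}" by simp
      then have "13 \<in> T" using \<open>S - {..12} \<subseteq> U\<close> U(4) by blast
      then show False using ST \<open>13 \<in> S\<close> by blast
    qed
    have "insert w (S \<inter> {..12}) \<in> K" by (rule s(4)[OF _ sS]) (use S(1) in \<open>simp add: fill_def\<close>)
    moreover have "insert w S \<inter> {..12} = insert w (S \<inter> {..12})" using w by auto
    moreover have "insert w S \<inter> T = {}" using ST \<open>w \<notin> T\<close> by blast
    moreover have "insert w S - {..12} \<subseteq> U" using S(1) w by (auto simp: fill_def)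
    moreover have "\<not> {2, 13} \<subseteq> insert w S" using w \<open>13 \<notin> S\<close> by auto
    moreover have "pairfree (insert w S)" using S(1) w by (auto simp: fill_def pairfree_def)
    ultimately show ?thesis by (auto simp: fill_def)
  qed
  have fin: "finite s" using s(1) finite_subset by blast
  have ne: "s \<noteq> {}" using s(3) by (auto simp: gen_def path_facets_def)
  have sub: "R \<in> fill T U K" if "S \<in> fill T U K" "R \<subseteq> S" for S R
    by (rule fill_mono[OF _ that]) (rule down)
  have "w \<notin> s" using s(2) by simp
  have "realization (fill T U K) homotopy_equivalent_space realization {S \<in> fill T U K. \<not> s \<subseteq> S}"
    by (rule collapse_homotopy_equivalent[OF finite_fill[OF U(1)] sub fin ne \<open>w \<notin> s\<close> star])
  moreover have "{S \<in> fill T U K. \<not> s \<subseteq> S} = fill T U K'"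
    using eq unfolding fill_def s(5) by blast
  ultimately show ?thesis using conn_homotopy_equivalent by simp
qed

lemma conn_fill_suspension:
  assumes U: "finite U" "T \<subseteq> U" "U \<subseteq> {13..}" "13 \<in> U \<Longrightarrow> 13 \<in> T"
  shows "conn (realization (fill T U (gen suspension_facets))) = conn (realization (fill T U (gen path_facets)))"
proof -
  let ?c = "conn (realization (fill T U (gen path_facets)))"
  have "conn (realization (fill T U (gen suspension_facets))) = ?c \<longleftrightarrow> ?c = ?c"
    by (rule suspension_iff_path[where Q = "\<lambda>K. conn (realization (fill T U K)) = ?c"])
       (simp add: conn_fill_collapses[OF U])
  then show ?thesis by simp
qed

lemma path_iff: "S \<inter> {..12} \<in> gen path_facets \<longleftrightarrow> S \<inter> {..9} \<subseteq> {2} \<and> 12 \<notin> S \<and> \<not> {10, 11} \<subseteq> S"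
proof
  assume "S \<inter> {..12} \<in> gen path_facets"
  then have "S \<inter> {..12} \<subseteq> {2, 10} \<or> S \<inter> {..12} \<subseteq> {2, 11}" by (simp add: gen_def path_facets_def)
  then have "\<And>x. x \<in> S \<Longrightarrow> x \<le> 12 \<Longrightarrow> x \<in> {2, 10}" if "\<not> S \<inter> {..12} \<subseteq> {2, 11}" using that by blast
  with \<open>S \<inter> {..12} \<subseteq> {2, 10} \<or> S \<inter> {..12} \<subseteq> {2, 11}\<close>
  show "S \<inter> {..9} \<subseteq> {2} \<and> 12 \<notin> S \<and> \<not> {10, 11} \<subseteq> S" by (auto simp: subset_iff)
next
  assume S: "S \<inter> {..9} \<subseteq> {2} \<and> 12 \<notin> S \<and> \<not> {10, 11} \<subseteq> S"
  have "x = 2 \<or> x = 10 \<or> x = 11" if "x \<in> S" "x \<le> 12" for x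
  proof -
    have "x \<le> 9 \<or> x = 10 \<or> x = 11 \<or> x = 12" using that by linarith
    then show ?thesis using S that by auto
  qed
  then have "S \<inter> {..12} \<subseteq> {2, 10} \<or> S \<inter> {..12} \<subseteq> {2, 11}" using S by blast
  then show "S \<inter> {..12} \<in> gen path_facets" by (simp add: gen_def path_facets_def)
qed

lemma suspension_iff:
  "S \<inter> {..12} \<in> gen suspension_facets \<longleftrightarrow> S \<inter> {..9} \<in> gen acyclic_facets \<and> 12 \<notin> S \<and> \<not> {10, 11} \<subseteq> S"
proof -
  have le: "x \<le> 9" if "G \<in> set acyclic_facets" "x \<in> set G" for G x
    using gen_acyclic_subset[of "set G"] that by (auto simp: gen_def)
  have "S \<inter> {..12} \<in> gen suspension_facets \<longleftrightarrow>
      (\<exists>G\<in>set acyclic_facets. S \<inter> {..12} \<subseteq> insert 10 (set G) \<or> S \<inter> {..12} \<subseteq> insert 11 (set G))"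
    by (simp add: gen_def suspension_facets_def bex_Un bex_disj_distrib)
  also have "\<dots> \<longleftrightarrow> (\<exists>G\<in>set acyclic_facets. S \<inter> {..9} \<subseteq> set G \<and> 12 \<notin> S \<and> \<not> {10, 11} \<subseteq> S)"
  proof (rule bex_cong[OF refl])
    fix G assume G: "G \<in> set acyclic_facets"
    have n: "10 \<notin> set G" "11 \<notin> set G" "12 \<notin> set G" using le[OF G] by force+
    show "(S \<inter> {..12} \<subseteq> insert 10 (set G) \<or> S \<inter> {..12} \<subseteq> insert 11 (set G)) \<longleftrightarrow>
        S \<inter> {..9} \<subseteq> set G \<and> 12 \<notin> S \<and> \<not> {10, 11} \<subseteq> S" (is "?l \<longleftrightarrow> ?r")
    proof
      assume l: ?l
      then obtain z where z: "z = 10 \<or> z = 11" "\<And>x. x \<in> S \<Longrightarrow> x \<le> 12 \<Longrightarrow> x = z \<or> x \<in> set G" by blast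
      have "S \<inter> {..9} \<subseteq> set G"
      proof
        fix x assume "x \<in> S \<inter> {..9}"
        then show "x \<in> set G" using z(2)[of x] z(1) by auto
      qed
      moreover have "12 \<notin> S" using z(2)[of 12] z(1) n by auto
      moreover have "\<not> {10, 11} \<subseteq> S" using z(2)[of 10] z(2)[of 11] z(1) n by auto
      ultimately show ?r by blast
    next
      assume r: ?r
      have "x \<in> set G \<or> x = 10 \<or> x = 11" if "x \<in> S" "x \<le> 12" for x
      proof -
        have "x \<le> 9 \<or> x = 10 \<or> x = 11 \<or> x = 12" using that by linarith
        then show ?thesis using r that by auto
      qed
      then show ?l using r by blast
    qed
  qed
  finally show ?thesis by (auto simp: gen_def)
qed

text \<open>Pair 0 is the suspension that makes A contractible; the later ones are numbered above
  the vertices of the sphere.\<close>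

definition pairs :: "nat \<Rightarrow> nat \<Rightarrow> nat set" where
  "pairs j i = (case i of 0 \<Rightarrow> {10, 11} | Suc i \<Rightarrow> {14 + 2 * (j + i), 15 + 2 * (j + i)})"

text \<open>The suspension points of the first suspension are 10 and 11.\<close>

lemma suspended_wedge:
  fixes j n :: nat
  defines "T \<equiv> sphere_vertices j"
  defines "U \<equiv> T \<union> {14 + 2 * j..<14 + 2 * (j + n)}"
  shows "\<exists>(V :: nat set) C. hypergraph V C \<and> psi V C = enat (n + 3) \<and>
    conn (realization (Ind V C)) = conn (realization (fill T U (gen path_facets)))"
proof -
  define V where "V = {..9} \<union> T"
  note w = wedge_hypergraph[of j, folded T_def, folded V_def]
  let ?C = "nonfaces V (wedge T)" and ?e = "pairs j"
  have T: "T \<subseteq> {13..}" "finite T" unfolding T_def by (rule sphere_vertices_ge) (simp add: sphere_vertices_def)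
  have Tlt: "x < 14 + 2 * j" if "x \<in> T" for x
    using that by (auto simp: T_def sphere_vertices_def split: if_splits)
  have card: "card (?e i) = 2" for i by (cases i) (auto simp: pairs_def)
  have dV: "?e i \<inter> V = {}" for i
    using Tlt T(1) by (cases i) (force simp: pairs_def V_def)+
  have dd: "?e i \<inter> ?e i' = {}" if ii: "i < i'" for i i'
  proof (cases i)
    case 0
    then obtain b where "i' = Suc b" using ii by (cases i') auto
    then show ?thesis using 0 by (auto simp: pairs_def)
  next
    case (Suc a)
    then obtain b where b: "i' = Suc b" "a < b" using ii by (cases i') auto
    have "14 + 2 * (j + a) \<noteq> 15 + 2 * (j + b)" "15 + 2 * (j + a) \<noteq> 14 + 2 * (j + b)" by presburger+
    then show ?thesis using b Suc by (auto simp: pairs_def)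
  qed
  let ?V = "V \<union> (\<Union>i<Suc n. ?e i)" and ?D = "?C \<union> ?e ` {..<Suc n}"
  have 1: "hypergraph ?V ?D" "psi ?V ?D = 2 + enat (Suc n)"
    using hypergraph_add_disjoint_edges[OF w(1), of "Suc n" ?e] card dV dd w(3) by simp_all
  have un: "(\<Union>i<Suc n. ?e i) = {10, 11} \<union> {14 + 2 * j..<14 + 2 * (j + n)}"
  proof -
    have "(\<Union>i<Suc n. ?e i) = {10, 11} \<union> (\<Union>i<n. {14 + 2 * (j + i), 15 + 2 * (j + i)})"
      by (simp add: lessThan_Suc_eq_insert_0 pairs_def)
    also have "(\<Union>i<n. {14 + 2 * (j + i), 15 + 2 * (j + i)}) = {14 + 2 * j..<14 + 2 * (j + n)}"
    proof (intro equalityI subsetI)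
      fix x assume x: "x \<in> {14 + 2 * j..<14 + 2 * (j + n)}"
      define i where "i = (x - (14 + 2 * j)) div 2"
      have "i < n" "x = 14 + 2 * (j + i) \<or> x = 15 + 2 * (j + i)" using x unfolding i_def by auto
      then show "x \<in> (\<Union>i<n. {14 + 2 * (j + i), 15 + 2 * (j + i)})" by auto
    qed auto
    finally show ?thesis .
  qed
  have allpairs: "(\<forall>i<Suc n. \<not> ?e i \<subseteq> S) \<longleftrightarrow> \<not> {10, 11} \<subseteq> S \<and> (\<forall>i<n. \<not> {14 + 2 * (j + i), 15 + 2 * (j + i)} \<subseteq> S)" for S
    by (simp only: All_less_Suc2) (simp add: pairs_def)
  have "Ind ?V ?D = fill T U (gen suspension_facets)"
  proof (rule Set.set_eqI)
    fix S
    have V12: "S \<subseteq> ?V \<longleftrightarrow> S - {..12} \<subseteq> U \<and> 12 \<notin> S"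
    proof -
      have "x \<in> ?V \<longleftrightarrow> x \<le> 11 \<or> x \<in> U" for x
      proof -
        have "x \<le> 11 \<longleftrightarrow> x \<le> 9 \<or> x = 10 \<or> x = 11" by linarith
        then show ?thesis unfolding un V_def U_def by auto
      qed
      moreover have "x \<le> 11 \<longleftrightarrow> x \<le> 12 \<and> x \<noteq> 12" for x :: nat by linarith
      moreover have "12 \<notin> U" using T(1) by (auto simp: U_def)
      ultimately show ?thesis by (auto simp: subset_iff)
    qed
    \<comment> \<open>Pairs with index below j belong to the sphere and are excluded by the wedge;
      those from j to j + n - 1 are the added edges.\<close>
    have pf: "pairfree (S \<inter> V) \<and> (\<forall>i<n. \<not> {14 + 2 * (j + i), 15 + 2 * (j + i)} \<subseteq> S) \<longleftrightarrow> pairfree S"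
      if "S - {..12} \<subseteq> U"
    proof
      assume l: "pairfree (S \<inter> V) \<and> (\<forall>i<n. \<not> {14 + 2 * (j + i), 15 + 2 * (j + i)} \<subseteq> S)"
      show "pairfree S" unfolding pairfree_def
      proof (intro allI notI)
        fix i assume i: "14 + 2 * i \<in> S \<and> 15 + 2 * i \<in> S"
        show False
        proof (cases "i < j")
          case True
          then have "14 + 2 * i \<in> T" "15 + 2 * i \<in> T" by (auto simp: T_def sphere_vertices_def)
          then show False using i l by (auto simp: pairfree_def V_def)
        next
          case False
          have "14 + 2 * i \<in> U" using i that by auto
          then have "i < j + n" using False Tlt[of "14 + 2 * i"] by (auto simp: U_def)
          then have "i - j < n" "j + (i - j) = i" using False by auto
          then show False using i l by (metis empty_subsetI insert_subset)
        qed
      qed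
    next
      assume p: "pairfree S"
      have "\<not> {14 + 2 * (j + i), 15 + 2 * (j + i)} \<subseteq> S" for i
        using p unfolding pairfree_def by (metis insert_subset)
      moreover have "pairfree (S \<inter> V)" using p unfolding pairfree_def by (metis IntD1)
      ultimately show "pairfree (S \<inter> V) \<and> (\<forall>i<n. \<not> {14 + 2 * (j + i), 15 + 2 * (j + i)} \<subseteq> S)" by simp
    qed
    have "S \<in> Ind ?V ?D \<longleftrightarrow> S \<subseteq> ?V \<and> S \<inter> V \<in> wedge T \<and> (\<forall>i<Suc n. \<not> ?e i \<subseteq> S)"
      using Ind_add_disjoint_edges[OF w(1) dV] unfolding w(2) .
    also have "S \<inter> V \<in> wedge T \<longleftrightarrow> S \<inter> {..9} \<in> gen acyclic_facets \<and> (S \<inter> T \<noteq> {} \<longrightarrow> S \<inter> {..9} \<subseteq> {2}) \<and>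
        \<not> {2, 13} \<subseteq> S \<inter> V \<and> pairfree (S \<inter> V)"
    proof -
      have "S \<inter> V \<inter> {..9} = S \<inter> {..9}" "S \<inter> V \<inter> T = S \<inter> T" "S \<inter> V - {..9} \<subseteq> T" by (auto simp: V_def)
      then show ?thesis unfolding wedge_def by (simp only: mem_Collect_eq simp_thms)
    qed
    also have "S \<subseteq> ?V \<and> (S \<inter> {..9} \<in> gen acyclic_facets \<and> (S \<inter> T \<noteq> {} \<longrightarrow> S \<inter> {..9} \<subseteq> {2}) \<and>
        \<not> {2, 13} \<subseteq> S \<inter> V \<and> pairfree (S \<inter> V)) \<and> (\<forall>i<Suc n. \<not> ?e i \<subseteq> S) \<longleftrightarrow> S \<in> fill T U (gen suspension_facets)"
    proof (cases "S - {..12} \<subseteq> U")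
      case True
      have "13 \<in> S \<Longrightarrow> 13 \<in> T" using True by (auto simp: U_def)
      then have "{2, 13} \<subseteq> S \<inter> V \<longleftrightarrow> {2, 13} \<subseteq> S" by (auto simp: V_def)
      then show ?thesis
        unfolding V12 allpairs fill_def mem_Collect_eq suspension_iff path_iff using pf[OF True] True by blast
    next
      case False
      then show ?thesis unfolding V12 by (simp add: fill_def)
    qed
    finally show "S \<in> Ind ?V ?D \<longleftrightarrow> S \<in> fill T U (gen suspension_facets)" .
  qed
  moreover have "conn (realization (fill T U (gen suspension_facets))) = conn (realization (fill T U (gen path_facets)))"
    by (rule conn_fill_suspension) (use T in \<open>auto simp: U_def\<close>)
  \<comment> \<open>The wedge contributes 2, the pair 10, 11 contributes 1 and the further pairs
    contribute n.\<close>
  moreover have "2 + enat (Suc n) = enat (n + 3)" by (simp add: numeral_eq_enat)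
  ultimately show ?thesis using 1 by metis
qed

text \<open>With A reduced to the path, the pairs 10, 11 and 2, 13 complete the j sphere pairs and
  the n suspension pairs to a cross polytope. The vertex 13 is present because j > 0.\<close>

lemma fill_path_cross:
  fixes j n :: nat
  assumes j: "0 < j"
  shows "fill (sphere_vertices j) (sphere_vertices j \<union> {14 + 2 * j..<14 + 2 * (j + n)}) (gen path_facets)
    = cross (\<lambda>i. if i = 0 then 10 else if i = 1 then 2 else 10 + 2 * i)
            (\<lambda>i. if i = 0 then 11 else if i = 1 then 13 else 11 + 2 * i) (2 + j + n)"
    (is "fill ?T ?U _ = cross ?a ?b ?k")
proof -
  have U: "?U = insert 13 {14..<14 + 2 * (j + n)}" using j by (auto simp: sphere_vertices_def)
  have im: "?a ` {..<?k} \<union> ?b ` {..<?k} = {2, 10, 11} \<union> ?U"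
  proof (intro equalityI subsetI)
    fix x assume "x \<in> {2, 10, 11} \<union> ?U"
    then consider "x = 10" | "x = 2" | "x = 11" | "x = 13" | "14 \<le> x" "x < 14 + 2 * (j + n)" unfolding U by auto
    then show "x \<in> ?a ` {..<?k} \<union> ?b ` {..<?k}"
    proof cases
      case 5
      \<comment> \<open>Inverts both 10 + 2 * i and 11 + 2 * i.\<close>
      define i where "i = x div 2 - 5"
      have i: "2 \<le> i" "i < ?k" "x = 10 + 2 * i \<or> x = 11 + 2 * i" using 5 unfolding i_def by auto
      then show ?thesis by (auto intro!: image_eqI[of _ _ i])
    qed (auto intro: image_eqI[of _ _ 0] image_eqI[of _ _ 1])
  next
    fix x assume "x \<in> ?a ` {..<?k} \<union> ?b ` {..<?k}"
    then show "x \<in> {2, 10, 11} \<union> ?U" unfolding U by (auto split: if_splits)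
  qed
  show ?thesis
  proof (rule Set.set_eqI)
    fix S
    have sub: "S - {..12} \<subseteq> ?U \<and> S \<inter> {..9} \<subseteq> {2} \<and> 12 \<notin> S \<longleftrightarrow> S \<subseteq> {2, 10, 11} \<union> ?U"
    proof
      assume l: "S - {..12} \<subseteq> ?U \<and> S \<inter> {..9} \<subseteq> {2} \<and> 12 \<notin> S"
      show "S \<subseteq> {2, 10, 11} \<union> ?U"
      proof
        fix x assume x: "x \<in> S"
        have "x \<le> 9 \<or> x = 10 \<or> x = 11 \<or> x = 12 \<or> \<not> x \<le> 12" by linarith
        then show "x \<in> {2, 10, 11} \<union> ?U" using l x by blast
      qed
    next
      assume r: "S \<subseteq> {2, 10, 11} \<union> ?U"
      then show "S - {..12} \<subseteq> ?U \<and> S \<inter> {..9} \<subseteq> {2} \<and> 12 \<notin> S" unfolding U by auto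
    qed
    have pf: "(\<forall>i<?k. \<not> (?a i \<in> S \<and> ?b i \<in> S)) \<longleftrightarrow> \<not> {10, 11} \<subseteq> S \<and> \<not> {2, 13} \<subseteq> S \<and> pairfree S"
      if s: "S \<subseteq> {2, 10, 11} \<union> ?U"
    proof
      assume l: "\<forall>i<?k. \<not> (?a i \<in> S \<and> ?b i \<in> S)"
      have "pairfree S" unfolding pairfree_def
      proof (intro allI notI)
        fix i assume i: "14 + 2 * i \<in> S \<and> 15 + 2 * i \<in> S"
        then have "14 + 2 * i \<in> ?U" using s by auto
        then have "i + 2 < ?k" unfolding U by auto
        then show False using l[rule_format, of "i + 2"] i by (simp add: algebra_simps)
      qed
      moreover have "\<not> {10, 11} \<subseteq> S" using l[rule_format, of 0] by simp
      moreover have "\<not> {2, 13} \<subseteq> S" using l[rule_format, of 1] by simp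
      ultimately show "\<not> {10, 11} \<subseteq> S \<and> \<not> {2, 13} \<subseteq> S \<and> pairfree S" by blast
    next
      assume r: "\<not> {10, 11} \<subseteq> S \<and> \<not> {2, 13} \<subseteq> S \<and> pairfree S"
      show "\<forall>i<?k. \<not> (?a i \<in> S \<and> ?b i \<in> S)"
      proof (intro allI impI)
        fix i :: nat
        consider "i = 0" | "i = 1" | "2 \<le> i" by linarith
        then show "\<not> (?a i \<in> S \<and> ?b i \<in> S)"
        proof cases
          case 3
          define m where "m = i - 2"
          have "i = 2 + m" using 3 by (simp add: m_def)
          then have "?a i = 14 + 2 * m" "?b i = 15 + 2 * m" by simp_all
          then show ?thesis using r unfolding pairfree_def by metis
        qed (use r in auto)
      qed
    qed
    have "S \<in> fill ?T ?U (gen path_facets) \<longleftrightarrow>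
      (S - {..12} \<subseteq> ?U \<and> S \<inter> {..9} \<subseteq> {2} \<and> 12 \<notin> S) \<and> \<not> {10, 11} \<subseteq> S \<and> \<not> {2, 13} \<subseteq> S \<and> pairfree S"
      unfolding fill_def mem_Collect_eq path_iff by blast
    also have "\<dots> \<longleftrightarrow> S \<in> cross ?a ?b ?k"
      unfolding sub cross_def mem_Collect_eq im using pf by blast
    finally show "S \<in> fill ?T ?U (gen path_facets) \<longleftrightarrow> S \<in> cross ?a ?b ?k" .
  qed
qed

lemma conn_fill_path_finite:
  assumes j: "0 < j"
  shows "conn (realization (fill (sphere_vertices j) (sphere_vertices j \<union> {14 + 2 * j..<14 + 2 * (j + n)})
      (gen path_facets))) = ereal (real (j + n))"
proof -
  have "conn (realization (cross (\<lambda>i. if i = 0 then 10 else if i = 1 then 2 else 10 + 2 * i)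
      (\<lambda>i. if i = 0 then 11 else if i = 1 then 13 else 11 + 2 * i) (2 + j + n) :: nat set set))
    = ereal (real (2 + j + n) - 2)"
  proof (rule conn_cross)
    show "(if i = 0 then 10 else if i = 1 then 2 else 10 + 2 * i) \<noteq>
        (if i' = 0 then 11 else if i' = 1 then 13 else 11 + 2 * i' :: nat)" for i i' :: nat
      by presburger
  qed (auto simp: inj_on_def split: if_splits)
  then show ?thesis unfolding fill_path_cross[OF j] by simp
qed

text \<open>Without the sphere the antipode 13 of 2 is absent, so 2 can be added to every simplex
  and the complex is a cone.\<close>

lemma conn_fill_path_infinite:
  "conn (realization (fill (sphere_vertices 0) (sphere_vertices 0 \<union> {14 + 2 * 0..<14 + 2 * (0 + n)})
      (gen path_facets))) = \<infinity>"
proof -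
  let ?K = "fill {} {14..<14 + 2 * n} (gen path_facets)"
  have fin: "finite (\<Union>?K)" by (rule finite_fill) simp
  have down: "S \<in> ?K \<Longrightarrow> R \<subseteq> S \<Longrightarrow> R \<in> ?K" for S R by (rule fill_mono[OF gen_mono])
  have star: "insert 2 S \<in> ?K" if "S \<in> ?K" for S
  proof -
    have s: "S \<inter> {..9} \<subseteq> {2} \<and> 12 \<notin> S \<and> \<not> {10, 11} \<subseteq> S" "S - {..12} \<subseteq> {14..<14 + 2 * n}" "pairfree S"
      using that unfolding fill_def path_iff by blast+
    have "13 \<notin> S" using s(2) by auto
    moreover have "pairfree (insert 2 S)" using s(3) by (auto simp: pairfree_def)
    moreover have "insert 2 S \<inter> {..12} \<in> gen path_facets" unfolding path_iff using s(1) by auto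
    ultimately show ?thesis using s(2) unfolding fill_def by auto
  qed
  have c: "contractible_space (realization ?K)" by (rule cone_contractible[OF fin down star])
  have "{2} \<in> ?K"
  proof -
    have "{} \<inter> {..12} \<in> gen path_facets" by (simp add: gen_def path_facets_def)
    then have "{} \<in> ?K" unfolding fill_def by (simp add: pairfree_def)
    then show ?thesis using star by blast
  qed
  then have "(\<lambda>v. if v = 2 then 1 else 0) \<in> topspace (realization ?K)" by (simp add: realization_def)
  then have "conn (realization ?K) = \<infinity>" using c by (intro conn_contractible) auto
  then show ?thesis by (simp add: sphere_vertices_def)
qed

theorem theorem3p8:
  fixes l k :: enat
  assumes "3 \<le> l" and "l \<le> k"
  shows "\<exists>(V :: nat set) C. hypergraph V C \<and> psi V C = l
           \<and> conn (realization (Ind V C)) = ereal_of_enat k - 2"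
proof (cases l)
  case infinity
  then have k: "k = \<infinity>" using assms(2) by simp
  have "hypergraph {0 :: nat} {}" by (simp add: hypergraph_def)
  moreover have "psi {0 :: nat} {} = l" using infinity by (simp add: psi_no_edges)
  moreover have "conn (realization (Ind {0 :: nat} {})) = \<infinity>"
  proof (rule conn_contractible)
    have I: "Ind {0 :: nat} {} = Pow {0}" by (auto simp: Ind_def)
    show "contractible_space (realization (Ind {0 :: nat} {}))"
      unfolding I by (rule cone_contractible[where w = 0]) auto
    have "(\<lambda>v. if v = 0 then 1 else 0) \<in> topspace (realization (Ind {0 :: nat} {}))"
      unfolding I by (simp add: realization_def)
    then show "topspace (realization (Ind {0 :: nat} {})) \<noteq> {}" by blast
  qed
  ultimately show ?thesis using k by (intro exI[of _ "{0}"] exI[of _ "{}"]) simp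
next
  case (enat l')
  then have "3 \<le> l'" using assms(1) by (simp add: numeral_eq_enat)
  define n where "n = l' - 3"
  have n: "l' = n + 3" using \<open>3 \<le> l'\<close> by (simp add: n_def)
  show ?thesis
  proof (cases k)
    case infinity
    then show ?thesis using suspended_wedge[of n 0] conn_fill_path_infinite[of n] enat n by auto
  next
    case (enat k')
    then have "n + 3 \<le> k'" using assms(2) \<open>l = enat l'\<close> n by simp
    \<comment> \<open>The connectivity j + n must equal k' - 2; the bound n + 3 \<le> k' makes j
      positive, so the sphere is connected.\<close>
    define j where "j = k' - n - 2"
    have j: "0 < j" "j + n + 2 = k'" using \<open>n + 3 \<le> k'\<close> by (auto simp: j_def)
    have "ereal (real (j + n)) = ereal_of_enat k - 2"
      using enat j(2) by (simp flip: j(2))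
    then show ?thesis using suspended_wedge[of n j] conn_fill_path_finite[OF j(1), of n] \<open>l = enat l'\<close> n by auto
  qed
qed

end
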